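(* There is a $2$-approximation algorithm for Undirected Multicut whose running time is $\mathrm{poly}(n, k^{O(t)})$ on instances with supply graph $G$ and $tK_2$-free demand graph $H$, where $n = |V(G)|$ and $k = |V(H)|$.
   Context: Undirected Multicut: the input is an undirected supply graph $G=(V,E)$ with nonnegative edge weights $w_e$ and an undirected simple demand graph $H$ whose vertices are vertices of $G$. A feasible solution is a set $E' \subseteq E$ such that for every edge $st$ of $H$ there is no path from $s$ to $t$ in $G - E'$; the goal is to minimize $\sum_{e\in E'} w_e$. An $\alpha$-approximation algorithm returns a feasible solution of weight at most $\alpha$ times the optimum. For an integer $t>1$, a graph is $tK_2$-free if it does not contain a matching with $t$ edges as an induced subgraph (i.e. there are no $t$ edges of the graph whose $2t$ endpoints are distinct and such that the subgraph induced on these $2t$ vertices consists of exactly these $t$ edges). *)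

theory Defs
  imports Complex_Main
begin

section \<open>Undirected Multicut\<close>

text \<open>
  The vertices of the supply graph are numbered, \<open>V(G) = {..<nverts I}\<close>. Both graphs are finite
  simple graphs; an undirected edge is the two-element set of its endpoints.
\<close>

definition all_pairs :: "nat set \<Rightarrow> nat set set" where
  "all_pairs V = {{u, v} | u v. u \<in> V \<and> v \<in> V \<and> u \<noteq> v}"

record multicut =
  nverts :: nat
  edges :: "nat set set"
  weight :: "nat set \<Rightarrow> real"
  dverts :: "nat set"
  dedges :: "nat set set"

definition valid_instance :: "multicut \<Rightarrow> bool" where
  "valid_instance I \<longleftrightarrow>
     edges I \<subseteq> all_pairs {..<nverts I} \<and>
     (\<forall>e\<in>edges I. 0 \<le> weight I e) \<and>
     dverts I \<subseteq> {..<nverts I} \<and>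
     dedges I \<subseteq> all_pairs (dverts I)"

definition is_path :: "nat set set \<Rightarrow> nat \<Rightarrow> nat list \<Rightarrow> nat \<Rightarrow> bool" where
  "is_path E s p t \<longleftrightarrow>
     p \<noteq> [] \<and> hd p = s \<and> last p = t \<and> distinct p \<and> successively (\<lambda>u v. {u, v} \<in> E) p"

definition feasible :: "multicut \<Rightarrow> nat set set \<Rightarrow> bool" where
  "feasible I F \<longleftrightarrow>
     F \<subseteq> edges I \<and>
     (\<forall>s t. {s, t} \<in> dedges I \<longrightarrow> \<not> (\<exists>p. is_path (edges I - F) s p t))"

definition cost :: "multicut \<Rightarrow> nat set set \<Rightarrow> real" where
  "cost I F = (\<Sum>e\<in>F. weight I e)"

definition opt :: "multicut \<Rightarrow> real" where
  "opt I = Min (cost I ` {F. feasible I F})"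

definition tK2_free :: "nat \<Rightarrow> nat set set \<Rightarrow> bool" where
  "tK2_free t E \<longleftrightarrow>
     \<not> (\<exists>M\<subseteq>E. finite M \<and> card M = t \<and> card (\<Union>M) = 2 * t \<and> {e \<in> E. e \<subseteq> \<Union>M} = M)"

text \<open>The minimum in \<^const>\<open>opt\<close> is over a finite nonempty set.\<close>

lemma finite_all_pairs: "finite V \<Longrightarrow> finite (all_pairs V)"
  by (rule finite_subset[of _ "Pow V"]) (auto simp: all_pairs_def)

lemma finite_feasible:
  assumes "valid_instance I"
  shows "finite {F. feasible I F}"
proof (rule finite_subset)
  show "{F. feasible I F} \<subseteq> Pow (edges I)"
    by (auto simp: feasible_def)
  show "finite (Pow (edges I))"
    using assms finite_all_pairs[of "{..<nverts I}"]
    by (auto simp: valid_instance_def intro: finite_subset)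
qed

lemma feasible_all_edges:
  assumes "valid_instance I"
  shows "feasible I (edges I)"
proof -
  have "\<not> is_path {} s p t" if "{s, t} \<in> dedges I" for s p t
  proof
    assume p: "is_path {} s p t"
    have "{s, t} \<in> all_pairs (dverts I)"
      using that assms by (auto simp: valid_instance_def)
    hence "s \<noteq> t"
      by (auto simp: all_pairs_def doubleton_eq_iff)
    with p show False
      by (cases p rule: remdups_adj.cases) (auto simp: is_path_def)
  qed
  thus ?thesis
    by (auto simp: feasible_def)
qed

section \<open>Model of computation\<close>

text \<open>
  Algorithms are programs for a real RAM, given as While programs over finitely many named arrays of
  natural numbers and finitely many named arrays of reals (a scalar is cell 0 of an array). Real
  numbers are subject to field operations and comparison at unit cost, without rounding or any other
  conversion to natural numbers, and the only numeric literals are natural numbers, so that no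
  information can be hidden in a real constant. On natural numbers, which also serve as array
  indices, only addition and truncated subtraction have unit cost: after \<open>T\<close> steps a natural number
  has \<open>O(T)\<close> more bits than the initial ones, hence there is no speed-up by arithmetic on long
  numbers.

  Expressions occur literally in the program, so their size is a constant of the program; evaluating
  one is charged as part of the step in which it occurs.
\<close>

datatype nexp =
    NConst nat
  | NCell nat nexp
  | NAdd nexp nexp
  | NSub nexp nexp

datatype rexp =
    ROfNat nexp
  | RCell nat nexp
  | RAdd rexp rexp
  | RSub rexp rexp
  | RMul rexp rexp
  | RDiv rexp rexp

datatype bexp =
    NLess nexp nexp
  | RLess rexp rexp
  | BNot bexp
  | BAnd bexp bexp

datatype com =
    Skip
  | NStore nat nexp nexp
  | RStore nat nexp rexp
  | Seq com com
  | Cond bexp com com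
  | While bexp com

record state =
  nmem :: "nat \<Rightarrow> nat \<Rightarrow> nat"
  rmem :: "nat \<Rightarrow> nat \<Rightarrow> real"

fun nval :: "nexp \<Rightarrow> state \<Rightarrow> nat" where
  "nval (NConst c) s = c"
| "nval (NCell a i) s = nmem s a (nval i s)"
| "nval (NAdd x y) s = nval x s + nval y s"
| "nval (NSub x y) s = nval x s - nval y s"

fun rval :: "rexp \<Rightarrow> state \<Rightarrow> real" where
  "rval (ROfNat x) s = real (nval x s)"
| "rval (RCell a i) s = rmem s a (nval i s)"
| "rval (RAdd x y) s = rval x s + rval y s"
| "rval (RSub x y) s = rval x s - rval y s"
| "rval (RMul x y) s = rval x s * rval y s"
| "rval (RDiv x y) s = rval x s / rval y s"

fun bval :: "bexp \<Rightarrow> state \<Rightarrow> bool" where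
  "bval (NLess x y) s \<longleftrightarrow> nval x s < nval y s"
| "bval (RLess x y) s \<longleftrightarrow> rval x s < rval y s"
| "bval (BNot b) s \<longleftrightarrow> \<not> bval b s"
| "bval (BAnd b c) s \<longleftrightarrow> bval b s \<and> bval c s"

definition nupdate :: "nat \<Rightarrow> nat \<Rightarrow> nat \<Rightarrow> state \<Rightarrow> state" where
  "nupdate a i x s = s\<lparr>nmem := (nmem s)(a := (nmem s a)(i := x))\<rparr>"

definition rupdate :: "nat \<Rightarrow> nat \<Rightarrow> real \<Rightarrow> state \<Rightarrow> state" where
  "rupdate a i x s = s\<lparr>rmem := (rmem s)(a := (rmem s a)(i := x))\<rparr>"

text \<open>
  \<open>exec c s T s'\<close>: started in \<open>s\<close>, the program \<open>c\<close> halts in \<open>s'\<close> after exactly \<open>T\<close> steps, counting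
  every assignment, every \<open>Skip\<close> and every evaluation of a test.
\<close>

inductive exec :: "com \<Rightarrow> state \<Rightarrow> nat \<Rightarrow> state \<Rightarrow> bool" where
  Skip: "exec Skip s 1 s"
| NStore: "exec (NStore a i x) s 1 (nupdate a (nval i s) (nval x s) s)"
| RStore: "exec (RStore a i x) s 1 (rupdate a (nval i s) (rval x s) s)"
| Seq: "exec c\<^sub>1 s T\<^sub>1 s' \<Longrightarrow> exec c\<^sub>2 s' T\<^sub>2 s'' \<Longrightarrow> exec (Seq c\<^sub>1 c\<^sub>2) s (T\<^sub>1 + T\<^sub>2) s''"
| CondTrue: "bval b s \<Longrightarrow> exec c\<^sub>1 s T s' \<Longrightarrow> exec (Cond b c\<^sub>1 c\<^sub>2) s (T + 1) s'"
| CondFalse: "\<not> bval b s \<Longrightarrow> exec c\<^sub>2 s T s' \<Longrightarrow> exec (Cond b c\<^sub>1 c\<^sub>2) s (T + 1) s'"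
| WhileFalse: "\<not> bval b s \<Longrightarrow> exec (While b c) s 1 s"
| WhileTrue: "bval b s \<Longrightarrow> exec c s T\<^sub>1 s' \<Longrightarrow> exec (While b c) s' T\<^sub>2 s'' \<Longrightarrow>
    exec (While b c) s (T\<^sub>1 + T\<^sub>2 + 1) s''"

inductive_cases SkipE: "exec Skip s T s'"
inductive_cases NStoreE: "exec (NStore a i x) s T s'"
inductive_cases RStoreE: "exec (RStore a i x) s T s'"
inductive_cases SeqE: "exec (Seq c\<^sub>1 c\<^sub>2) s T s'"
inductive_cases CondE: "exec (Cond b c\<^sub>1 c\<^sub>2) s T s'"
inductive_cases WhileE: "exec (While b c) s T s'"

theorem exec_deterministic:
  "exec c s T s' \<Longrightarrow> exec c s U u \<Longrightarrow> U = T \<and> u = s'"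
proof (induction arbitrary: U u rule: exec.induct)
  case (Seq c\<^sub>1 s T\<^sub>1 s' c\<^sub>2 T\<^sub>2 s'')
  obtain U\<^sub>1 u' U\<^sub>2 where "exec c\<^sub>1 s U\<^sub>1 u'" "exec c\<^sub>2 u' U\<^sub>2 u" "U = U\<^sub>1 + U\<^sub>2"
    using Seq.prems by (rule SeqE)
  thus ?case
    using Seq.IH by metis
next
  case (CondTrue b s c\<^sub>1 T s' c\<^sub>2)
  from CondTrue.prems show ?case
    by (rule CondE) (use CondTrue.hyps in \<open>auto dest: CondTrue.IH\<close>)
next
  case (CondFalse b s c\<^sub>2 T s' c\<^sub>1)
  from CondFalse.prems show ?case
    by (rule CondE) (use CondFalse.hyps in \<open>auto dest: CondFalse.IH\<close>)
next
  case (WhileFalse b s c)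
  from WhileFalse.prems show ?case
    by (rule WhileE) (use WhileFalse.hyps in auto)
next
  case (WhileTrue b s c T\<^sub>1 s' T\<^sub>2 s'')
  from WhileTrue.prems obtain U\<^sub>1 u' U\<^sub>2
    where "exec c s U\<^sub>1 u'" "exec (While b c) u' U\<^sub>2 u" "U = U\<^sub>1 + U\<^sub>2 + 1"
    by (rule WhileE) (use WhileTrue.hyps in auto)
  thus ?case
    using WhileTrue.IH by metis
qed (auto elim: SkipE NStoreE RStoreE)

section \<open>Algorithms for Undirected Multicut\<close>

text \<open>
  Input: the number \<open>n\<close> of vertices in cell 0 of array 0; the adjacency matrix of \<open>G\<close> in array 1;
  the characteristic vector of \<open>V(H)\<close> in array 2; the adjacency matrix of \<open>H\<close> in array 3; the weight
  matrix in real array 0. Matrices are stored row by row, with entry \<open>(u, v)\<close> at index \<open>u * n + v\<close>.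
  All other cells contain 0.
\<close>

definition row_major :: "nat \<Rightarrow> (nat \<Rightarrow> nat \<Rightarrow> 'a::zero) \<Rightarrow> nat \<Rightarrow> 'a" where
  "row_major n A i = (if i < n * n then A (i div n) (i mod n) else 0)"

definition input_state :: "multicut \<Rightarrow> state" where
  "input_state I =
     (let n = nverts I in
      \<lparr>nmem = (\<lambda>_ _. 0)
         (0 := (\<lambda>_. 0)(0 := n),
          1 := row_major n (\<lambda>u v. of_bool ({u, v} \<in> edges I)),
          2 := (\<lambda>v. of_bool (v \<in> dverts I)),
          3 := row_major n (\<lambda>u v. of_bool ({u, v} \<in> dedges I))),
       rmem = (\<lambda>_ _. 0)
         (0 := row_major n (\<lambda>u v. if {u, v} \<in> edges I then weight I {u, v} else 0))\<rparr>)"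

text \<open>
  Output: a matrix in array 4 whose nonzero entries \<open>(u, v)\<close> mark the edges \<open>{u, v}\<close> of the
  solution.
\<close>

definition output_edges :: "multicut \<Rightarrow> state \<Rightarrow> nat set set" where
  "output_edges I s =
     {{u, v} | u v. u < nverts I \<and> v < nverts I \<and> nmem s 4 (u * nverts I + v) \<noteq> 0}"

definition approx_algorithm :: "real \<Rightarrow> com \<Rightarrow> bool" where
  "approx_algorithm \<alpha> P \<longleftrightarrow>
     (\<forall>I. valid_instance I \<longrightarrow>
        (\<exists>T s. exec P (input_state I) T s \<and>
           feasible I (output_edges I s) \<and>
           cost I (output_edges I s) \<le> \<alpha> * opt I))"

text \<open>Meaningful for halting programs only; well defined by \<open>exec_deterministic\<close>.\<close>

definition running_time :: "com \<Rightarrow> multicut \<Rightarrow> nat" where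
  "running_time P I = (THE T. \<exists>s. exec P (input_state I) T s)"

lemma running_time_eq: "exec P (input_state I) T s \<Longrightarrow> running_time P I = T"
  unfolding running_time_def by (rule the_equality) (auto dest: exec_deterministic)

end

theory Submission
  imports Defs "HOL-Library.FuncSet"
begin

text \<open>
  Cutting the edges between differently labelled vertices reduces the problem to labelling every
  vertex of \<open>G\<close> with a maximal independent set of \<open>H\<close> that contains it (non-terminals being isolated
  in \<open>H\<close>), where an edge costs its weight if its ends have different labels. A \<open>tK\<^sub>2\<close>-free graph has
  only \<open>k\<^bsup>O(t)\<^esup>\<close> maximal independent sets, and they are enumerated by adding the vertices one by one.

  The labelling problem is solved by local search. A move gives the vertices of some set a common
  new label; the best move for a given label is a minimum cut. With \<open>L\<close> labels, comparison with the
  classes of an optimal labelling shows that the best move shrinks \<open>g = cost - 2 * optimum\<close> by the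
  factor \<open>1 - 1 / L\<close> as long as \<open>g > 0\<close>. Since \<open>g\<close> is a combination of the weights with
  coefficients in \<open>{-2, .., 1}\<close>, it can be halved only polynomially often before it becomes
  nonpositive, however large or small the weights are. Hence the ratio is exactly 2 after a
  strongly polynomial number of moves.
\<close>

section \<open>Maximal independent sets\<close>

definition independent :: "'a set set \<Rightarrow> 'a set \<Rightarrow> bool" where
  "independent E S \<longleftrightarrow> (\<forall>u\<in>S. \<forall>v\<in>S. {u, v} \<notin> E)"

definition nonneighbours :: "'a set set \<Rightarrow> 'a \<Rightarrow> 'a set \<Rightarrow> 'a set" where
  "nonneighbours E v V = {u \<in> V. {u, v} \<notin> E}"

definition mis :: "'a set set \<Rightarrow> 'a set \<Rightarrow> 'a set set" where
  "mis E V = {M. M \<subseteq> V \<and> (\<forall>v\<in>V. v \<in> M \<longleftrightarrow> (\<forall>u\<in>M. {u, v} \<notin> E))}"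

definition mis_exchange :: "'a set set \<Rightarrow> 'a \<Rightarrow> 'a set \<Rightarrow> 'a set" where
  "mis_exchange E v M = insert v (nonneighbours E v M)"

lemma mis_subset: "M \<in> mis E V \<Longrightarrow> M \<subseteq> V"
  by (simp add: mis_def)

lemma mis_mem_iff: "M \<in> mis E V \<Longrightarrow> v \<in> V \<Longrightarrow> v \<in> M \<longleftrightarrow> (\<forall>u\<in>M. {u, v} \<notin> E)"
  by (simp add: mis_def)

lemma mis_independent: "M \<in> mis E V \<Longrightarrow> independent E M"
  by (auto simp: mis_def independent_def)

lemma finite_mis: "finite V \<Longrightarrow> finite (mis E V)"
  by (rule finite_subset[of _ "Pow V"]) (auto simp: mis_def)

lemma mis_empty: "mis E {} = {{}}"
  by (auto simp: mis_def)

lemma mis_of_independent: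
  assumes "independent E V"
  shows "mis E V = {V}"
proof
  have "M = V" if "M \<in> mis E V" for M
    using that assms unfolding mis_def independent_def by blast
  thus "mis E V \<subseteq> {V}"
    by blast
  show "{V} \<subseteq> mis E V"
    using assms by (auto simp: mis_def independent_def)
qed

lemma independent_subset_mis:
  assumes "finite V" "S \<subseteq> V" "independent E S" and no_loop: "\<And>v. {v} \<notin> E"
  obtains M where "M \<in> mis E V" "S \<subseteq> M"
proof -
  define A where "A = {M. S \<subseteq> M \<and> M \<subseteq> V \<and> independent E M}"
  have "finite A"
    using assms(1) by (auto simp: A_def intro: finite_subset[of _ "Pow V"])
  moreover have "S \<in> A"
    using assms by (simp add: A_def)
  ultimately obtain M where "M \<in> A" and max: "\<And>B. B \<in> A \<Longrightarrow> M \<subseteq> B \<Longrightarrow> M = B"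
    by (metis finite_has_maximal2)
  hence M: "S \<subseteq> M" "M \<subseteq> V" "independent E M"
    by (simp_all add: A_def)
  have "v \<in> M" if "v \<in> V" "\<forall>u\<in>M. {u, v} \<notin> E" for v
  proof -
    have "independent E (insert v M)"
      using M(3) that(2) no_loop by (auto simp: independent_def insert_commute)
    thus ?thesis
      using max[of "insert v M"] M(1,2) that(1) by (auto simp: A_def)
  qed
  hence "M \<in> mis E V"
    using M(2,3) by (auto simp: mis_def independent_def)
  with M(1) show ?thesis
    by (rule that[rotated])
qed

lemma mis_covers:
  assumes "finite V" "v \<in> V" "\<And>u. {u} \<notin> E"
  shows "\<exists>M\<in>mis E V. v \<in> M"
  by (rule independent_subset_mis[of V "{v}" E]) (use assms in \<open>auto simp: independent_def\<close>)

lemma mis_exchange_eqI: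
  assumes M: "M \<in> mis E (insert v V)" "v \<in> M" and N: "N \<in> mis E V" "M - {v} \<subseteq> N"
  shows "mis_exchange E v N = M"
proof -
  have "u \<in> M" if u: "u \<in> N" "{u, v} \<notin> E" for u
  proof -
    have "u \<in> insert v V"
      using mis_subset[OF N(1)] u(1) by blast
    moreover have "{x, u} \<notin> E" if "x \<in> M" for x
    proof (cases "x = v")
      case True
      thus ?thesis
        using u(2) by (simp add: insert_commute)
    next
      case False
      hence "x \<in> N"
        using that N(2) by blast
      thus ?thesis
        using mis_independent[OF N(1)] u(1) by (simp add: independent_def)
    qed
    ultimately show ?thesis
      using mis_mem_iff[OF M(1)] by blast
  qed
  moreover have "u \<in> N \<and> {u, v} \<notin> E" if "u \<in> M" "u \<noteq> v" for u
    using that N(2) mis_independent[OF M(1)] M(2) by (auto simp: independent_def)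
  ultimately show ?thesis
    using M(2) unfolding mis_exchange_def nonneighbours_def by blast
qed

lemma mis_insert_subset:
  assumes "finite V" and no_loop: "\<And>u. {u} \<notin> E"
  shows "mis E (insert v V) \<subseteq> mis E V \<union> mis_exchange E v ` mis E V"
proof
  fix M assume M: "M \<in> mis E (insert v V)"
  show "M \<in> mis E V \<union> mis_exchange E v ` mis E V"
  proof (cases "v \<in> M")
    case False
    thus ?thesis
      using M by (auto simp: mis_def)
  next
    case True
    have "M - {v} \<subseteq> V" "independent E (M - {v})"
      using mis_subset[OF M] mis_independent[OF M] by (auto simp: independent_def)
    then obtain N where N: "N \<in> mis E V" "M - {v} \<subseteq> N"
      using independent_subset_mis[OF assms(1)] no_loop by metis
    with mis_exchange_eqI[OF M True N] show ?thesis
      by blast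
  qed
qed

lemma card_mis_insert_le_double:
  assumes "finite V" "\<And>u. {u} \<notin> E"
  shows "card (mis E (insert v V)) \<le> 2 * card (mis E V)"
proof -
  have fin: "finite (mis E V)"
    using assms(1) by (rule finite_mis)
  have "card (mis E (insert v V)) \<le> card (mis E V \<union> mis_exchange E v ` mis E V)"
    using fin by (intro card_mono mis_insert_subset assms) auto
  also have "\<dots> \<le> card (mis E V) + card (mis_exchange E v ` mis E V)"
    by (rule card_Un_le)
  also have "\<dots> \<le> card (mis E V) + card (mis E V)"
    using fin by (intro add_left_mono card_image_le)
  finally show ?thesis
    by simp
qed

lemma card_mis_isolated_le:
  assumes "finite V" "\<And>e. e \<in> E \<Longrightarrow> e \<subseteq> D"
  shows "card (mis E V) \<le> card (mis E (V \<inter> D))"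
proof (rule card_inj_on_le)
  have isolated: "M - D = V - D" if "M \<in> mis E V" for M
    using that assms(2) by (fastforce simp: mis_def)
  show "inj_on (\<lambda>M. M \<inter> D) (mis E V)"
  proof (rule inj_onI)
    fix M N assume "M \<in> mis E V" "N \<in> mis E V" "M \<inter> D = N \<inter> D"
    thus "M = N"
      using isolated[of M] isolated[of N] by blast
  qed
  show "(\<lambda>M. M \<inter> D) ` mis E V \<subseteq> mis E (V \<inter> D)"
    using assms(2) by (fastforce simp: mis_def)
  show "finite (mis E (V \<inter> D))"
    using assms(1) by (simp add: finite_mis)
qed

subsection \<open>Graphs without large induced matchings\<close>

definition induced_matching :: "'a set set \<Rightarrow> 'a set set \<Rightarrow> bool" where
  "induced_matching E M \<longleftrightarrow>
     M \<subseteq> E \<and> finite M \<and> card (\<Union>M) = 2 * card M \<and> {e \<in> E. e \<subseteq> \<Union>M} = M"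

lemma tK2_free_iff_induced_matching:
  "tK2_free t E \<longleftrightarrow> \<not> (\<exists>M. induced_matching E M \<and> card M = t)"
  by (auto simp: tK2_free_def induced_matching_def)

lemma induced_matching_edge:
  assumes "\<And>e. e \<in> E \<Longrightarrow> card e = 2" "e \<in> E"
  shows "induced_matching E {e}"
proof -
  have "f = e" if "f \<in> E" "f \<subseteq> e" for f
    using that assms by (metis card_subset_eq card.infinite zero_neq_numeral)
  thus ?thesis
    using assms by (auto simp: induced_matching_def)
qed

lemma induced_matching_insert:
  assumes edges: "\<And>e. e \<in> E \<Longrightarrow> card e = 2"
    and v: "v \<notin> V" and w: "w \<in> V" "{v, w} \<in> E"
    and M: "induced_matching E M" "\<Union>M \<subseteq> nonneighbours E w (nonneighbours E v V)"
  shows "induced_matching E (insert {v, w} M)" "card (insert {v, w} M) = Suc (card M)"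
proof -
  let ?M = "insert {v, w} M"
  have far: "{z, v} \<notin> E" "{z, w} \<notin> E" "z \<in> V" if "z \<in> \<Union>M" for z
    using M(2) that by (auto simp: nonneighbours_def)
  have notin: "v \<notin> \<Union>M" "w \<notin> \<Union>M"
    using far(1)[of w] far(3)[of v] v w by (auto simp: insert_commute)
  show card_insert: "card ?M = Suc (card M)"
    using M(1) notin by (auto simp: induced_matching_def card_insert_if)
  have "v \<noteq> w"
    using v w by auto
  moreover have "finite (\<Union>M)"
    using M(1) edges by (force simp: induced_matching_def intro: card_ge_0_finite)
  ultimately have card: "card (\<Union>?M) = 2 * card ?M"
    using M(1) notin card_insert by (simp add: induced_matching_def)
  have "e \<in> ?M" if e: "e \<in> E" "e \<subseteq> \<Union>?M" for e
  proof -
    obtain x y where xy: "e = {x, y}" "x \<noteq> y"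
      using edges[OF e(1)] by (auto simp: card_2_iff)
    have swap: "{y, x} \<in> E"
      using e(1) xy by (simp add: insert_commute)
    consider (old) "x \<in> \<Union>M" "y \<in> \<Union>M" | (new) "x \<in> {v, w}" "y \<in> {v, w}"
      using e xy far(1,2)[of x] far(1,2)[of y] swap by auto
    thus ?thesis
    proof cases
      case old
      hence "e \<subseteq> \<Union>M"
        using xy(1) by blast
      thus ?thesis
        using M(1) e(1) by (auto simp: induced_matching_def)
    next
      case new
      thus ?thesis
        using xy by auto
    qed
  qed
  moreover have "?M \<subseteq> E" "finite ?M"
    using M(1) w(2) by (auto simp: induced_matching_def)
  ultimately show "induced_matching E ?M"
    using card by (auto simp: induced_matching_def)
qed

lemma mis_insert_delete_cases:
  assumes v: "v \<notin> V" and M: "M \<in> mis E (insert v V)" and nonmaximal: "M - {v} \<notin> mis E V"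
  obtains w where "w \<in> V" "{v, w} \<in> E" "M - {v} \<in> mis E (nonneighbours E w (nonneighbours E v V))"
proof -
  note indep = mis_independent[OF M, unfolded independent_def]
  note mem_iff = mis_mem_iff[OF M]
  have "v \<in> M"
  proof (rule ccontr)
    assume "v \<notin> M"
    hence "M - {v} \<in> mis E V"
      using M by (auto simp: mis_def)
    with nonmaximal show False ..
  qed
  have sub: "M - {v} \<subseteq> V"
    using mis_subset[OF M] by blast
  then obtain w where w: "w \<in> V" "\<not> (w \<in> M - {v} \<longleftrightarrow> (\<forall>u\<in>M - {v}. {u, w} \<notin> E))"
    using nonmaximal unfolding mis_def by blast
  have "w \<notin> M" "\<forall>u\<in>M - {v}. {u, w} \<notin> E"
    using w v indep by blast+
  moreover from this have "{v, w} \<in> E"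
    using mem_iff[of w] w(1) by blast
  moreover have "M - {v} \<in> mis E (nonneighbours E w (nonneighbours E v V))"
    unfolding mis_def
  proof (intro CollectI conjI ballI)
    show "M - {v} \<subseteq> nonneighbours E w (nonneighbours E v V)"
      using calculation(2) indep \<open>v \<in> M\<close> sub by (auto simp: nonneighbours_def)
    fix x assume x: "x \<in> nonneighbours E w (nonneighbours E v V)"
    hence "x \<in> V" "x \<noteq> v" "{v, x} \<notin> E"
      using v by (auto simp: nonneighbours_def insert_commute)
    thus "x \<in> M - {v} \<longleftrightarrow> (\<forall>u\<in>M - {v}. {u, x} \<notin> E)"
      using mem_iff[of x] by blast
  qed
  ultimately show ?thesis
    using w(1) by (intro that)
qed

lemma inj_on_delete_mis:
  assumes no_loop: "\<And>u. {u} \<notin> E"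
  shows "inj_on (\<lambda>M. M - {v}) (mis E (insert v V))"
proof (rule inj_onI)
  fix M N assume MN: "M \<in> mis E (insert v V)" "N \<in> mis E (insert v V)" "M - {v} = N - {v}"
  have "v \<in> M \<longleftrightarrow> (\<forall>u\<in>M - {v}. {u, v} \<notin> E)" "v \<in> N \<longleftrightarrow> (\<forall>u\<in>N - {v}. {u, v} \<notin> E)"
    using mis_mem_iff[OF MN(1), of v] mis_mem_iff[OF MN(2), of v] no_loop by auto
  hence "v \<in> M \<longleftrightarrow> v \<in> N"
    by (simp only: MN(3))
  thus "M = N"
    using MN(3) by blast
qed

lemma card_mis_insert_le:
  assumes fin: "finite V" and v: "v \<notin> V" and no_loop: "\<And>u. {u} \<notin> E"
  shows "card (mis E (insert v V)) \<le> card (mis E V) +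
    (\<Sum>w | w \<in> V \<and> {v, w} \<in> E. card (mis E (nonneighbours E w (nonneighbours E v V))))"
proof -
  let ?N = "{w. w \<in> V \<and> {v, w} \<in> E}"
  let ?V = "\<lambda>w. nonneighbours E w (nonneighbours E v V)"
  have fin_V: "finite (?V w)" for w
    using fin by (simp add: nonneighbours_def)
  have "card (mis E (insert v V)) \<le> card (mis E V \<union> (\<Union>w\<in>?N. mis E (?V w)))"
  proof (rule card_inj_on_le[OF inj_on_delete_mis[OF no_loop]])
    show "(\<lambda>M. M - {v}) ` mis E (insert v V) \<subseteq> mis E V \<union> (\<Union>w\<in>?N. mis E (?V w))"
      using mis_insert_delete_cases[OF v] by blast
    show "finite (mis E V \<union> (\<Union>w\<in>?N. mis E (?V w)))"
      using fin fin_V by (auto intro: finite_mis)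
  qed
  also have "\<dots> \<le> card (mis E V) + card (\<Union>w\<in>?N. mis E (?V w))"
    by (rule card_Un_le)
  also have "card (\<Union>w\<in>?N. mis E (?V w)) \<le> (\<Sum>w\<in>?N. card (mis E (?V w)))"
    using fin fin_V by (intro card_UN_le) auto
  finally show ?thesis
    by simp
qed

lemma square_power_recurrence:
  "(k\<^sup>2 + 1) ^ Suc t + k * (k\<^sup>2 + 1) ^ t \<le> ((Suc k)\<^sup>2 + 1) ^ Suc t"
proof -
  have "(k\<^sup>2 + 1) ^ Suc t + k * (k\<^sup>2 + 1) ^ t = (k\<^sup>2 + 1) ^ t * (k\<^sup>2 + 1 + k)"
    by (simp add: algebra_simps)
  also have "\<dots> \<le> ((Suc k)\<^sup>2 + 1) ^ t * ((Suc k)\<^sup>2 + 1)"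
    by (intro mult_mono power_mono) (auto simp: power2_eq_square)
  finally show ?thesis
    by (simp add: mult.commute)
qed

lemma card_mis_insert_power_le:
  assumes V: "finite V" "v \<notin> V" and no_loop: "\<And>u. {u} \<notin> E"
    and delete: "card (mis E V) \<le> ((card V)\<^sup>2 + 1) ^ Suc t"
    and delete_edge: "\<And>w. w \<in> V \<Longrightarrow> {v, w} \<in> E \<Longrightarrow>
      card (mis E (nonneighbours E w (nonneighbours E v V))) \<le> ((card V)\<^sup>2 + 1) ^ t"
  shows "card (mis E (insert v V)) \<le> ((Suc (card V))\<^sup>2 + 1) ^ Suc t"
proof -
  let ?k = "card V" and ?N = "{w. w \<in> V \<and> {v, w} \<in> E}"
  let ?mis = "\<lambda>w. mis E (nonneighbours E w (nonneighbours E v V))"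
  have "(\<Sum>w\<in>?N. card (?mis w)) \<le> card ?N * (?k\<^sup>2 + 1) ^ t"
    using sum_bounded_above[of ?N "\<lambda>w. card (?mis w)"] delete_edge by simp
  also have "\<dots> \<le> ?k * (?k\<^sup>2 + 1) ^ t"
    using V(1) by (intro mult_right_mono card_mono) auto
  finally have "card (mis E (insert v V)) \<le> (?k\<^sup>2 + 1) ^ Suc t + ?k * (?k\<^sup>2 + 1) ^ t"
    using card_mis_insert_le[OF V no_loop] delete by linarith
  also note square_power_recurrence
  finally show ?thesis .
qed

lemma card_induced_matching_nonneighbours_neq:
  assumes edges: "\<And>e. e \<in> E \<Longrightarrow> card e = 2"
    and v: "v \<notin> V" and w: "w \<in> V" "{v, w} \<in> E"
    and bound: "\<And>M. induced_matching E M \<Longrightarrow> \<Union>M \<subseteq> insert v V \<Longrightarrow> card M \<noteq> Suc t"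
    and M: "induced_matching E M" "\<Union>M \<subseteq> nonneighbours E w (nonneighbours E v V)"
  shows "card M \<noteq> t"
proof -
  note extended = induced_matching_insert[OF edges v w M]
  have "\<Union>(insert {v, w} M) \<subseteq> insert v V"
    using M(2) w(1) by (auto simp: nonneighbours_def)
  thus ?thesis
    using bound[OF extended(1)] by (simp add: extended(2))
qed

theorem card_mis_le_of_induced_matching:
  assumes "finite V" and edges: "\<And>e. e \<in> E \<Longrightarrow> card e = 2"
    and "\<And>M. induced_matching E M \<Longrightarrow> \<Union>M \<subseteq> V \<Longrightarrow> card M \<noteq> Suc t"
  shows "card (mis E V) \<le> ((card V)\<^sup>2 + 1) ^ t"
  using assms(1,3)
proof (induction t arbitrary: V)
  case 0
  have "{u, v} \<notin> E" if "u \<in> V" "v \<in> V" for u v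
    using 0(2)[of "{{u, v}}"] induced_matching_edge[of E "{u, v}"] edges that by auto
  thus ?case
    by (simp add: mis_of_independent independent_def)
next
  case (Suc t)
  have no_loop: "{u} \<notin> E" for u
    using edges[of "{u}"] by auto
  from Suc.prems show ?case
  proof (induction V rule: finite_induct)
    case empty
    thus ?case
      by (simp add: mis_empty)
  next
    case (insert v V)
    have "card (mis E (nonneighbours E w (nonneighbours E v V))) \<le> ((card V)\<^sup>2 + 1) ^ t"
      if w: "w \<in> V" "{v, w} \<in> E" for w
    proof -
      let ?V = "nonneighbours E w (nonneighbours E v V)"
      have sub: "?V \<subseteq> V"
        by (auto simp: nonneighbours_def)
      have "card (mis E ?V) \<le> ((card ?V)\<^sup>2 + 1) ^ t"
      proof (rule Suc.IH)
        show "finite ?V"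
          using insert.hyps sub by (auto intro: finite_subset)
        show "card M \<noteq> Suc t" if "induced_matching E M" "\<Union>M \<subseteq> ?V" for M
          by (rule card_induced_matching_nonneighbours_neq[
                OF edges insert.hyps(2) w insert.prems that])
      qed
      also have "\<dots> \<le> ((card V)\<^sup>2 + 1) ^ t"
        using insert.hyps sub by (intro power_mono add_mono card_mono) auto
      finally show ?thesis .
    qed
    moreover have "card (mis E V) \<le> ((card V)\<^sup>2 + 1) ^ Suc t"
      using insert.IH insert.prems by blast
    ultimately have "card (mis E (insert v V)) \<le> ((Suc (card V))\<^sup>2 + 1) ^ Suc t"
      using card_mis_insert_power_le[OF insert.hyps no_loop] by blast
    thus ?case
      using insert.hyps by simp
  qed
qed

section \<open>Minimum cuts by preflow pushing\<close>

definition cut_cost :: "'a set \<Rightarrow> ('a \<Rightarrow> 'w) \<Rightarrow> ('a \<Rightarrow> 'a \<Rightarrow> 'w) \<Rightarrow> 'a set \<Rightarrow> 'w :: linordered_idom" where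
  "cut_cost V b c X = (\<Sum>v\<in>V - X. b v) + (\<Sum>u\<in>X. \<Sum>v\<in>V - X. c u v)"

text \<open>
  There is no source: \<open>b\<close> is the supply of the vertices, \<open>c\<close> the capacity, \<open>r\<close> the residual
  capacity, \<open>e\<close> the excess and \<open>d\<close> the distance label. The sinks are the vertices outside \<open>S\<close>.
\<close>

locale preflow =
  fixes V S :: "'a set" and b :: "'a \<Rightarrow> 'w :: linordered_idom" and c r :: "'a \<Rightarrow> 'a \<Rightarrow> 'w"
    and e :: "'a \<Rightarrow> 'w" and d :: "'a \<Rightarrow> nat"
  assumes finite_vertices: "finite V"
    and residual_nonneg: "u \<in> V \<Longrightarrow> v \<in> V \<Longrightarrow> 0 \<le> r u v"
    and residual_antisym: "u \<in> V \<Longrightarrow> v \<in> V \<Longrightarrow> r u v + r v u = c u v + c v u"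
    and excess_nonneg: "v \<in> V \<Longrightarrow> 0 \<le> e v"
    and excess_eq: "v \<in> V \<Longrightarrow> e v = b v + (\<Sum>u\<in>V. c u v - r u v)"
    and height_le: "v \<in> V \<Longrightarrow> d v \<le> card V"
    and height_sink: "v \<in> V \<Longrightarrow> v \<notin> S \<Longrightarrow> d v = 0"
    and height_residual: "u \<in> V \<Longrightarrow> v \<in> V \<Longrightarrow> 0 < r u v \<Longrightarrow> d u \<le> d v + 1"

definition active :: "'a set \<Rightarrow> 'a set \<Rightarrow> ('a \<Rightarrow> 'w :: linordered_idom) \<Rightarrow> ('a \<Rightarrow> nat) \<Rightarrow> 'a \<Rightarrow> bool" where
  "active V S e d u \<longleftrightarrow> u \<in> V \<and> u \<in> S \<and> 0 < e u \<and> d u < card V"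

definition admissible ::
  "'a set \<Rightarrow> ('a \<Rightarrow> 'a \<Rightarrow> 'w :: linordered_idom) \<Rightarrow> ('a \<Rightarrow> nat) \<Rightarrow> 'a \<Rightarrow> 'a \<Rightarrow> bool" where
  "admissible V r d u v \<longleftrightarrow> u \<in> V \<and> v \<in> V \<and> 0 < r u v \<and> d u = d v + 1"

definition push_residual :: "'a \<Rightarrow> 'a \<Rightarrow> 'w \<Rightarrow> ('a \<Rightarrow> 'a \<Rightarrow> 'w) \<Rightarrow> 'a \<Rightarrow> 'a \<Rightarrow> 'w :: linordered_idom" where
  "push_residual u v x r a b =
     (if a = u \<and> b = v then r u v - x else if a = v \<and> b = u then r v u + x else r a b)"

definition push_excess :: "'a \<Rightarrow> 'a \<Rightarrow> 'w \<Rightarrow> ('a \<Rightarrow> 'w) \<Rightarrow> 'a \<Rightarrow> 'w :: linordered_idom" where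
  "push_excess u v x e = e(u := e u - x, v := e v + x)"

inductive push_relabel ::
  "'a set \<Rightarrow> 'a set \<Rightarrow> ('a \<Rightarrow> 'a \<Rightarrow> 'w :: linordered_idom) \<Rightarrow> ('a \<Rightarrow> 'w) \<Rightarrow> ('a \<Rightarrow> nat) \<Rightarrow>
   ('a \<Rightarrow> 'a \<Rightarrow> 'w) \<Rightarrow> ('a \<Rightarrow> 'w) \<Rightarrow> ('a \<Rightarrow> nat) \<Rightarrow> bool" for V S r e d where
  push: "active V S e d u \<Longrightarrow> admissible V r d u v \<Longrightarrow> x = min (e u) (r u v) \<Longrightarrow>
    push_relabel V S r e d (push_residual u v x r) (push_excess u v x e) d"
| relabel: "active V S e d u \<Longrightarrow> (\<And>v. \<not> admissible V r d u v) \<Longrightarrow>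
    push_relabel V S r e d r e (d(u := d u + 1))"

text \<open>
  A relabelling creates at most \<open>n = card V\<close> admissible pairs and raises the last sum by at most 1.
  A push saturates an admissible pair, raising the last sum by at most \<open>n\<close>, or lowers that sum.
\<close>

definition potential ::
  "'a set \<Rightarrow> ('a \<Rightarrow> 'a \<Rightarrow> 'w :: linordered_idom) \<Rightarrow> ('a \<Rightarrow> 'w) \<Rightarrow> ('a \<Rightarrow> nat) \<Rightarrow> nat" where
  "potential V r e d =
     (card V * (card V + 1) + 2) * (\<Sum>v\<in>V. card V - d v) +
     (card V + 1) * card {(u, v). admissible V r d u v} +
     (\<Sum>v\<in>V. if 0 < e v then d v else 0)"

lemma finite_admissible: "finite V \<Longrightarrow> finite {(u, v). admissible V r d u v}"
  by (rule finite_subset[of _ "V \<times> V"]) (auto simp: admissible_def)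

lemma preflow_initial:
  assumes "finite V" "\<And>v. v \<in> V \<Longrightarrow> 0 \<le> b v" "\<And>u v. u \<in> V \<Longrightarrow> v \<in> V \<Longrightarrow> 0 \<le> c u v"
    and "\<And>u v. u \<in> V \<Longrightarrow> v \<in> V \<Longrightarrow> r u v = c u v" "\<And>v. v \<in> V \<Longrightarrow> e v = b v" "\<And>v. v \<in> V \<Longrightarrow> d v = 0"
  shows "preflow V S b c r e d"
  using assms by unfold_locales auto

lemma potential_initial_less:
  assumes "\<And>v. v \<in> V \<Longrightarrow> d v = 0"
  shows "potential V r e d < (card V + 2) ^ 4"
proof -
  let ?n = "card V"
  have "{(u, v). admissible V r d u v} = {}"
    using assms by (auto simp: admissible_def)
  moreover have "(\<Sum>v\<in>V. if 0 < e v then d v else 0) = 0"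
    using assms by (intro sum.neutral) auto
  ultimately have "potential V r e d = (?n * (?n + 1) + 2) * (?n * ?n)"
    using assms unfolding potential_def by (simp only: card.empty) simp
  also have "\<dots> < ((?n + 2) * (?n + 2)) * ((?n + 2) * (?n + 2))"
    by (intro mult_strict_mono) auto
  also have "\<dots> = (?n + 2) ^ 4"
    by (simp only: power4_eq_xxxx mult.assoc)
  finally show ?thesis .
qed

lemma sum_fun_upd:
  fixes g :: "'a \<Rightarrow> 'b \<Rightarrow> 'c :: comm_monoid_add"
  assumes "finite V" "u \<in> V"
  shows "(\<Sum>v\<in>V. g v ((f(u := x)) v)) + g u (f u) = (\<Sum>v\<in>V. g v (f v)) + g u x"
proof -
  have "(\<Sum>v\<in>V. g v ((f(u := x)) v)) = g u x + (\<Sum>v\<in>V - {u}. g v (f v))"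
    using assms by (subst sum.remove) (auto intro!: sum.cong)
  moreover have "(\<Sum>v\<in>V. g v (f v)) = g u (f u) + (\<Sum>v\<in>V - {u}. g v (f v))"
    using assms by (rule sum.remove)
  ultimately show ?thesis
    by (simp add: ac_simps)
qed

context preflow
begin

lemma sum_excess:
  assumes "X \<subseteq> V"
  shows "(\<Sum>v\<in>V - X. e v) = cut_cost V b c X - (\<Sum>u\<in>X. \<Sum>v\<in>V - X. r u v)"
proof -
  let ?T = "V - X" and ?flow = "\<lambda>u v. c u v - r u v"
  have antisym: "?flow u v + ?flow v u = 0" if "u \<in> V" "v \<in> V" for u v
    using residual_antisym[OF that] by (simp add: algebra_simps)
  have "2 * (\<Sum>v\<in>?T. \<Sum>u\<in>?T. ?flow u v) =
      (\<Sum>v\<in>?T. \<Sum>u\<in>?T. ?flow u v) + (\<Sum>v\<in>?T. \<Sum>u\<in>?T. ?flow v u)"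
    by (subst (2) sum.swap) simp
  also have "\<dots> = (\<Sum>v\<in>?T. \<Sum>u\<in>?T. ?flow u v + ?flow v u)"
    by (simp only: sum.distrib)
  also have "\<dots> = 0"
    by (intro sum.neutral ballI antisym) auto
  finally have internal: "(\<Sum>v\<in>?T. \<Sum>u\<in>?T. ?flow u v) = 0"
    by simp
  have "(\<Sum>v\<in>?T. e v) = (\<Sum>v\<in>?T. b v + (\<Sum>u\<in>V. ?flow u v))"
    by (intro sum.cong refl excess_eq) auto
  also have "\<dots> = (\<Sum>v\<in>?T. b v + ((\<Sum>u\<in>?T. ?flow u v) + (\<Sum>u\<in>X. ?flow u v)))"
    using assms finite_vertices by (intro sum.cong refl arg_cong2[of _ _ _ _ "(+)"] sum.subset_diff)
  also have "\<dots> = (\<Sum>v\<in>?T. b v) + (\<Sum>v\<in>?T. \<Sum>u\<in>X. ?flow u v)"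
    using internal by (simp only: sum.distrib add_0)
  also have "(\<Sum>v\<in>?T. \<Sum>u\<in>X. ?flow u v) = (\<Sum>u\<in>X. \<Sum>v\<in>?T. ?flow u v)"
    by (rule sum.swap)
  finally show ?thesis
    by (simp add: cut_cost_def sum_subtractf)
qed

text \<open>
  No residual edge crosses a gap in the distance labels, and below it the excess has reached the
  sinks; hence the cut at the gap is saturated.
\<close>

theorem gap_cut_minimal:
  assumes inactive: "\<And>u. \<not> active V S e d u"
    and gap: "h \<le> card V" "\<And>v. v \<in> V \<Longrightarrow> d v \<noteq> h"
    and Y: "Y \<subseteq> V" "Y \<subseteq> S"
  shows "cut_cost V b c {v \<in> V. h < d v} \<le> cut_cost V b c Y"
proof -
  let ?X = "{v \<in> V. h < d v}"
  have below: "d v < h" if "v \<in> V - ?X" for v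
    using that gap(2)[of v] by auto
  have "(\<Sum>u\<in>?X. \<Sum>v\<in>V - ?X. r u v) = 0"
  proof (intro sum.neutral ballI)
    fix u v assume uv: "u \<in> ?X" "v \<in> V - ?X"
    hence "\<not> 0 < r u v"
      using below[OF uv(2)] height_residual[of u v] by auto
    thus "r u v = 0"
      using residual_nonneg[of u v] uv by auto
  qed
  hence "cut_cost V b c ?X = (\<Sum>v\<in>V - ?X. e v)"
    using sum_excess[of ?X] by simp
  also have "\<dots> = (\<Sum>v\<in>(V - ?X) - S. e v)"
  proof (intro sum.mono_neutral_right ballI)
    fix v assume v: "v \<in> (V - ?X) - (V - ?X - S)"
    hence "\<not> 0 < e v"
      using inactive[of v] below[of v] gap(1) by (auto simp: active_def)
    thus "e v = 0"
      using excess_nonneg[of v] v by auto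
  qed (use finite_vertices in auto)
  also have "\<dots> \<le> (\<Sum>v\<in>V - Y. e v)"
    using excess_nonneg height_sink Y finite_vertices by (intro sum_mono2) auto
  also have "\<dots> = cut_cost V b c Y - (\<Sum>u\<in>Y. \<Sum>v\<in>V - Y. r u v)"
    by (rule sum_excess[OF Y(1)])
  also have "\<dots> \<le> cut_cost V b c Y"
    using residual_nonneg Y(1) by (auto intro!: sum_nonneg)
  finally show ?thesis .
qed

lemma gap_subset_nonsinks: "{v \<in> V. h < d v} \<subseteq> S"
  using height_sink by fastforce

lemma preflow_push:
  assumes u: "active V S e d u" and uv: "admissible V r d u v"
    and x: "0 \<le> x" "x \<le> e u" "x \<le> r u v"
  shows "preflow V S b c (push_residual u v x r) (push_excess u v x e) d"
proof
  have V: "u \<in> V" "v \<in> V" "u \<noteq> v"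
    using uv by (auto simp: admissible_def)
  show "push_excess u v x e w = b w + (\<Sum>a\<in>V. c a w - push_residual u v x r a w)" if "w \<in> V" for w
  proof -
    have "(\<Sum>a\<in>V. c a w - push_residual u v x r a w) =
        (\<Sum>a\<in>V. (c a w - r a w) + (if a = u then if w = v then x else 0 else 0)
          + (if a = v then if w = u then - x else 0 else 0))"
      using V by (intro sum.cong) (auto simp: push_residual_def)
    also have "\<dots> = (\<Sum>a\<in>V. c a w - r a w) + (if w = v then x else 0) + (if w = u then - x else 0)"
      using V finite_vertices by (simp add: sum.distrib)
    finally show ?thesis
      using excess_eq[OF that] V by (auto simp: push_excess_def)
  qed
  show "d a \<le> d b + 1" if "a \<in> V" "b \<in> V" "0 < push_residual u v x r a b" for a b
  proof (cases "0 < r a b")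
    case True
    thus ?thesis
      using height_residual that by auto
  next
    case False
    hence "a = v \<and> b = u"
      using that x uv by (auto simp: push_residual_def admissible_def split: if_splits)
    thus ?thesis
      using uv by (auto simp: admissible_def)
  qed
  show "0 \<le> push_residual u v x r a b" if "a \<in> V" "b \<in> V" for a b
    using residual_nonneg[OF that] residual_nonneg[OF V(2,1)] x by (auto simp: push_residual_def)
  show "push_residual u v x r a b + push_residual u v x r b a = c a b + c b a"
    if "a \<in> V" "b \<in> V" for a b
    using residual_antisym[OF that] V(3) by (auto simp: push_residual_def)
  show "0 \<le> push_excess u v x e a" if "a \<in> V" for a
    using excess_nonneg[OF that] excess_nonneg[OF V(2)] x V(3) by (auto simp: push_excess_def)
qed (use finite_vertices height_le height_sink in auto)

lemma preflow_relabel: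
  assumes u: "active V S e d u" and inadmissible: "\<And>v. \<not> admissible V r d u v"
  shows "preflow V S b c r e (d(u := d u + 1))"
proof
  have "d u \<le> d v" if "v \<in> V" "0 < r u v" for v
    using inadmissible[of v] height_residual[of u v] u that
    by (fastforce simp: admissible_def active_def)
  moreover have "d a \<le> Suc (d b)" if "a \<in> V" "b \<in> V" "0 < r a b" for a b
    using height_residual[OF that] by simp
  ultimately show "(d(u := d u + 1)) a \<le> (d(u := d u + 1)) b + 1"
    if "a \<in> V" "b \<in> V" "0 < r a b" for a b
    using that by (auto simp: le_SucI)
  show "(d(u := d u + 1)) v \<le> card V" if "v \<in> V" for v
    using u height_le[OF that] by (auto simp: active_def)
  show "(d(u := d u + 1)) v = 0" if "v \<in> V" "v \<notin> S" for v
    using u height_sink[OF that] that by (auto simp: active_def)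
qed (use finite_vertices residual_nonneg residual_antisym excess_nonneg excess_eq in auto)

lemma card_admissible_relabel_le:
  "card {(a, b). admissible V r (d(u := d u + 1)) a b} \<le>
    card {(a, b). admissible V r d a b} + card V"
proof -
  let ?A = "{(a, b). admissible V r d a b}"
  have "admissible V r d a b" if "admissible V r (d(u := d u + 1)) a b" "a \<noteq> u" for a b
    using that height_residual[of a b] by (auto simp: admissible_def split: if_splits)
  moreover have "b \<in> V" if "admissible V r (d(u := d u + 1)) a b" for a b
    using that by (simp add: admissible_def)
  ultimately have "{(a, b). admissible V r (d(u := d u + 1)) a b} \<subseteq> ?A \<union> Pair u ` V"
    by blast
  hence "card {(a, b). admissible V r (d(u := d u + 1)) a b} \<le> card (?A \<union> Pair u ` V)"
    using finite_vertices by (intro card_mono) (auto simp: finite_admissible)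
  also have "\<dots> \<le> card ?A + card (Pair u ` V)"
    by (rule card_Un_le)
  also have "card (Pair u ` V) \<le> card V"
    using finite_vertices by (rule card_image_le)
  finally show ?thesis
    by simp
qed

lemma potential_relabel_less:
  assumes "active V S e d u"
  shows "potential V r e (d(u := d u + 1)) < potential V r e d"
proof -
  let ?n = "card V" and ?d = "d(u := d u + 1)"
  have u: "u \<in> V" "d u < ?n"
    using assms by (auto simp: active_def)
  have "(\<Sum>v\<in>V. ?n - d v) = (\<Sum>v\<in>V. ?n - ?d v) + 1"
    using sum_fun_upd[OF finite_vertices u(1), of "\<lambda>_ y. ?n - y" d "d u + 1"] u(2) by simp
  hence "(?n * (?n + 1) + 2) * (\<Sum>v\<in>V. ?n - d v) =
      (?n * (?n + 1) + 2) * (\<Sum>v\<in>V. ?n - ?d v) + (?n + 1) * ?n + 2"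
    by (simp add: algebra_simps)
  moreover have "(?n + 1) * card {(a, b). admissible V r ?d a b} \<le>
      (?n + 1) * card {(a, b). admissible V r d a b} + (?n + 1) * ?n"
    using mult_le_mono2[OF card_admissible_relabel_le] by (simp only: add_mult_distrib2)
  moreover have "(\<Sum>v\<in>V. if 0 < e v then ?d v else 0) \<le> (\<Sum>v\<in>V. if 0 < e v then d v else 0) + 1"
    using sum_fun_upd[OF finite_vertices u(1), of "\<lambda>v y. if 0 < e v then y else 0" d "d u + 1"]
    by (simp split: if_splits)
  ultimately show ?thesis
    unfolding potential_def by linarith
qed

lemma potential_push_less:
  assumes u: "active V S e d u" and uv: "admissible V r d u v" and x: "x = min (e u) (r u v)"
  shows "potential V (push_residual u v x r) (push_excess u v x e) d < potential V r e d"
proof -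
  let ?n = "card V" and ?r = "push_residual u v x r" and ?e = "push_excess u v x e"
  let ?A = "\<lambda>r. {(a, b). admissible V r d a b}"
  let ?h = "\<lambda>v y. if 0 < y then d v else 0"
  have V: "u \<in> V" "v \<in> V" "u \<noteq> v" "d u = d v + 1" "d u < ?n" "0 < e u" "0 < x"
    using uv u x by (auto simp: admissible_def active_def)
  have subset: "?A ?r \<subseteq> ?A r"
    using V by (auto simp: admissible_def push_residual_def split: if_splits)
  have heights: "(\<Sum>w\<in>V. ?h w (?e w)) + ?h v (e v) + d u =
      (\<Sum>w\<in>V. ?h w (e w)) + ?h u (e u - x) + ?h v (e v + x)"
    using sum_fun_upd[OF finite_vertices V(1), of ?h e "e u - x"]
      sum_fun_upd[OF finite_vertices V(2), of ?h "e(u := e u - x)" "e v + x"] V(3,6)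
    unfolding push_excess_def by simp
  show ?thesis
  proof (cases "x = e u")
    case True
    hence "(\<Sum>w\<in>V. ?h w (?e w)) < (\<Sum>w\<in>V. ?h w (e w))"
      using heights V(4) by (auto split: if_splits)
    moreover have "(?n + 1) * card (?A ?r) \<le> (?n + 1) * card (?A r)"
      using card_mono[OF finite_admissible[OF finite_vertices] subset] by (rule mult_le_mono2)
    ultimately show ?thesis
      by (simp add: potential_def)
  next
    case False
    hence "x = r u v"
      using x by (auto simp: min_def split: if_splits)
    hence "(u, v) \<in> ?A r - ?A ?r"
      using uv by (auto simp: admissible_def push_residual_def)
    hence "card (?A ?r) < card (?A r)"
      using subset finite_vertices by (intro psubset_card_mono finite_admissible) auto
    hence "(?n + 1) * (card (?A ?r) + 1) \<le> (?n + 1) * card (?A r)"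
      by (intro mult_le_mono2) simp
    moreover have "(\<Sum>w\<in>V. ?h w (?e w)) \<le> (\<Sum>w\<in>V. ?h w (e w)) + d v"
      using heights by (auto split: if_splits)
    ultimately show ?thesis
      using V(4,5) by (simp add: potential_def)
  qed
qed

theorem push_relabel_preserves_preflow:
  assumes "push_relabel V S r e d r' e' d'"
  shows "preflow V S b c r' e' d'"
  using assms
proof cases
  case (push u v x)
  moreover have "0 \<le> x"
    using push by (simp add: active_def admissible_def)
  ultimately show ?thesis
    using preflow_push[of u v x] by simp
next
  case (relabel u)
  thus ?thesis
    using preflow_relabel by simp
qed

theorem push_relabel_potential_less:
  assumes "push_relabel V S r e d r' e' d'"
  shows "potential V r' e' d' < potential V r e d"
  using assms by cases (use potential_push_less potential_relabel_less in simp_all)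

end

lemma gap_exists:
  assumes "finite V"
  obtains h where "h \<le> card V" "\<And>v. v \<in> V \<Longrightarrow> d v \<noteq> (h :: nat)"
proof -
  have "\<not> {..card V} \<subseteq> d ` V"
    using surj_card_le[OF assms, of "{..card V}" d] by auto
  thus ?thesis
    using that by force
qed

section \<open>Halving sequences of integer combinations\<close>

lemma sum_less_of_doubling:
  fixes a :: "nat \<Rightarrow> 'w :: linordered_idom"
  assumes "\<And>i. i < q \<Longrightarrow> 0 < a i" "\<And>i. Suc i < q \<Longrightarrow> 2 * a i \<le> a (Suc i)" "m < q"
  shows "(\<Sum>i<m. a i) < a m"
  using assms(3)
proof (induction m)
  case (Suc m)
  thus ?case
    using assms(2)[of m] by simp
qed (use assms(1) in simp)

lemma inj_on_subset_sums:
  fixes a :: "nat \<Rightarrow> 'w :: linordered_idom"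
  assumes pos: "\<And>i. i < q \<Longrightarrow> 0 < a i" and doubling: "\<And>i. Suc i < q \<Longrightarrow> 2 * a i \<le> a (Suc i)"
  shows "inj_on (\<lambda>S. \<Sum>i\<in>S. a i) (Pow {..<q})"
proof -
  have "S = T" if "m \<le> q" "S \<subseteq> {..<m}" "T \<subseteq> {..<m}" "(\<Sum>i\<in>S. a i) = (\<Sum>i\<in>T. a i)" for m S T
    using that
  proof (induction m arbitrary: S T)
    case (Suc m)
    have less: "(\<Sum>i\<in>B. a i) < (\<Sum>i\<in>A. a i)"
      if "A \<subseteq> {..<Suc m}" "B \<subseteq> {..<Suc m}" "m \<in> A" "m \<notin> B" for A B
    proof -
      have "B \<subseteq> {..<m}"
        using that by (auto simp: less_Suc_eq)
      hence "(\<Sum>i\<in>B. a i) \<le> (\<Sum>i<m. a i)"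
        using pos Suc.prems by (intro sum_mono2) (auto intro!: less_imp_le)
      also have "\<dots> < a m"
        using Suc.prems by (intro sum_less_of_doubling[of q] pos doubling) auto
      also have "\<dots> \<le> (\<Sum>i\<in>A. a i)"
        using that pos Suc.prems finite_subset[OF that(1)]
        by (intro member_le_sum) (auto intro!: less_imp_le)
      finally show ?thesis .
    qed
    have mem_iff: "m \<in> S \<longleftrightarrow> m \<in> T"
      using less[of S T] less[of T S] Suc.prems by auto
    have "S - {m} = T - {m}"
    proof (rule Suc.IH)
      show "S - {m} \<subseteq> {..<m}" "T - {m} \<subseteq> {..<m}"
        using Suc.prems by (auto simp: less_Suc_eq)
      show "(\<Sum>i\<in>S - {m}. a i) = (\<Sum>i\<in>T - {m}. a i)"
        using Suc.prems mem_iff finite_subset[OF Suc.prems(2)] finite_subset[OF Suc.prems(3)]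
        by (simp add: sum_diff1)
    qed (use Suc.prems in simp)
    thus ?case
      using mem_iff by blast
  qed auto
  thus ?thesis
    by (intro inj_onI) auto
qed

lemma sum_subset_bounds:
  fixes y :: "'i \<Rightarrow> int"
  assumes "\<And>i. y i \<in> {- int a..int b}" "finite Q" "S \<subseteq> Q"
  shows "(\<Sum>i\<in>S. y i) \<in> {- int (a * card Q)..int (b * card Q)}"
proof -
  have "card S \<le> card Q"
    using assms(2,3) by (rule card_mono)
  hence "int (card S) * int a \<le> int (card Q) * int a" "int (card S) * int b \<le> int (card Q) * int b"
    by (simp_all add: mult_right_mono)
  moreover have "- (int (card S) * int a) \<le> (\<Sum>i\<in>S. y i)" "(\<Sum>i\<in>S. y i) \<le> int (card S) * int b"
    using sum_bounded_below[of S "- int a" y] sum_bounded_above[of S y "int b"] assms(1) by auto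
  ultimately show ?thesis
    by (simp add: mult.commute)
qed

text \<open>
  Distinct subset sums of the same weights have distinct coefficient vectors, and there are few of
  those.
\<close>

lemma doubling_length_le:
  fixes W :: "'a \<Rightarrow> 'w :: linordered_idom" and y :: "nat \<Rightarrow> 'a \<Rightarrow> int"
  assumes "finite P" and coeff: "\<And>i p. y i p \<in> {- int a..int b}"
    and g: "\<And>i. i < q \<Longrightarrow> g i = (\<Sum>p\<in>P. W p * of_int (y i p))"
    and pos: "\<And>i. i < q \<Longrightarrow> 0 < g i" and doubling: "\<And>i. Suc i < q \<Longrightarrow> 2 * g i \<le> g (Suc i)"
  shows "2 ^ q \<le> ((a + b) * q + 1) ^ card P"
proof -
  define vector where "vector = (\<lambda>S. restrict (\<lambda>p. \<Sum>i\<in>S. y i p) P)"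
  have subset_sum: "(\<Sum>i\<in>S. g i) = (\<Sum>p\<in>P. W p * of_int (vector S p))" if "S \<in> Pow {..<q}" for S
  proof -
    have "(\<Sum>i\<in>S. g i) = (\<Sum>i\<in>S. \<Sum>p\<in>P. W p * of_int (y i p))"
      using that by (intro sum.cong refl g) auto
    also have "\<dots> = (\<Sum>p\<in>P. \<Sum>i\<in>S. W p * of_int (y i p))"
      by (rule sum.swap)
    also have "\<dots> = (\<Sum>p\<in>P. W p * of_int (vector S p))"
      by (intro sum.cong refl) (simp add: vector_def sum_distrib_left)
    finally show ?thesis .
  qed
  have "inj_on vector (Pow {..<q})"
  proof (rule inj_onI)
    fix S T assume ST: "S \<in> Pow {..<q}" "T \<in> Pow {..<q}" "vector S = vector T"
    show "S = T"
      using inj_onD[OF inj_on_subset_sums[of q g] _ ST(1,2)] pos doubling ST(3)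
        subset_sum[OF ST(1)] subset_sum[OF ST(2)] by simp
  qed
  moreover have "vector ` Pow {..<q} \<subseteq> P \<rightarrow>\<^sub>E {- int (a * q)..int (b * q)}"
    using sum_subset_bounds[OF coeff, of "{..<q}"] by (auto simp: vector_def)
  ultimately have "card (Pow {..<q}) \<le> card (P \<rightarrow>\<^sub>E {- int (a * q)..int (b * q)})"
    using assms(1) by (intro card_inj_on_le[of vector]) (auto intro: finite_PiE)
  also have "\<dots> = ((a + b) * q + 1) ^ card P"
  proof -
    have "nat (int (b * q) - - int (a * q) + 1) = (a + b) * q + 1"
      by (simp add: nat_eq_iff algebra_simps)
    thus ?thesis
      using assms(1) by (simp only: card_PiE card_atLeastAtMost_int prod_constant)
  qed
  finally show ?thesis
    by (simp add: card_Pow)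
qed

corollary halving_length_le:
  fixes W :: "'a \<Rightarrow> 'w :: linordered_idom" and y :: "nat \<Rightarrow> 'a \<Rightarrow> int"
  assumes "finite P" "\<And>i p. y i p \<in> {- int a..int b}"
    and g: "\<And>i. i < q \<Longrightarrow> g i = (\<Sum>p\<in>P. W p * of_int (y i p))"
    and pos: "\<And>i. i < q \<Longrightarrow> 0 < g i" and halving: "\<And>i. Suc i < q \<Longrightarrow> 2 * g (Suc i) \<le> g i"
  shows "2 ^ q \<le> ((a + b) * q + 1) ^ card P"
proof (rule doubling_length_le[OF assms(1,2)])
  fix i assume i: "Suc i < q"
  have "q - Suc i = Suc (q - Suc (Suc i))"
    using i by simp
  thus "2 * g (q - Suc i) \<le> g (q - Suc (Suc i))"
    using halving[of "q - Suc (Suc i)"] i by simp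
qed (use g pos in auto)

lemma halving_length_bound: "(3 * (16 * (p + 1)\<^sup>2) + 1) ^ p < (2 :: nat) ^ (16 * (p + 1)\<^sup>2)"
proof -
  have "p + 1 \<le> 2 ^ p"
    by (simp add: Suc_leI)
  hence "(p + 1)\<^sup>2 \<le> (2 ^ p)\<^sup>2"
    by (rule power_mono) simp
  moreover have "1 \<le> (p + 1)\<^sup>2"
    by simp
  ultimately have "3 * (16 * (p + 1)\<^sup>2) + 1 \<le> 64 * (2 ^ p)\<^sup>2"
    by linarith
  also have "\<dots> = 2 ^ (6 + 2 * p)"
    by (simp add: power_add power_mult power2_eq_square mult.commute)
  finally have "(3 * (16 * (p + 1)\<^sup>2) + 1) ^ p \<le> (2 ^ (6 + 2 * p)) ^ p"
    by (rule power_mono) simp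
  also have "\<dots> = 2 ^ ((6 + 2 * p) * p)"
    by (simp only: power_mult)
  also have "\<dots> < 2 ^ (16 * (p + 1)\<^sup>2)"
    by (rule power_strict_increasing) (auto simp: power2_eq_square algebra_simps)
  finally show ?thesis .
qed

lemma power_contraction_le_half:
  assumes "0 < L"
  shows "(1 - 1 / real L) ^ L \<le> 1 / 2"
proof -
  have "(1 - 1 / real L) ^ L \<le> exp (- (1 / real L)) ^ L"
    using exp_ge_add_one_self[of "- (1 / real L)"] assms by (intro power_mono) auto
  also have "\<dots> = 1 / exp 1"
    using assms by (simp add: exp_of_nat_mult[symmetric] exp_minus field_simps)
  also have "\<dots> \<le> 1 / 2"
    using exp_ge_add_one_self[of 1] by (intro divide_left_mono) auto
  finally show ?thesis .
qed

lemma geometric_decay: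
  fixes g :: "nat \<Rightarrow> 'w :: linordered_idom"
  assumes "0 \<le> \<rho>" "\<And>i. i < k \<Longrightarrow> g (Suc i) \<le> \<rho> * g i" "i + j \<le> k"
  shows "g (i + j) \<le> \<rho> ^ j * g i"
  using assms(3)
proof (induction j)
  case (Suc j)
  have "g (i + Suc j) \<le> \<rho> * g (i + j)"
    using assms(2)[of "i + j"] Suc.prems by simp
  also have "\<dots> \<le> \<rho> * (\<rho> ^ j * g i)"
    using Suc assms(1) by (intro mult_left_mono) auto
  finally show ?case
    by (simp add: mult.assoc)
qed simp

lemma contraction_pos_and_halving:
  fixes g :: "nat \<Rightarrow> real"
  assumes L: "0 < L" and decay: "\<And>i. i < k \<Longrightarrow> g (Suc i) \<le> (1 - 1 / real L) * g i" and last: "0 < g k"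
  shows "i \<le> k \<Longrightarrow> 0 < g i" and "i + L \<le> k \<Longrightarrow> 2 * g (i + L) \<le> g i"
proof -
  let ?\<rho> = "1 - 1 / real L"
  have nonneg: "0 \<le> ?\<rho>"
    using L by simp
  show pos: "0 < g i" if "i \<le> k" for i
  proof (rule ccontr)
    assume "\<not> 0 < g i"
    hence "?\<rho> ^ (k - i) * g i \<le> 0"
      using nonneg by (intro mult_nonneg_nonpos) auto
    thus False
      using geometric_decay[where g = g, OF nonneg decay, of k i "k - i"] that last by simp
  qed
  show "2 * g (i + L) \<le> g i" if "i + L \<le> k" for i
  proof -
    have "g (i + L) \<le> ?\<rho> ^ L * g i"
      using geometric_decay[where g = g, OF nonneg decay, of k] that by blast
    also have "\<dots> \<le> 1 / 2 * g i"
      using pos[of i] that power_contraction_le_half[OF L] by (intro mult_right_mono) auto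
    finally show ?thesis
      by simp
  qed
qed

section \<open>Local search for uniform labelings\<close>

definition separation :: "'a set \<Rightarrow> ('a \<Rightarrow> 'a \<Rightarrow> real) \<Rightarrow> ('a \<Rightarrow> 'l) \<Rightarrow> 'a \<Rightarrow> real" where
  "separation V W f u = (\<Sum>v\<in>V. if f u = f v then 0 else W u v)"

definition label_cost :: "'a set \<Rightarrow> ('a \<Rightarrow> 'a \<Rightarrow> real) \<Rightarrow> ('a \<Rightarrow> 'l) \<Rightarrow> real" where
  "label_cost V W f = (\<Sum>u\<in>V. separation V W f u)"

definition move_capacity :: "('a \<Rightarrow> 'a \<Rightarrow> real) \<Rightarrow> ('a \<Rightarrow> 'l) \<Rightarrow> 'a \<Rightarrow> 'a \<Rightarrow> real" where
  "move_capacity W f u v = (if f u = f v then 2 * W u v else W u v)"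

definition move_cost :: "'a set \<Rightarrow> ('a \<Rightarrow> 'a \<Rightarrow> real) \<Rightarrow> ('a \<Rightarrow> 'l) \<Rightarrow> 'a set \<Rightarrow> real" where
  "move_cost V W f X = cut_cost V (separation V W f) (move_capacity W f) X"

text \<open>
  Upper bound for the contribution of \<open>{u, v}\<close> after the vertices of \<open>X\<close> have received a common new
  label. It is exact if \<open>X\<close> contains all vertices that had this label before.
\<close>

definition move_weight :: "('a \<Rightarrow> 'l) \<Rightarrow> 'a set \<Rightarrow> 'a \<Rightarrow> 'a \<Rightarrow> real" where
  "move_weight f X u v =
     (if f u = f v then of_bool ((u \<in> X) \<noteq> (v \<in> X)) else 1 - of_bool (u \<in> X \<and> v \<in> X))"

definition labeling :: "'a set \<Rightarrow> 'l set \<Rightarrow> ('l \<Rightarrow> 'a set) \<Rightarrow> ('a \<Rightarrow> 'l) \<Rightarrow> bool" where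
  "labeling V \<Lambda> lab f \<longleftrightarrow> (\<forall>v\<in>V. f v \<in> \<Lambda> \<and> v \<in> lab (f v))"

definition improves ::
  "'a set \<Rightarrow> ('a \<Rightarrow> 'a \<Rightarrow> real) \<Rightarrow> 'l set \<Rightarrow> ('l \<Rightarrow> 'a set) \<Rightarrow> ('a \<Rightarrow> 'l) \<Rightarrow> ('a \<Rightarrow> 'l) \<Rightarrow> bool" where
  "improves V W \<Lambda> lab f f' \<longleftrightarrow>
     (\<forall>a\<in>\<Lambda>. \<forall>Y. Y \<subseteq> V \<and> Y \<subseteq> lab a \<longrightarrow> label_cost V W f' \<le> move_cost V W f Y)"

lemma label_cost_cong: "(\<And>v. v \<in> V \<Longrightarrow> f v = g v) \<Longrightarrow> label_cost V W f = label_cost V W g"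
  unfolding label_cost_def separation_def by (intro sum.cong refl) auto

lemma labeling_cong: "(\<And>v. v \<in> V \<Longrightarrow> f v = g v) \<Longrightarrow> labeling V \<Lambda> lab f \<longleftrightarrow> labeling V \<Lambda> lab g"
  by (simp add: labeling_def)

lemma sum_symmetrize:
  fixes g :: "'a \<Rightarrow> 'a \<Rightarrow> 'b :: field_char_0"
  shows "(\<Sum>u\<in>A. \<Sum>v\<in>A. g u v) = (\<Sum>u\<in>A. \<Sum>v\<in>A. (g u v + g v u) / 2)"
proof -
  have "(\<Sum>u\<in>A. \<Sum>v\<in>A. (g u v + g v u) / 2) =
      ((\<Sum>u\<in>A. \<Sum>v\<in>A. g u v) + (\<Sum>u\<in>A. \<Sum>v\<in>A. g v u)) / 2"
    by (simp add: sum.distrib flip: sum_divide_distrib)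
  also have "(\<Sum>u\<in>A. \<Sum>v\<in>A. g v u) = (\<Sum>u\<in>A. \<Sum>v\<in>A. g u v)"
    by (rule sum.swap)
  finally show ?thesis
    by simp
qed

lemma sum_move_weight_le:
  fixes h :: "'a \<Rightarrow> 'l"
  assumes uv: "u \<in> V" "v \<in> V" and \<Lambda>: "finite \<Lambda>" "h u \<in> \<Lambda>" "h v \<in> \<Lambda>"
  shows "(\<Sum>a\<in>\<Lambda>. move_weight f {w \<in> V. h w = a} u v) \<le>
    (real (card \<Lambda>) - 1) * of_bool (f u \<noteq> f v) + 2 * of_bool (h u \<noteq> h v)"
proof (cases "f u = f v")
  case True
  have "(\<Sum>a\<in>\<Lambda>. move_weight f {w \<in> V. h w = a} u v) \<le>
      (\<Sum>a\<in>\<Lambda>. of_bool (h u \<noteq> h v) * ((if a = h u then 1 else 0) + (if a = h v then 1 else 0)))"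
    using True uv by (intro sum_mono) (auto simp: move_weight_def)
  also have "\<dots> = of_bool (h u \<noteq> h v) *
      ((\<Sum>a\<in>\<Lambda>. if a = h u then 1 else 0) + (\<Sum>a\<in>\<Lambda>. if a = h v then 1 else 0))"
    by (simp only: sum_distrib_left[symmetric] sum.distrib)
  finally show ?thesis
    using \<Lambda> True by simp
next
  case False
  have "(\<Sum>a\<in>\<Lambda>. move_weight f {w \<in> V. h w = a} u v) =
      (\<Sum>a\<in>\<Lambda>. 1 - of_bool (h u = h v) * (if a = h u then 1 else 0))"
    using False uv by (intro sum.cong) (auto simp: move_weight_def)
  also have "\<dots> = real (card \<Lambda>) - of_bool (h u = h v) * (\<Sum>a\<in>\<Lambda>. if a = h u then 1 else 0)"
    by (simp only: sum_subtractf sum_distrib_left) simp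
  finally show ?thesis
    using \<Lambda> False by simp
qed

locale uniform_labeling =
  fixes V :: "'a set" and W :: "'a \<Rightarrow> 'a \<Rightarrow> real"
  assumes finite_vertices: "finite V"
    and weight_sym: "W u v = W v u"
    and weight_nonneg: "0 \<le> W u v"
begin

lemma separation_nonneg: "0 \<le> separation V W f u"
  by (simp add: separation_def sum_nonneg weight_nonneg)

lemma move_capacity_nonneg: "0 \<le> move_capacity W f u v"
  by (simp add: move_capacity_def weight_nonneg)

lemma move_cost_eq:
  assumes X: "X \<subseteq> V"
  shows "move_cost V W f X = (\<Sum>u\<in>V. \<Sum>v\<in>V. W u v * move_weight f X u v)"
proof -
  have supply_part: "(\<Sum>v\<in>V - X. separation V W f v) =
      (\<Sum>u\<in>V. \<Sum>v\<in>V. of_bool (u \<notin> X) * (if f u = f v then 0 else W u v))"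
    unfolding separation_def sum_distrib_left[symmetric] using finite_vertices
    by (intro sum.mono_neutral_cong_left) auto
  have capacity_part: "(\<Sum>u\<in>X. \<Sum>v\<in>V - X. move_capacity W f u v) =
      (\<Sum>u\<in>V. \<Sum>v\<in>V. of_bool (u \<in> X) * (of_bool (v \<notin> X) * move_capacity W f u v))"
    unfolding sum_distrib_left[symmetric] using X finite_vertices
    by (intro sum.mono_neutral_cong_left) (auto intro!: sum.mono_neutral_cong_left)
  have "move_cost V W f X = (\<Sum>u\<in>V. \<Sum>v\<in>V. of_bool (u \<notin> X) * (if f u = f v then 0 else W u v)
      + of_bool (u \<in> X) * (of_bool (v \<notin> X) * move_capacity W f u v))"
    unfolding move_cost_def cut_cost_def supply_part capacity_part by (simp only: sum.distrib)
  also have "\<dots> = (\<Sum>u\<in>V. \<Sum>v\<in>V. W u v * move_weight f X u v)"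
    by (subst sum_symmetrize, intro sum.cong refl)
      (auto simp: move_weight_def move_capacity_def weight_sym)
  finally show ?thesis .
qed

lemma label_cost_move_le:
  assumes "X \<subseteq> V"
  shows "label_cost V W (\<lambda>v. if v \<in> X then a else f v) \<le> move_cost V W f X"
  unfolding move_cost_eq[OF assms] label_cost_def separation_def
  by (intro sum_mono) (simp add: move_weight_def weight_nonneg)

lemma sum_move_cost_le:
  fixes h :: "'a \<Rightarrow> 'l"
  assumes \<Lambda>: "finite \<Lambda>" "h ` V \<subseteq> \<Lambda>"
  shows "(\<Sum>a\<in>\<Lambda>. move_cost V W f {v \<in> V. h v = a}) \<le>
    (real (card \<Lambda>) - 1) * label_cost V W f + 2 * label_cost V W h"
proof -
  let ?Y = "\<lambda>a. {v \<in> V. h v = a}" and ?L = "real (card \<Lambda>)"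
  have "(\<Sum>a\<in>\<Lambda>. move_cost V W f (?Y a)) = (\<Sum>a\<in>\<Lambda>. \<Sum>u\<in>V. \<Sum>v\<in>V. W u v * move_weight f (?Y a) u v)"
    by (intro sum.cong refl move_cost_eq) auto
  also have "\<dots> = (\<Sum>u\<in>V. \<Sum>a\<in>\<Lambda>. \<Sum>v\<in>V. W u v * move_weight f (?Y a) u v)"
    by (rule sum.swap)
  also have "\<dots> = (\<Sum>u\<in>V. \<Sum>v\<in>V. \<Sum>a\<in>\<Lambda>. W u v * move_weight f (?Y a) u v)"
    by (intro sum.cong refl sum.swap)
  also have "\<dots> = (\<Sum>u\<in>V. \<Sum>v\<in>V. W u v * (\<Sum>a\<in>\<Lambda>. move_weight f (?Y a) u v))"
    by (simp only: sum_distrib_left)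
  also have "\<dots> \<le> (\<Sum>u\<in>V. \<Sum>v\<in>V.
      W u v * ((?L - 1) * of_bool (f u \<noteq> f v) + 2 * of_bool (h u \<noteq> h v)))"
    using \<Lambda> by (intro sum_mono mult_left_mono sum_move_weight_le weight_nonneg) auto
  also have "\<dots> = (\<Sum>u\<in>V. \<Sum>v\<in>V.
      (?L - 1) * (if f u = f v then 0 else W u v) + 2 * (if h u = h v then 0 else W u v))"
    by (intro sum.cong refl) (auto simp: algebra_simps)
  also have "\<dots> = (?L - 1) * label_cost V W f + 2 * label_cost V W h"
    by (simp only: label_cost_def separation_def sum.distrib sum_distrib_left)
  finally show ?thesis .
qed

text \<open>Comparison with the moves that give label \<open>a\<close> to the vertices labelled \<open>a\<close> by \<open>h\<close>.\<close>

lemma improves_contraction: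
  assumes h: "labeling V \<Lambda> lab h" and \<Lambda>: "finite \<Lambda>" "\<Lambda> \<noteq> {}" and f: "improves V W \<Lambda> lab f f'"
  shows "label_cost V W f' - 2 * label_cost V W h \<le>
    (1 - 1 / real (card \<Lambda>)) * (label_cost V W f - 2 * label_cost V W h)"
proof -
  have "(\<Sum>a\<in>\<Lambda>. label_cost V W f') \<le> (\<Sum>a\<in>\<Lambda>. move_cost V W f {v \<in> V. h v = a})"
    using h by (intro sum_mono f[unfolded improves_def, rule_format]) (auto simp: labeling_def)
  also have "\<dots> \<le> (real (card \<Lambda>) - 1) * label_cost V W f + 2 * label_cost V W h"
    using h \<Lambda>(1) by (intro sum_move_cost_le) (auto simp: labeling_def)
  finally show ?thesis
    using \<Lambda> by (simp add: card_gt_0_iff field_simps)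
qed

lemma approximation_gap_eq:
  "label_cost V W f - 2 * label_cost V W h =
    (\<Sum>(u, v)\<in>V \<times> V. W u v * of_int (of_bool (f u \<noteq> f v) - 2 * of_bool (h u \<noteq> h v)))"
  unfolding label_cost_def separation_def sum_distrib_left sum_subtractf[symmetric]
    sum.cartesian_product
  by (intro sum.cong refl) auto

theorem local_search_two_approx:
  assumes h: "labeling V \<Lambda> lab h" and \<Lambda>: "finite \<Lambda>" "\<Lambda> \<noteq> {}"
    and f: "(improves V W \<Lambda> lab ^^ k) f\<^sub>0 f" and k: "16 * ((card V)\<^sup>2 + 1)\<^sup>2 * card \<Lambda> \<le> k"
  shows "label_cost V W f \<le> 2 * label_cost V W h"
proof (rule ccontr)
  assume large: "\<not> ?thesis"
  let ?L = "card \<Lambda>" and ?q = "16 * ((card V)\<^sup>2 + 1)\<^sup>2"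
  obtain F where F: "F 0 = f\<^sub>0" "F k = f" "\<And>i. i < k \<Longrightarrow> improves V W \<Lambda> lab (F i) (F (Suc i))"
    using f by (auto simp: relpowp_fun_conv)
  define g where "g i = label_cost V W (F i) - 2 * label_cost V W h" for i
  have L: "0 < ?L"
    using \<Lambda> by (simp add: card_gt_0_iff)
  have decay: "g (Suc i) \<le> (1 - 1 / real ?L) * g i" if "i < k" for i
    unfolding g_def using improves_contraction[OF h \<Lambda> F(3)[OF that]] .
  have last: "0 < g k"
    using large F(2) by (simp add: g_def)
  have index: "t * ?L \<le> k" if "t \<le> ?q" for t
    using mult_le_mono1[OF that] k by (rule order.trans)
  define y :: "nat \<Rightarrow> 'a \<times> 'a \<Rightarrow> int" where
    "y t = (\<lambda>(u, v). of_bool (F (t * ?L) u \<noteq> F (t * ?L) v) - 2 * of_bool (h u \<noteq> h v))" for t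
  have "2 ^ ?q \<le> ((2 + 1) * ?q + 1) ^ card (V \<times> V)"
  proof (rule halving_length_le[where g = "\<lambda>t. g (t * ?L)"])
    show "y t p \<in> {- int 2..int 1}" for t p
      by (simp add: y_def split_beta)
    show "g (t * ?L) = (\<Sum>p\<in>V \<times> V. (case p of (u, v) \<Rightarrow> W u v) * of_int (y t p))" for t
      unfolding g_def approximation_gap_eq by (intro sum.cong refl) (auto simp: y_def)
    show "0 < g (t * ?L)" if "t < ?q" for t
      using contraction_pos_and_halving(1)[where g = g, OF L decay last] index[of t] that by simp
    show "2 * g (Suc t * ?L) \<le> g (t * ?L)" if "Suc t < ?q" for t
      using contraction_pos_and_halving(2)[where g = g, OF L decay last, of "t * ?L"]
        index[of "Suc t"] that
      by (simp add: add.commute)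
  qed (use finite_vertices in simp)
  thus False
    using halving_length_bound[of "(card V)\<^sup>2"]
    by (simp add: card_cartesian_product power2_eq_square)
qed

end

section \<open>Multicuts and labelings\<close>

definition weight_matrix :: "multicut \<Rightarrow> nat \<Rightarrow> nat \<Rightarrow> real" where
  "weight_matrix I u v = (if {u, v} \<in> edges I then weight I {u, v} else 0)"

definition label_cut :: "multicut \<Rightarrow> (nat \<Rightarrow> 'l) \<Rightarrow> nat set set" where
  "label_cut I f = {{u, v} | u v. {u, v} \<in> edges I \<and> f u \<noteq> f v}"

definition component :: "'a set set \<Rightarrow> 'a \<Rightarrow> 'a set" where
  "component E v = {(u, w). {u, w} \<in> E}\<^sup>* `` {v}"

lemma uniform_labeling_weight_matrix:
  "valid_instance I \<Longrightarrow> uniform_labeling {..<nverts I} (weight_matrix I)"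
  by unfold_locales (auto simp: weight_matrix_def valid_instance_def insert_commute)

lemma demand_loop_free: "valid_instance I \<Longrightarrow> {v} \<notin> dedges I"
  by (auto simp: valid_instance_def all_pairs_def doubleton_eq_iff)

lemma edges_subset_vertices: "valid_instance I \<Longrightarrow> {u, v} \<in> edges I \<Longrightarrow> u < nverts I \<and> v < nverts I"
  by (auto simp: valid_instance_def all_pairs_def doubleton_eq_iff)

lemma demands_subset_terminals: "valid_instance I \<Longrightarrow> {s, t} \<in> dedges I \<Longrightarrow> s \<in> dverts I \<and> t \<in> dverts I"
  by (auto simp: valid_instance_def all_pairs_def doubleton_eq_iff)

lemma sum_ordered_pairs:
  fixes w :: "nat set \<Rightarrow> 'b :: comm_semiring_1"
  assumes V: "finite V" and F: "F \<subseteq> all_pairs V"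
  shows "(\<Sum>u\<in>V. \<Sum>v\<in>V. if {u, v} \<in> F then w {u, v} else 0) = 2 * (\<Sum>e\<in>F. w e)"
proof -
  let ?P = "{p \<in> V \<times> V. {fst p, snd p} \<in> F}"
  have fiber: "(\<Sum>p\<in>{p \<in> ?P. {fst p, snd p} = e}. w {fst p, snd p}) = 2 * w e" if e: "e \<in> F" for e
  proof -
    obtain a b where ab: "e = {a, b}" "a \<in> V" "b \<in> V" "a \<noteq> b"
      using e F by (auto simp: all_pairs_def)
    have "{p \<in> ?P. {fst p, snd p} = e} = {(a, b), (b, a)}"
      using ab e by (auto simp: doubleton_eq_iff insert_commute)
    thus ?thesis
      using ab by (simp add: insert_commute mult_2)
  qed
  have "(\<Sum>u\<in>V. \<Sum>v\<in>V. if {u, v} \<in> F then w {u, v} else 0) =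
      (\<Sum>p\<in>V \<times> V. if {fst p, snd p} \<in> F then w {fst p, snd p} else 0)"
    by (simp add: sum.cartesian_product split_beta)
  also have "\<dots> = (\<Sum>p\<in>?P. w {fst p, snd p})"
    using V by (intro sum.inter_filter[symmetric]) simp
  also have "\<dots> = (\<Sum>e\<in>F. \<Sum>p\<in>{p \<in> ?P. {fst p, snd p} = e}. w {fst p, snd p})"
    using V F finite_all_pairs[OF V] by (intro sum.group[symmetric]) (auto intro: finite_subset)
  also have "\<dots> = (\<Sum>e\<in>F. 2 * w e)"
    by (intro sum.cong refl fiber)
  finally show ?thesis
    by (simp add: sum_distrib_left)
qed

lemma label_cut_iff: "{u, v} \<in> label_cut I f \<longleftrightarrow> {u, v} \<in> edges I \<and> f u \<noteq> f v"
  by (auto simp: label_cut_def doubleton_eq_iff insert_commute)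

lemma label_cut_subset: "label_cut I f \<subseteq> edges I"
  by (auto simp: label_cut_def)

lemma label_cost_eq_cost_label_cut:
  assumes "valid_instance I"
  shows "label_cost {..<nverts I} (weight_matrix I) f = 2 * cost I (label_cut I f)"
proof -
  have "label_cost {..<nverts I} (weight_matrix I) f =
      (\<Sum>u<nverts I. \<Sum>v<nverts I. if {u, v} \<in> label_cut I f then weight I {u, v} else 0)"
    unfolding label_cost_def separation_def
    by (intro sum.cong refl) (simp add: label_cut_iff weight_matrix_def)
  also have "\<dots> = 2 * cost I (label_cut I f)"
    unfolding cost_def using assms label_cut_subset
    by (intro sum_ordered_pairs) (auto simp: valid_instance_def)
  finally show ?thesis .
qed

lemma labeling_same_label_not_demand:
  assumes I: "valid_instance I" and f: "labeling {..<nverts I} \<Lambda> lab f"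
    and lab: "lab ` \<Lambda> \<subseteq> mis (dedges I) {..<nverts I}" and st: "{s, t} \<in> dedges I"
  shows "f s \<noteq> f t"
proof
  assume eq: "f s = f t"
  have "s < nverts I" "t < nverts I"
    using demands_subset_terminals[OF I st] I by (auto simp: valid_instance_def)
  hence "f s \<in> \<Lambda>" "s \<in> lab (f s)" "t \<in> lab (f s)"
    using f eq by (metis labeling_def lessThan_iff)+
  thus False
    using mis_independent[of "lab (f s)"] lab st by (auto simp: independent_def)
qed

lemma feasible_label_cut:
  assumes "valid_instance I" "labeling {..<nverts I} \<Lambda> lab f"
    and "lab ` \<Lambda> \<subseteq> mis (dedges I) {..<nverts I}"
  shows "feasible I (label_cut I f)"
  unfolding feasible_def
proof (intro conjI allI impI notI label_cut_subset)
  fix s t assume st: "{s, t} \<in> dedges I" and path: "\<exists>p. is_path (edges I - label_cut I f) s p t"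
  have "f (hd p) = f (last p)"
    if "p \<noteq> []" "successively (\<lambda>u v. {u, v} \<in> edges I - label_cut I f) p" for p
    using that by (induction p rule: induct_list012) (auto simp: label_cut_iff)
  hence "f s = f t"
    using path by (auto simp: is_path_def)
  with labeling_same_label_not_demand[OF assms st] show False ..
qed

lemma is_path_of_component:
  assumes "t \<in> component E s"
  shows "\<exists>p. is_path E s p t"
proof -
  have "(s, t) \<in> {(u, v). {u, v} \<in> E}\<^sup>*"
    using assms by (simp add: component_def)
  thus ?thesis
  proof (induction rule: rtrancl_induct)
    case base
    have "is_path E s [s] s"
      by (simp add: is_path_def)
    thus ?case ..
  next
    case (step u v)
    then obtain p where p: "is_path E s p u"
      by blast
    show ?case
    proof (cases "v \<in> set p")
      case True
      then obtain q r where "p = (q @ [v]) @ r"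
        by (auto simp: in_set_conv_decomp)
      hence "is_path E s (q @ [v]) v"
        using p by (auto simp: is_path_def successively_append_iff hd_append split: if_splits)
      thus ?thesis ..
    next
      case False
      have "is_path E s (p @ [v]) v"
        using p False step(2) by (auto simp: is_path_def successively_append_iff)
      thus ?thesis ..
    qed
  qed
qed

lemma component_trans: "u \<in> component E v \<Longrightarrow> w \<in> component E u \<Longrightarrow> w \<in> component E v"
  by (auto simp: component_def)

lemma component_sym: "u \<in> component E v \<Longrightarrow> v \<in> component E u"
proof -
  have "sym ({(u, w). {u, w} \<in> E}\<^sup>*)"
    by (intro sym_rtrancl) (auto simp: sym_def insert_commute)
  thus "u \<in> component E v \<Longrightarrow> v \<in> component E u"
    by (auto simp: component_def dest: symD)
qed

lemma component_eq_of_edge: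
  assumes "{u, v} \<in> E"
  shows "component E u = component E v"
proof -
  have "u \<in> component E v" "v \<in> component E u"
    using assms by (auto simp: component_def insert_commute)
  thus ?thesis
    by (auto intro: component_trans)
qed

lemma independent_component:
  assumes "feasible I F"
  shows "independent (dedges I) (component (edges I - F) v)"
  unfolding independent_def
proof (intro ballI notI)
  fix s t assume "s \<in> component (edges I - F) v" "t \<in> component (edges I - F) v"
    and st: "{s, t} \<in> dedges I"
  hence "t \<in> component (edges I - F) s"
    by (auto intro: component_trans component_sym)
  hence "\<exists>p. is_path (edges I - F) s p t"
    by (rule is_path_of_component)
  with assms st show False
    by (auto simp: feasible_def)
qed

lemma labeling_of_multicut:
  assumes I: "valid_instance I" and F: "feasible I F"
    and lab: "mis (dedges I) {..<nverts I} = lab ` \<Lambda>"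
  obtains h where "labeling {..<nverts I} \<Lambda> lab h" "label_cut I h \<subseteq> F"
proof -
  let ?E = "edges I - F" and ?V = "{..<nverts I}"
  have "\<exists>a\<in>\<Lambda>. component ?E v \<inter> ?V \<subseteq> lab a" for v
  proof -
    have "independent (dedges I) (component ?E v \<inter> ?V)"
      using independent_component[OF F, of v] by (auto simp: independent_def)
    then obtain M where "M \<in> mis (dedges I) ?V" "component ?E v \<inter> ?V \<subseteq> M"
      using independent_subset_mis[of ?V "component ?E v \<inter> ?V" "dedges I"] demand_loop_free[OF I]
      by auto
    thus ?thesis
      using lab by auto
  qed
  then obtain choice where choice: "\<And>v. choice (component ?E v) \<in> \<Lambda>"
      "\<And>v. component ?E v \<inter> ?V \<subseteq> lab (choice (component ?E v))"
    using that[of "\<lambda>C. SOME a. a \<in> \<Lambda> \<and> C \<inter> ?V \<subseteq> lab a"] by (metis (no_types, lifting) someI_ex)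
  define h where "h v = choice (component ?E v)" for v
  show ?thesis
  proof
    have "v \<in> component ?E v" for v
      by (simp add: component_def)
    thus "labeling ?V \<Lambda> lab h"
      using choice by (fastforce simp: labeling_def h_def)
    have "h u = h v" if "{u, v} \<in> ?E" for u v
      using component_eq_of_edge[OF that] by (simp add: h_def)
    thus "label_cut I h \<subseteq> F"
      by (auto simp: label_cut_def)
  qed
qed

theorem label_cut_two_approx:
  assumes I: "valid_instance I" and lab: "mis (dedges I) {..<nverts I} = lab ` \<Lambda>"
    and f: "\<And>h. labeling {..<nverts I} \<Lambda> lab h \<Longrightarrow>
      label_cost {..<nverts I} (weight_matrix I) f \<le>
        2 * label_cost {..<nverts I} (weight_matrix I) h"
  shows "cost I (label_cut I f) \<le> 2 * opt I"
proof -
  have "opt I \<in> cost I ` {F. feasible I F}"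
    unfolding opt_def using finite_feasible[OF I] feasible_all_edges[OF I] by (intro Min_in) auto
  then obtain F where F: "feasible I F" "opt I = cost I F"
    by auto
  obtain h where h: "labeling {..<nverts I} \<Lambda> lab h" "label_cut I h \<subseteq> F"
    using labeling_of_multicut[OF I F(1) lab] .
  have "F \<subseteq> all_pairs {..<nverts I}" "\<forall>e\<in>F. 0 \<le> weight I e"
    using F(1) I by (auto simp: feasible_def valid_instance_def)
  moreover from this have "finite F"
    using finite_all_pairs[of "{..<nverts I}"] by (auto intro: finite_subset)
  ultimately have "cost I (label_cut I h) \<le> cost I F"
    unfolding cost_def using h(2) by (intro sum_mono2) auto
  thus ?thesis
    using f[OF h(1)] F(2) by (simp add: label_cost_eq_cost_label_cut[OF I])
qed

section \<open>Time-bounded program verification\<close>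

subsection \<open>Concrete syntax\<close>

notation Seq (infixr ";;" 58)
notation Cond ("(IF _/ THEN _/ ELSE _)" [0, 61, 61] 61)
notation NCell ("_\<langle>_\<rangle>" [1000, 0] 900)
notation NAdd (infixl "\<oplus>" 65)
notation NSub (infixl "\<ominus>" 65)
notation NStore ("_\<langle>_\<rangle> ::= _" [1000, 0, 65] 62)
notation RCell ("_\<langle>_\<rangle>\<^sub>r" [1000, 0] 900)
notation RAdd (infixl "\<oplus>\<^sub>r" 65)
notation RSub (infixl "\<ominus>\<^sub>r" 65)
notation RStore ("_\<langle>_\<rangle>\<^sub>r ::= _" [1000, 0, 65] 62)
notation NLess (infix "\<^bold><" 50)
notation RLess (infix "\<^bold><\<^sub>r" 50)
notation BNot ("\<^bold>\<not> _" [40] 40)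
notation BAnd (infixr "\<^bold>\<and>" 35)

abbreviation Var :: "nat \<Rightarrow> nexp" where
  "Var x \<equiv> x\<langle>NConst 0\<rangle>"

abbreviation RVar :: "nat \<Rightarrow> rexp" where
  "RVar x \<equiv> x\<langle>NConst 0\<rangle>\<^sub>r"

abbreviation Assign :: "nat \<Rightarrow> nexp \<Rightarrow> com" ("_ ::= _" [1000, 65] 62) where
  "x ::= y \<equiv> x\<langle>NConst 0\<rangle> ::= y"

abbreviation RAssign :: "nat \<Rightarrow> rexp \<Rightarrow> com" ("_ ::=\<^sub>r _" [1000, 65] 62) where
  "x ::=\<^sub>r y \<equiv> x\<langle>NConst 0\<rangle>\<^sub>r ::= y"

definition NEq :: "nexp \<Rightarrow> nexp \<Rightarrow> bexp" (infix "\<^bold>=" 50) where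
  "(x \<^bold>= y) = (\<^bold>\<not> x \<^bold>< y \<^bold>\<and> \<^bold>\<not> y \<^bold>< x)"

definition Nonzero :: "nexp \<Rightarrow> bexp" where
  "Nonzero x = (NConst 0 \<^bold>< x)"

definition BIff :: "bexp \<Rightarrow> bexp \<Rightarrow> bexp" (infix "\<^bold>\<longleftrightarrow>" 25) where
  "(b \<^bold>\<longleftrightarrow> c) = (\<^bold>\<not> (b \<^bold>\<and> \<^bold>\<not> c) \<^bold>\<and> \<^bold>\<not> (c \<^bold>\<and> \<^bold>\<not> b))"

definition For :: "nat \<Rightarrow> nexp \<Rightarrow> com \<Rightarrow> com" ("(FOR _ < _ DO _)" [1000, 0, 61] 61) where
  "(FOR x < b DO c) = (x ::= NConst 0 ;; While (Var x \<^bold>< b) (c ;; x ::= Var x \<oplus> NConst 1))"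

lemma bval_NEq [simp]: "bval (x \<^bold>= y) s \<longleftrightarrow> nval x s = nval y s"
  by (auto simp: NEq_def)

lemma bval_Nonzero [simp]: "bval (Nonzero x) s \<longleftrightarrow> nval x s \<noteq> 0"
  by (auto simp: Nonzero_def)

lemma bval_BIff [simp]: "bval (b \<^bold>\<longleftrightarrow> c) s \<longleftrightarrow> (bval b s \<longleftrightarrow> bval c s)"
  by (auto simp: BIff_def)

subsection \<open>Frame conditions\<close>

fun nreads :: "nexp \<Rightarrow> nat set" where
  "nreads (NConst c) = {}"
| "nreads (NCell a i) = insert a (nreads i)"
| "nreads (NAdd x y) = nreads x \<union> nreads y"
| "nreads (NSub x y) = nreads x \<union> nreads y"

fun nwrites :: "com \<Rightarrow> nat set" where
  "nwrites (NStore a i x) = {a}"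
| "nwrites (Seq c d) = nwrites c \<union> nwrites d"
| "nwrites (Cond b c d) = nwrites c \<union> nwrites d"
| "nwrites (While b c) = nwrites c"
| "nwrites _ = {}"

fun rwrites :: "com \<Rightarrow> nat set" where
  "rwrites (RStore a i x) = {a}"
| "rwrites (Seq c d) = rwrites c \<union> rwrites d"
| "rwrites (Cond b c d) = rwrites c \<union> rwrites d"
| "rwrites (While b c) = rwrites c"
| "rwrites _ = {}"

definition agree_outside :: "nat set \<Rightarrow> nat set \<Rightarrow> state \<Rightarrow> state \<Rightarrow> bool" where
  "agree_outside N R s t \<longleftrightarrow> (\<forall>a. a \<notin> N \<longrightarrow> nmem t a = nmem s a) \<and> (\<forall>a. a \<notin> R \<longrightarrow> rmem t a = rmem s a)"

lemma nmem_nupdate [simp]: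
  "nmem (nupdate a i x s) = (nmem s)(a := (nmem s a)(i := x))" "rmem (nupdate a i x s) = rmem s"
  by (simp_all add: nupdate_def)

lemma rmem_rupdate [simp]:
  "rmem (rupdate a i x s) = (rmem s)(a := (rmem s a)(i := x))" "nmem (rupdate a i x s) = nmem s"
  by (simp_all add: rupdate_def)

lemma writes_For [simp]:
  "nwrites (FOR x < b DO c) = insert x (nwrites c)" "rwrites (FOR x < b DO c) = rwrites c"
  by (auto simp: For_def)

lemma agree_outsideD:
  assumes "agree_outside N R s t"
  shows "a \<notin> N \<Longrightarrow> nmem t a = nmem s a" "a \<notin> R \<Longrightarrow> rmem t a = rmem s a"
  using assms by (simp_all add: agree_outside_def)

lemma agree_outside_refl: "agree_outside N R s s"
  by (simp add: agree_outside_def)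

lemma agree_outside_trans:
  assumes "agree_outside N R s t" "agree_outside N' R' t u" "N' \<subseteq> N" "R' \<subseteq> R"
  shows "agree_outside N R s u"
  using assms by (auto simp: agree_outside_def)

lemma agree_outside_nupdate: "agree_outside N R s t \<Longrightarrow> a \<in> N \<Longrightarrow> agree_outside N R s (nupdate a i x t)"
  by (auto simp: agree_outside_def)

lemma nval_agree_outside: "agree_outside N R s t \<Longrightarrow> nreads x \<inter> N = {} \<Longrightarrow> nval x t = nval x s"
  by (induction x) (auto simp: agree_outside_def Int_Un_distrib2)

lemma exec_agree_outside: "exec c s T t \<Longrightarrow> agree_outside (nwrites c) (rwrites c) s t"
  by (induction rule: exec.induct) (auto simp: agree_outside_def)

subsection \<open>Proof rules\<close>

text \<open>
  If every loop makes at most \<open>z\<close> iterations, a program \<open>c\<close> halts within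
  \<open>z ^ time_exponent c\<close> steps, so no running time has to be computed explicitly.
\<close>

fun time_exponent :: "com \<Rightarrow> nat" where
  "time_exponent (Seq c d) = max (time_exponent c) (time_exponent d) + 1"
| "time_exponent (Cond b c d) = max (time_exponent c) (time_exponent d) + 1"
| "time_exponent (While b c) = time_exponent c + 3"
| "time_exponent _ = 0"

locale time_bound =
  fixes z :: nat
  assumes two_le_bound: "2 \<le> z"
begin

definition reaches :: "com \<Rightarrow> state \<Rightarrow> state \<Rightarrow> bool" where
  "reaches c s t \<longleftrightarrow> (\<exists>T. exec c s T t \<and> T \<le> z ^ time_exponent c)"

definition runs :: "com \<Rightarrow> state \<Rightarrow> (state \<Rightarrow> bool) \<Rightarrow> bool" where
  "runs c s Q \<longleftrightarrow> (\<exists>t. reaches c s t \<and> Q t)"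

lemma reaches_agree_outside: "reaches c s t \<Longrightarrow> agree_outside (nwrites c) (rwrites c) s t"
  using exec_agree_outside by (auto simp: reaches_def)

lemmas reaches_frame = agree_outsideD[OF reaches_agree_outside]

lemma runsI: "reaches c s t \<Longrightarrow> Q t \<Longrightarrow> runs c s Q"
  by (auto simp: runs_def)

lemma runsE:
  assumes "runs c s Q"
  obtains t where "reaches c s t" "Q t"
  using assms by (auto simp: runs_def)

lemma runs_conseq:
  assumes "runs c s Q" "\<And>t. reaches c s t \<Longrightarrow> Q t \<Longrightarrow> Q' t"
  shows "runs c s Q'"
  using assms by (auto simp: runs_def)

lemma runs_Skip: "Q s \<Longrightarrow> runs Skip s Q"
  by (rule runsI) (auto simp: reaches_def intro!: exI[of _ 1] exec.Skip[unfolded One_nat_def])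

lemma reaches_NStore: "reaches (a\<langle>i\<rangle> ::= x) s (nupdate a (nval i s) (nval x s) s)"
  by (auto simp: reaches_def intro!: exI[of _ 1] exec.NStore[unfolded One_nat_def])

lemma runs_NStore: "Q (nupdate a (nval i s) (nval x s) s) \<Longrightarrow> runs (a\<langle>i\<rangle> ::= x) s Q"
  by (rule runsI[OF reaches_NStore])

lemma runs_RStore: "Q (rupdate a (nval i s) (rval x s) s) \<Longrightarrow> runs (a\<langle>i\<rangle>\<^sub>r ::= x) s Q"
  by (rule runsI) (auto simp: reaches_def intro!: exI[of _ 1] exec.RStore[unfolded One_nat_def])

lemma time_exponent_branches_le:
  fixes c d :: com
  assumes "T \<le> z ^ time_exponent c" "U \<le> z ^ time_exponent d"
  shows "T + U \<le> z ^ (max (time_exponent c) (time_exponent d) + 1)"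
proof -
  let ?m = "max (time_exponent c) (time_exponent d)"
  have "T \<le> z ^ ?m" "U \<le> z ^ ?m"
    using assms two_le_bound by (auto intro: order.trans power_increasing)
  hence "T + U \<le> 2 * z ^ ?m"
    by linarith
  also have "\<dots> \<le> z ^ (?m + 1)"
    using two_le_bound by simp
  finally show ?thesis .
qed

lemma reaches_Seq:
  assumes "reaches c s t" "reaches d t u"
  shows "reaches (c ;; d) s u"
  using assms exec.Seq time_exponent_branches_le unfolding reaches_def time_exponent.simps by meson

lemma runs_reaches_Seq: "reaches c s t \<Longrightarrow> runs d t Q \<Longrightarrow> runs (c ;; d) s Q"
  unfolding runs_def using reaches_Seq by blast

lemma runs_Seq: "runs c s (\<lambda>t. runs d t Q) \<Longrightarrow> runs (c ;; d) s Q"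
  by (erule runsE) (rule runs_reaches_Seq)

lemma runs_Cond:
  assumes "bval b s \<Longrightarrow> runs c s Q" "\<not> bval b s \<Longrightarrow> runs d s Q"
  shows "runs (IF b THEN c ELSE d) s Q"
proof (cases "bval b s")
  case True
  then obtain T t where T: "exec c s T t" "T \<le> z ^ time_exponent c" "Q t"
    using assms(1) by (auto simp: runs_def reaches_def)
  have "T + 1 \<le> z ^ time_exponent (IF b THEN c ELSE d)"
    using time_exponent_branches_le[OF T(2), of 1 d] two_le_bound by simp
  with exec.CondTrue[OF True T(1)] T(3) show ?thesis
    unfolding runs_def reaches_def by blast
next
  case False
  then obtain T t where T: "exec d s T t" "T \<le> z ^ time_exponent d" "Q t"
    using assms(2) by (auto simp: runs_def reaches_def)
  have "1 + T \<le> z ^ time_exponent (IF b THEN c ELSE d)"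
    using time_exponent_branches_le[OF _ T(2), of 1 c] two_le_bound by simp
  with exec.CondFalse[OF False T(1)] T(3) show ?thesis
    unfolding runs_def reaches_def by (metis add.commute)
qed

lemmas runs_intros = runs_Skip runs_NStore runs_RStore runs_Seq runs_Cond

lemma exec_While_counter:
  assumes x: "x \<notin> nwrites c"
    and bound: "\<And>t. agree_outside (insert x (nwrites c)) (rwrites c) s t \<Longrightarrow> nval b t = m"
    and step: "\<And>i t. i < m \<Longrightarrow> Inv i t \<Longrightarrow> nmem t x 0 = i \<Longrightarrow>
      agree_outside (insert x (nwrites c)) (rwrites c) s t \<Longrightarrow>
      runs c t (\<lambda>t'. Inv (Suc i) (nupdate x 0 (Suc i) t'))"
    and "Inv i t" "nmem t x 0 = i" "agree_outside (insert x (nwrites c)) (rwrites c) s t"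
      "i + j = m"
  shows "\<exists>T t'. exec (While (Var x \<^bold>< b) (c ;; x ::= Var x \<oplus> NConst 1)) t T t' \<and>
    T \<le> j * (z ^ time_exponent c + 2) + 1 \<and> Inv m t'"
  using assms(4-7)
proof (induction j arbitrary: i t)
  case 0
  hence "\<not> bval (Var x \<^bold>< b) t"
    using bound by simp
  from exec.WhileFalse[OF this] show ?case
    using 0 by (intro exI[of _ 1] exI[of _ t]) simp
next
  case (Suc j)
  let ?c = "c ;; x ::= Var x \<oplus> NConst 1"
  obtain T t' where T: "exec c t T t'" "T \<le> z ^ time_exponent c"
    "Inv (Suc i) (nupdate x 0 (Suc i) t')"
    using step[of i t] Suc.prems by (auto simp: runs_def reaches_def)
  have agree: "agree_outside (nwrites c) (rwrites c) t t'"
    using T(1) by (rule exec_agree_outside)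
  let ?t = "nupdate x 0 (Suc i) t'"
  have body: "exec ?c t (T + 1) ?t"
    using exec.Seq[OF T(1) exec.NStore[of x "NConst 0" "Var x \<oplus> NConst 1" t']]
      agree_outsideD(1)[OF agree x] Suc.prems(2) by simp
  have "agree_outside (insert x (nwrites c)) (rwrites c) s ?t"
    using agree_outside_trans[OF Suc.prems(3) agree] by (intro agree_outside_nupdate) auto
  then obtain U u where U: "exec (While (Var x \<^bold>< b) ?c) ?t U u"
      "U \<le> j * (z ^ time_exponent c + 2) + 1" "Inv m u"
    using Suc.IH[of "Suc i" ?t] T(3) Suc.prems(4) by auto
  have "bval (Var x \<^bold>< b) t"
    using bound[OF Suc.prems(3)] Suc.prems(2,4) by simp
  hence "exec (While (Var x \<^bold>< b) ?c) t (T + 1 + U + 1) u"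
    using body U(1) by (rule exec.WhileTrue)
  moreover have "T + 1 + U + 1 \<le> Suc j * (z ^ time_exponent c + 2) + 1"
    using T(2) U(2) by simp
  ultimately show ?case
    using U(3) by blast
qed

lemma time_For_le:
  assumes "m \<le> z" "T \<le> m * (z ^ time_exponent c + 2) + 1"
  shows "1 + T \<le> z ^ time_exponent (FOR x < b DO c)"
proof -
  let ?d = "time_exponent c"
  have "1 + T \<le> z * (z ^ ?d + 2) + 2"
    using assms mult_le_mono1[of m z "z ^ ?d + 2"] by linarith
  also have "\<dots> \<le> z * (z ^ ?d + 3)"
    using two_le_bound by (simp add: algebra_simps)
  also have "\<dots> \<le> z * (4 * z ^ ?d)"
    using two_le_bound by (intro mult_le_mono2) (simp add: Suc_le_eq)
  also have "\<dots> \<le> z * ((z * z) * z ^ ?d)"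
    using mult_mono[OF two_le_bound two_le_bound] by (intro mult_le_mono2 mult_le_mono1) simp
  also have "\<dots> = z ^ (?d + 3)"
    by (simp add: power_add power3_eq_cube)
  also have "\<dots> \<le> z ^ time_exponent (FOR x < b DO c)"
    using two_le_bound by (intro power_increasing) (auto simp: For_def)
  finally show ?thesis .
qed

theorem runs_For:
  assumes bound: "nval b s = m" "m \<le> z" "nreads b \<inter> insert x (nwrites c) = {}"
    and x: "x \<notin> nwrites c"
    and init: "Inv 0 (nupdate x 0 0 s)"
    and step: "\<And>i t. i < m \<Longrightarrow> Inv i t \<Longrightarrow> nmem t x 0 = i \<Longrightarrow>
      agree_outside (insert x (nwrites c)) (rwrites c) s t \<Longrightarrow>
      runs c t (\<lambda>t'. Inv (Suc i) (nupdate x 0 (Suc i) t'))"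
  shows "runs (FOR x < b DO c) s (Inv m)"
proof -
  let ?t = "nupdate x 0 0 s"
  have "nval b t = m" if "agree_outside (insert x (nwrites c)) (rwrites c) s t" for t
    using nval_agree_outside[OF that bound(3)] bound(1) by simp
  moreover have "agree_outside (insert x (nwrites c)) (rwrites c) s ?t"
    by (intro agree_outside_nupdate agree_outside_refl) simp
  ultimately obtain T u where T:
      "exec (While (Var x \<^bold>< b) (c ;; x ::= Var x \<oplus> NConst 1)) ?t T u"
      "T \<le> m * (z ^ time_exponent c + 2) + 1" "Inv m u"
    using exec_While_counter[of x c s b m Inv 0 ?t m] x init step by auto
  have "exec (FOR x < b DO c) s (1 + T) u"
    unfolding For_def using exec.Seq[OF exec.NStore[of x "NConst 0" "NConst 0" s]] T(1) by simp
  with T(3) time_For_le[OF bound(2) T(2)] show ?thesis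
    unfolding runs_def reaches_def by blast
qed

subsection \<open>Loop schemes\<close>

lemma runs_For_sum:
  assumes bound: "nval b s = m" "m \<le> z" "nreads b \<inter> insert x (nwrites c) = {}"
    and x: "x \<notin> nwrites c"
    and step: "\<And>i t. i < m \<Longrightarrow> nmem t x 0 = i \<Longrightarrow> agree_outside (insert x (nwrites c)) (rwrites c) s t \<Longrightarrow>
      runs c t (\<lambda>t'. rmem t' r 0 = rmem t r 0 + g i)"
  shows "runs (FOR x < b DO c) s (\<lambda>t. rmem t r 0 = rmem s r 0 + (\<Sum>i<m. g i))"
proof (rule runs_For[OF bound x], goal_cases init step)
  case (step i t)
  from assms(5)[OF step(1,3,4)] show ?case
    by (rule runs_conseq) (use step(2) in simp)
qed simp

end

definition overwrite :: "(nat \<Rightarrow> 'v) \<Rightarrow> nat \<Rightarrow> nat \<Rightarrow> (nat \<Rightarrow> 'v) \<Rightarrow> nat \<Rightarrow> 'v" where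
  "overwrite A k m F j = (if k \<le> j \<and> j < k + m then F (j - k) else A j)"

lemma overwrite_0: "overwrite A k 0 F = A"
  by (rule ext) (auto simp: overwrite_def)

lemma overwrite_Suc: "overwrite A k (Suc m) F = (overwrite A k m F)(k + m := F m)"
  by (auto simp: overwrite_def fun_eq_iff)

lemma matrix_index_less:
  fixes u v m n :: nat
  assumes "u < m" "v < n"
  shows "u * n + v < m * n"
proof -
  have "u * n + v < Suc u * n"
    using assms(2) by simp
  also have "\<dots> \<le> m * n"
    using assms(1) by (intro mult_le_mono1) simp
  finally show ?thesis .
qed

definition search_result :: "(nat \<Rightarrow> bool) \<Rightarrow> nat \<Rightarrow> nat \<Rightarrow> bool" where
  "search_result P m k \<longleftrightarrow> (case k of 0 \<Rightarrow> \<forall>i<m. \<not> P i | Suc i \<Rightarrow> i < m \<and> P i)"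

lemma search_result_eq_0_iff: "search_result P m k \<Longrightarrow> k = 0 \<longleftrightarrow> (\<forall>i<m. \<not> P i)"
  by (auto simp: search_result_def split: nat.splits)

lemma search_result_witness: "search_result P m k \<Longrightarrow> k \<noteq> 0 \<Longrightarrow> k - 1 < m \<and> P (k - 1)"
  by (auto simp: search_result_def split: nat.splits)

text \<open>\<open>y\<close> receives \<open>i + 1\<close> for the last \<open>i\<close> satisfying the test, or 0.\<close>

definition Search :: "nat \<Rightarrow> nat \<Rightarrow> nexp \<Rightarrow> com \<Rightarrow> bexp \<Rightarrow> com" where
  "Search y x b c q =
     (y ::= NConst 0 ;; FOR x < b DO (c ;; IF q THEN y ::= Var x \<oplus> NConst 1 ELSE Skip))"

lemma writes_Search [simp]:
  "nwrites (Search y x b c q) = insert y (insert x (nwrites c))"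
  "rwrites (Search y x b c q) = rwrites c"
  by (auto simp: Search_def)

primrec Repeat :: "nat list \<Rightarrow> nexp \<Rightarrow> com \<Rightarrow> com" where
  "Repeat [] b c = c"
| "Repeat (x # xs) b c = (FOR x < b DO Repeat xs b c)"

lemma writes_Repeat [simp]:
  "nwrites (Repeat xs b c) = set xs \<union> nwrites c" "rwrites (Repeat xs b c) = rwrites c"
  by (induction xs) auto

context time_bound
begin

lemma runs_tabulate:
  assumes bound: "nval b s = m" "m \<le> z" "nreads b \<inter> insert x (nwrites c) = {}"
    and x: "x \<notin> nwrites c"
    and get: "\<And>k t. get (nupdate x 0 k t) = get t"
    and step: "\<And>i t. i < m \<Longrightarrow> nmem t x 0 = i \<Longrightarrow> agree_outside (insert x (nwrites c)) (rwrites c) s t \<Longrightarrow>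
      runs c t (\<lambda>t'. get t' = (get t)(k + i := F i))"
  shows "runs (FOR x < b DO c) s (\<lambda>t. get t = overwrite (get s) k m F)"
proof (rule runs_For[OF bound x], goal_cases init step)
  case init
  show ?case
    by (simp add: get overwrite_0)
next
  case (step i t)
  from assms(6)[OF step(1,3,4)] show ?case
    by (rule runs_conseq) (use step(2) in \<open>simp add: get overwrite_Suc\<close>)
qed

lemma runs_tabulate_matrix:
  assumes bound: "nval b s = n" "n \<le> z" "nreads b \<inter> insert x (insert y (nwrites c)) = {}"
    and xy: "x \<notin> nwrites c" "y \<notin> nwrites c" "x \<noteq> y"
    and get: "\<And>k t. get (nupdate x 0 k t) = get t" "\<And>k t. get (nupdate y 0 k t) = get t"
    and step: "\<And>u v t. u < n \<Longrightarrow> v < n \<Longrightarrow> nmem t x 0 = u \<Longrightarrow> nmem t y 0 = v \<Longrightarrow>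
      agree_outside (insert x (insert y (nwrites c))) (rwrites c) s t \<Longrightarrow>
      runs c t (\<lambda>t'. get t' = (get t)(u * n + v := F u v))"
  shows "runs (FOR x < b DO FOR y < b DO c) s (\<lambda>t. \<forall>u<n. \<forall>v<n. get t (u * n + v) = F u v)"
proof (rule runs_conseq[OF runs_For[OF bound(1,2), where
      Inv = "\<lambda>u t. get t = overwrite (get s) 0 (u * n) (\<lambda>j. F (j div n) (j mod n))"]],
    goal_cases disjoint counter init step final)
  case init
  show ?case
    by (simp add: get overwrite_0)
next
  case (step u t)
  have "nval b t = n"
    using nval_agree_outside[OF step(4)] bound by auto
  moreover have "runs c t' (\<lambda>t''. get t'' = (get t')(u * n + v := F u v))"
    if t': "v < n" "nmem t' y 0 = v"
      "agree_outside (insert y (nwrites c)) (rwrites c) t t'" for v t'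
  proof (rule assms(9))
    show "nmem t' x 0 = u"
      using agree_outsideD(1)[OF t'(3), of x] xy step(3) by simp
    show "agree_outside (insert x (insert y (nwrites c))) (rwrites c) s t'"
      using agree_outside_trans[OF step(4) t'(3)] by auto
  qed (use step(1) t' in auto)
  ultimately have row: "runs (FOR y < b DO c) t (\<lambda>t'. get t' = overwrite (get t) (u * n) n (F u))"
    using bound xy get by (intro runs_tabulate) auto
  let ?F = "\<lambda>j. F (j div n) (j mod n)"
  have "overwrite (overwrite (get s) 0 (u * n) ?F) (u * n) n (F u) =
      overwrite (get s) 0 (Suc u * n) ?F"
  proof
    fix j
    consider "j < u * n" | v where "j = u * n + v" "v < n" | "Suc u * n \<le> j"
      by (metis add.commute le_add_diff_inverse less_diff_conv2 mult_Suc not_le)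
    thus "overwrite (overwrite (get s) 0 (u * n) ?F) (u * n) n (F u) j =
        overwrite (get s) 0 (Suc u * n) ?F j"
      by cases (auto simp: overwrite_def)
  qed
  with row show ?case
    using step(2) by (elim runs_conseq) (simp add: get)
next
  case (final t)
  thus ?case
    using matrix_index_less by (simp add: overwrite_def)
qed (use bound xy in auto)

lemma runs_Search:
  assumes bound: "nval b s = m" "m \<le> z" "nreads b \<inter> insert y (insert x (nwrites c)) = {}"
    and xy: "x \<notin> nwrites c" "y \<notin> nwrites c" "x \<noteq> y"
    and step: "\<And>i t. i < m \<Longrightarrow> nmem t x 0 = i \<Longrightarrow>
      agree_outside (insert y (insert x (nwrites c))) (rwrites c) s t \<Longrightarrow>
      runs c t (\<lambda>t'. bval q t' \<longleftrightarrow> P i)"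
  shows "runs (Search y x b c q) s (\<lambda>t. search_result P m (nmem t y 0))"
  unfolding Search_def
proof (rule runs_Seq, rule runs_NStore, rule runs_For[OF _ bound(2)],
    goal_cases bound disjoint counter init step)
  case bound
  show ?case
    using nval_agree_outside[OF agree_outside_nupdate[OF agree_outside_refl, of y "{y}"]] assms(1,3)
    by simp
next
  case init
  show ?case
    using xy by (simp add: search_result_def)
next
  case (step i t)
  have agree: "agree_outside (insert y (insert x (nwrites c))) (rwrites c) s t"
    using step(4) by (auto simp: agree_outside_def)
  obtain t' where t': "reaches c t t'" "bval q t' \<longleftrightarrow> P i"
    using assms(7)[OF step(1,3) agree] by (rule runsE)
  have "nmem t' x 0 = i" "nmem t' y = nmem t y"
    using reaches_frame(1)[OF t'(1)] xy step(3) by auto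
  with step(1,2) t'(2) show ?case
    using xy by (intro runs_reaches_Seq[OF t'(1)] runs_intros)
      (auto simp: search_result_def less_Suc_eq split: nat.splits)
qed (use bound xy in auto)

lemma runs_Repeat:
  assumes bound: "nval b s = m" "m \<le> z" "nreads b \<inter> (set xs \<union> nwrites c) = {}"
    and xs: "distinct xs" "set xs \<inter> nwrites c = {}"
    and stable: "\<And>i x k t. x \<in> set xs \<Longrightarrow> Inv i t \<Longrightarrow> Inv i (nupdate x 0 k t)"
    and init: "Inv 0 s"
    and step: "\<And>i t. Inv i t \<Longrightarrow> agree_outside (set xs \<union> nwrites c) (rwrites c) s t \<Longrightarrow>
      runs c t (Inv (Suc i))"
  shows "runs (Repeat xs b c) s (Inv (m ^ length xs))"
proof -
  let ?agree = "agree_outside (set xs \<union> nwrites c) (rwrites c) s"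
  have "runs (Repeat ys b c) t (Inv (i + m ^ length ys))"
    if "set ys \<subseteq> set xs" "distinct ys" "Inv i t" "?agree t" for ys i t
    using that
  proof (induction ys arbitrary: i t)
    case Nil
    thus ?case
      using step by simp
  next
    case (Cons y ys)
    have bound_t: "nval b t = m"
      using nval_agree_outside[OF Cons.prems(4) bound(3)] bound(1) by simp
    have "runs (FOR y < b DO Repeat ys b c) t (Inv (i + m * m ^ length ys))"
    proof (rule runs_For[OF bound_t bound(2), where Inv = "\<lambda>j. Inv (i + j * m ^ length ys)"],
        goal_cases disjoint counter init step)
      case (step j t')
      have "?agree t'"
        using Cons.prems(1) by (intro agree_outside_trans[OF Cons.prems(4) step(4)]) auto
      hence "runs (Repeat ys b c) t' (Inv (i + j * m ^ length ys + m ^ length ys))"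
        using Cons.prems step(2) by (intro Cons.IH) auto
      moreover have "i + j * m ^ length ys + m ^ length ys = i + Suc j * m ^ length ys"
        by simp
      ultimately show ?case
        using stable Cons.prems(1) by (elim runs_conseq) (simp only:, auto)
    qed (use bound(3) xs(2) Cons.prems stable in auto)
    thus ?case
      by simp
  qed
  from this[of xs 0 s] show ?thesis
    using xs(1) init agree_outside_refl by simp
qed

end

section \<open>Enumerating the maximal independent sets\<close>

text \<open>
  Arrays named \<open>a...\<close> hold natural numbers, those named \<open>r...\<close> reals; the numbers below 5 and the
  real array 0 are fixed by the input and output conventions. There is no multiplication: array
  \<open>aROW\<close> is a table of the multiples of \<open>n\<close>. The independent sets found so far are the first \<open>aCNT\<close>
  rows of \<open>aFAM\<close>, those of the next stage the first \<open>aCNT'\<close> rows of \<open>aNEW\<close>, whose next row is the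
  candidate under consideration.
\<close>

abbreviation (input) "aN \<equiv> (0 :: nat)"
abbreviation (input) "aH \<equiv> (3 :: nat)"
abbreviation (input) "aROW \<equiv> (5 :: nat)"
abbreviation (input) "aFAM \<equiv> (6 :: nat)"
abbreviation (input) "aNEW \<equiv> (7 :: nat)"
abbreviation (input) "aCNT \<equiv> (8 :: nat)"
abbreviation (input) "aCNT' \<equiv> (9 :: nat)"
abbreviation (input) "aX \<equiv> (10 :: nat)"
abbreviation (input) "aI \<equiv> (11 :: nat)"
abbreviation (input) "aJ \<equiv> (12 :: nat)"
abbreviation (input) "aU \<equiv> (13 :: nat)"
abbreviation (input) "aV \<equiv> (14 :: nat)"
abbreviation (input) "aHIT \<equiv> (15 :: nat)"
abbreviation (input) "aCONFLICT \<equiv> (16 :: nat)"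
abbreviation (input) "aDIFF \<equiv> (17 :: nat)"
abbreviation (input) "aDUP \<equiv> (18 :: nat)"

abbreviation MCell :: "nat \<Rightarrow> nexp \<Rightarrow> nexp \<Rightarrow> nexp" ("_\<langle>_, _\<rangle>" [1000, 0, 0] 900) where
  "a\<langle>i, j\<rangle> \<equiv> a\<langle>aROW\<langle>i\<rangle> \<oplus> j\<rangle>"

abbreviation MStore :: "nat \<Rightarrow> nexp \<Rightarrow> nexp \<Rightarrow> nexp \<Rightarrow> com" ("_\<langle>_, _\<rangle> ::= _" [1000, 0, 0, 65] 62) where
  "a\<langle>i, j\<rangle> ::= x \<equiv> a\<langle>aROW\<langle>i\<rangle> \<oplus> j\<rangle> ::= x"

text \<open>With these equations the simplifier computes which arrays a program writes.\<close>

named_theorems program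

definition fill_rows :: com where [program]:
  "fill_rows = (aROW\<langle>NConst 0\<rangle> ::= NConst 0 ;;
     FOR aX < Var aN \<oplus> (Var aCNT \<oplus> Var aCNT) DO
       aROW\<langle>Var aX \<oplus> NConst 1\<rangle> ::= aROW\<langle>Var aX\<rangle> \<oplus> Var aN)"

definition copy_member :: com where [program]:
  "copy_member = (FOR aV < Var aN DO aNEW\<langle>Var aCNT', Var aV\<rangle> ::= aFAM\<langle>Var aI, Var aV\<rangle>)"

definition exchange_member :: com where [program]:
  "exchange_member = ((FOR aV < Var aN DO
       IF Nonzero (aH\<langle>Var aV, Var aJ\<rangle>) THEN aNEW\<langle>Var aCNT', Var aV\<rangle> ::= NConst 0
       ELSE aNEW\<langle>Var aCNT', Var aV\<rangle> ::= aFAM\<langle>Var aI, Var aV\<rangle>) ;;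
     aNEW\<langle>Var aCNT', Var aJ\<rangle> ::= NConst 1)"

definition find_neighbour :: com where [program]:
  "find_neighbour = Search aHIT aU (Var aJ \<oplus> NConst 1) Skip
     (Nonzero (aNEW\<langle>Var aCNT', Var aU\<rangle>) \<^bold>\<and> Nonzero (aH\<langle>Var aU, Var aV\<rangle>))"

definition find_conflict :: com where [program]:
  "find_conflict = Search aCONFLICT aV (Var aJ \<oplus> NConst 1) find_neighbour
     (Nonzero (aNEW\<langle>Var aCNT', Var aV\<rangle>) \<^bold>\<longleftrightarrow> Nonzero (Var aHIT))"

definition find_difference :: com where [program]:
  "find_difference = Search aDIFF aV (Var aN) Skip
     (\<^bold>\<not> (Nonzero (aNEW\<langle>Var aU, Var aV\<rangle>) \<^bold>\<longleftrightarrow> Nonzero (aNEW\<langle>Var aCNT', Var aV\<rangle>)))"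

definition find_duplicate :: com where [program]:
  "find_duplicate = Search aDUP aU (Var aCNT') find_difference (\<^bold>\<not> Nonzero (Var aDIFF))"

definition keep_candidate :: com where [program]:
  "keep_candidate = (find_conflict ;; find_duplicate ;;
     IF \<^bold>\<not> Nonzero (Var aCONFLICT) \<^bold>\<and> \<^bold>\<not> Nonzero (Var aDUP)
     THEN aCNT' ::= Var aCNT' \<oplus> NConst 1 ELSE Skip)"

definition extend_member :: com where [program]:
  "extend_member = ((copy_member ;; keep_candidate) ;; exchange_member ;; keep_candidate)"

definition extend_family :: com where [program]:
  "extend_family = (FOR aI < Var aCNT DO extend_member)"

definition copy_family :: com where [program]:
  "copy_family = ((FOR aX < aROW\<langle>Var aCNT'\<rangle> DO aFAM\<langle>Var aX\<rangle> ::= aNEW\<langle>Var aX\<rangle>) ;;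
     aCNT ::= Var aCNT')"

definition mis_stage :: com where [program]:
  "mis_stage = (fill_rows ;; aCNT' ::= NConst 0 ;; extend_family ;; copy_family)"

definition enum_mis :: com where [program]:
  "enum_mis = (aCNT ::= NConst 1 ;; FOR aJ < Var aN DO mis_stage)"

definition row_table :: "nat \<Rightarrow> nat \<Rightarrow> state \<Rightarrow> bool" where
  "row_table n m s \<longleftrightarrow> nmem s aN 0 = n \<and> (\<forall>i\<le>m. nmem s aROW i = i * n)"

definition row :: "nat \<Rightarrow> (nat \<Rightarrow> nat) \<Rightarrow> nat \<Rightarrow> nat set" where
  "row n A i = {v. v < n \<and> A (i * n + v) \<noteq> 0}"

definition family :: "nat \<Rightarrow> (nat \<Rightarrow> nat) \<Rightarrow> nat \<Rightarrow> nat set set \<Rightarrow> bool" where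
  "family n A D S \<longleftrightarrow> inj_on (row n A) {..<D} \<and> row n A ` {..<D} = S"

definition adjacency :: "nat \<Rightarrow> nat set set \<Rightarrow> state \<Rightarrow> bool" where
  "adjacency n E s \<longleftrightarrow> (\<forall>u<n. \<forall>v<n. nmem s aH (u * n + v) \<noteq> 0 \<longleftrightarrow> {u, v} \<in> E)"

lemma row_tableD:
  assumes "row_table n m s"
  shows "nmem s aN 0 = n" "i \<le> m \<Longrightarrow> nmem s aROW i = i * n"
  using assms by (simp_all add: row_table_def)

lemma adjacencyD: "adjacency n E s \<Longrightarrow> u < n \<Longrightarrow> v < n \<Longrightarrow> nmem s aH (u * n + v) \<noteq> 0 \<longleftrightarrow> {u, v} \<in> E"
  by (simp add: adjacency_def)

lemma matrix_index_eq_iff: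
  fixes i j v w n :: nat
  assumes "v < n" "w < n"
  shows "i * n + v = j * n + w \<longleftrightarrow> i = j \<and> v = w"
proof
  assume eq: "i * n + v = j * n + w"
  have "(i * n + v) div n = i" "(j * n + w) div n = j"
    using assms by simp_all
  thus "i = j \<and> v = w"
    using eq by auto
qed simp

lemma mem_row_iff: "v < n \<Longrightarrow> v \<in> row n A i \<longleftrightarrow> A (i * n + v) \<noteq> 0"
  by (simp add: row_def)

lemma row_eq_iff: "row n A i = row n B k \<longleftrightarrow> (\<forall>v<n. A (i * n + v) \<noteq> 0 \<longleftrightarrow> B (k * n + v) \<noteq> 0)"
  by (auto simp: row_def)

lemma row_overwrite:
  "row n (overwrite A (k * n) n F) i = (if i = k then {v. v < n \<and> F v \<noteq> 0} else row n A i)"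
proof (cases "i = k")
  case False
  have "overwrite A (k * n) n F (i * n + v) = A (i * n + v)" if v: "v < n" for v
  proof (cases "k * n \<le> i * n + v \<and> i * n + v < k * n + n")
    case True
    then obtain w where "i * n + v = k * n + w" "w < n"
      by (metis le_iff_add nat_add_left_cancel_less)
    thus ?thesis
      using matrix_index_eq_iff[OF v, of w i k] False by simp
  qed (auto simp: overwrite_def)
  thus ?thesis
    using False by (auto simp: row_def)
qed (auto simp: row_def overwrite_def)

lemma row_fun_upd:
  assumes "j < n" "x \<noteq> 0"
  shows "row n (A(k * n + j := x)) i = (if i = k then insert j (row n A i) else row n A i)"
  using assms by (auto simp: row_def matrix_index_eq_iff)

lemma card_family: "family n A D S \<Longrightarrow> card S = D"
  unfolding family_def using card_image[of "row n A" "{..<D}"] by auto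

lemma family_cong: "(\<And>i. i < D \<Longrightarrow> row n A i = row n B i) \<Longrightarrow> family n A D S \<longleftrightarrow> family n B D S"
  unfolding family_def by (intro conj_cong inj_on_cong arg_cong2[of _ _ _ _ "(=)"] image_cong) auto

lemma family_Suc: "family n A D S \<Longrightarrow> row n A D \<notin> S \<Longrightarrow> family n A (Suc D) (insert (row n A D) S)"
  by (auto simp: family_def lessThan_Suc)

locale matrix_ram = time_bound +
  fixes n :: nat
  assumes dim_bound: "n + 2 \<le> z"
begin

lemma dim_le: "n \<le> z" "n + 1 \<le> z"
  using dim_bound by simp_all

lemma runs_fill_rows:
  assumes "nmem s aN 0 = n" "nmem s aCNT 0 = C" "n + (C + C) \<le> z"
  shows "runs fill_rows s (row_table n (n + (C + C)))"
  unfolding fill_rows_def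
proof (rule runs_Seq, rule runs_NStore, rule runs_conseq[OF runs_For[where m = "n + (C + C)" and
      Inv = "\<lambda>k t. \<forall>i\<le>k. nmem t aROW i = i * n"]],
    goal_cases bound le disjoint counter init step final)
  case (step k t)
  note [simp] = agree_outsideD[OF step(4), simplified]
  show ?case
    using step(1-3) assms by (intro runs_intros) (auto simp: le_Suc_eq)
next
  case (final t)
  note [simp] = reaches_frame[OF final(1), simplified]
  show ?case
    using final(2) assms by (simp add: row_table_def)
qed (use assms in auto)

lemma runs_copy_member:
  assumes tab: "row_table n m s" and i: "nmem s aI 0 = i" "i \<le> m"
    and D: "nmem s aCNT' 0 = D" "D \<le> m"
  shows "runs copy_member s (\<lambda>t. row n (nmem t aNEW) D = row n (nmem s aFAM) i \<and>
    (\<forall>k. k \<noteq> D \<longrightarrow> row n (nmem t aNEW) k = row n (nmem s aNEW) k))"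
  unfolding copy_member_def
proof (rule runs_conseq[OF runs_tabulate[where m = n and get = "\<lambda>t. nmem t aNEW" and k = "D * n" and
      F = "\<lambda>v. nmem s aFAM (i * n + v)"]], goal_cases bound le disjoint counter get step final)
  case (step v t)
  note [simp] = agree_outsideD[OF step(3), simplified]
  show ?case
    using step(2) i D by (intro runs_intros) (simp add: row_tableD[OF tab])
next
  case (final t)
  thus ?case
    unfolding final(2) row_overwrite by (simp add: row_def)
qed (use dim_le in \<open>simp_all add: row_tableD[OF tab]\<close>)

lemma runs_exchange_member:
  assumes tab: "row_table n m s" "n \<le> m" and adj: "adjacency n E s" and j: "nmem s aJ 0 = j" "j < n"
    and i: "nmem s aI 0 = i" "i \<le> m" and D: "nmem s aCNT' 0 = D" "D \<le> m" and no_loop: "{j} \<notin> E"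
  shows "runs exchange_member s (\<lambda>t.
    row n (nmem t aNEW) D = mis_exchange E j (row n (nmem s aFAM) i) \<and>
    (\<forall>k. k \<noteq> D \<longrightarrow> row n (nmem t aNEW) k = row n (nmem s aNEW) k))"
  unfolding exchange_member_def
proof (rule runs_Seq, rule runs_conseq[OF runs_tabulate[where m = n and get = "\<lambda>t. nmem t aNEW" and
      k = "D * n" and F = "\<lambda>v. if {v, j} \<in> E then 0 else nmem s aFAM (i * n + v)"]],
    goal_cases bound le disjoint counter get step final)
  case (step v t)
  note [simp] = agree_outsideD[OF step(3), simplified]
  show ?case
    using step(1,2) i j D tab(2) adjacencyD[OF adj step(1) j(2)]
    by (intro runs_intros) (simp_all add: row_tableD[OF tab(1)])
next
  case (final t)
  note [simp] = reaches_frame[OF final(1), simplified]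
  have "row n (nmem t aNEW) k = (if k = D then nonneighbours E j (row n (nmem s aFAM) i)
      else row n (nmem s aNEW) k)" for k
    unfolding final(2) row_overwrite by (auto simp: row_def nonneighbours_def)
  thus ?case
    using j D by (intro runs_intros) (simp add: row_tableD[OF tab(1)] mis_exchange_def row_fun_upd)
qed (use dim_le in \<open>simp_all add: row_tableD[OF tab(1)]\<close>)

definition candidate :: "nat \<Rightarrow> nat set set \<Rightarrow> nat \<Rightarrow> nat \<Rightarrow> nat set \<Rightarrow> state \<Rightarrow> bool" where
  "candidate m E j D M s \<longleftrightarrow> row_table n m s \<and> n \<le> m \<and> adjacency n E s \<and> nmem s aJ 0 = j \<and> j < n \<and>
     nmem s aCNT' 0 = D \<and> D \<le> m \<and> row n (nmem s aNEW) D = M \<and> M \<subseteq> {..j}"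

lemma candidate_frame:
  assumes "candidate m E j D M s" "agree_outside N R s t" "N \<inter> {aN, aH, aROW, aJ, aCNT', aNEW} = {}"
  shows "candidate m E j D M t"
proof -
  have "nmem t a = nmem s a" if "a \<in> {aN, aH, aROW, aJ, aCNT', aNEW}" for a
    using agree_outsideD(1)[OF assms(2), of a] assms(3) that by blast
  thus ?thesis
    using assms(1) by (simp add: candidate_def row_table_def adjacency_def)
qed

lemma runs_find_neighbour:
  assumes s: "candidate m E j D M s" and v: "nmem s aV 0 = v" "v \<le> j"
  shows "runs find_neighbour s (\<lambda>t. nmem t aHIT 0 \<noteq> 0 \<longleftrightarrow> (\<exists>u\<in>M. {u, v} \<in> E))"
  unfolding find_neighbour_def
proof (rule runs_conseq[OF runs_Search[where m = "j + 1" and P = "\<lambda>u. u \<in> M \<and> {u, v} \<in> E"]],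
    goal_cases bound le disjoint counter result distinct step final)
  case (step u t)
  note [simp] = agree_outsideD[OF step(3), simplified]
  have tab: "row_table n m s" and adj: "adjacency n E s" and M: "row n (nmem s aNEW) D = M"
    using s by (simp_all add: candidate_def)
  have "u < n" "v < n" "u \<le> m"
    using step(1) s v by (auto simp: candidate_def)
  thus ?case
    using step(2) s v mem_row_iff[of u n "nmem s aNEW" D] adjacencyD[OF adj, of u v]
    by (intro runs_intros) (simp add: row_tableD[OF tab] candidate_def M)
next
  case (final t)
  thus ?case
    using search_result_eq_0_iff[OF final(2)] s by (auto simp: candidate_def less_Suc_eq_le)
qed (use s dim_le in \<open>auto simp: candidate_def\<close>)

lemma runs_find_conflict:
  assumes s: "candidate m E j D M s"
  shows "runs find_conflict s (\<lambda>t. nmem t aCONFLICT 0 = 0 \<longleftrightarrow> M \<in> mis E {..j})"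
  unfolding find_conflict_def
proof (rule runs_conseq[OF runs_Search[where m = "j + 1" and
      P = "\<lambda>v. v \<in> M \<longleftrightarrow> \<not> (\<forall>u\<in>M. {u, v} \<notin> E)"]],
    goal_cases bound le disjoint counter result distinct step final)
  case (step v t)
  have t: "candidate m E j D M t"
    by (rule candidate_frame[OF s step(3)]) (simp add: program)
  have "v \<le> j"
    using step(1) by simp
  from runs_find_neighbour[OF t step(2) this] show ?case
  proof (rule runs_conseq)
    fix t' assume t': "reaches find_neighbour t t'" "nmem t' aHIT 0 \<noteq> 0 \<longleftrightarrow> (\<exists>u\<in>M. {u, v} \<in> E)"
    note [simp] = reaches_frame[OF t'(1), simplified program]
    have tab: "row_table n m t" and M: "row n (nmem t aNEW) D = M"
      using t by (simp_all add: candidate_def)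
    show "bval (Nonzero (aNEW\<langle>Var aCNT', Var aV\<rangle>) \<^bold>\<longleftrightarrow> Nonzero (Var aHIT)) t' \<longleftrightarrow>
        (v \<in> M \<longleftrightarrow> \<not> (\<forall>u\<in>M. {u, v} \<notin> E))"
      using t t'(2) step(1,2) mem_row_iff[of v n "nmem t aNEW" D] M
      by (simp add: candidate_def row_tableD[OF tab])
  qed
next
  case (final t)
  thus ?case
    using search_result_eq_0_iff[OF final(2)] s by (auto simp: candidate_def mis_def less_Suc_eq_le)
qed (use s dim_le in \<open>auto simp: candidate_def program\<close>)

lemma runs_find_difference:
  assumes s: "candidate m E j D M s" and r: "nmem s aU 0 = r" "r \<le> m"
  shows "runs find_difference s (\<lambda>t. nmem t aDIFF 0 = 0 \<longleftrightarrow> row n (nmem s aNEW) r = M)"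
  unfolding find_difference_def
proof (rule runs_conseq[OF runs_Search[where m = n and
      P = "\<lambda>v. (nmem s aNEW (r * n + v) \<noteq> 0) \<noteq> (nmem s aNEW (D * n + v) \<noteq> 0)"]],
    goal_cases bound le disjoint counter result distinct step final)
  case (step v t)
  note [simp] = agree_outsideD[OF step(3), simplified]
  have tab: "row_table n m s"
    using s by (simp add: candidate_def)
  show ?case
    using step(2) s r by (intro runs_intros) (simp add: row_tableD[OF tab] candidate_def)
next
  case (final t)
  have "row n (nmem s aNEW) D = M"
    using s by (simp add: candidate_def)
  thus ?case
    using search_result_eq_0_iff[OF final(2)] row_eq_iff[of n "nmem s aNEW" r "nmem s aNEW" D]
    by auto
qed (use s dim_le in \<open>auto simp: candidate_def row_table_def\<close>)

lemma runs_find_duplicate: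
  assumes s: "candidate m E j D M s" and D: "D \<le> z"
  shows "runs find_duplicate s (\<lambda>t. nmem t aDUP 0 = 0 \<longleftrightarrow> M \<notin> row n (nmem s aNEW) ` {..<D})"
  unfolding find_duplicate_def
proof (rule runs_conseq[OF runs_Search[OF _ D, where P = "\<lambda>r. row n (nmem s aNEW) r = M"]],
    goal_cases bound disjoint counter result distinct step final)
  case (step r t)
  have "candidate m E j D M t"
    by (rule candidate_frame[OF s step(3)]) (simp add: program)
  moreover have "r \<le> m"
    using step(1) s by (simp add: candidate_def)
  moreover have "nmem t aNEW = nmem s aNEW"
    using agree_outsideD(1)[OF step(3)] by (simp add: program)
  ultimately show ?case
    using runs_find_difference[of m E j D M t r] step(2) by (auto elim: runs_conseq)
next
  case (final t)
  thus ?case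
    using search_result_eq_0_iff[OF final(2)] by auto
qed (use s in \<open>auto simp: candidate_def program\<close>)

lemma runs_keep_candidate:
  assumes s: "candidate m E j D M s" and D: "D \<le> z" and fam: "family n (nmem s aNEW) D S"
  shows "runs keep_candidate s (\<lambda>t.
    family n (nmem t aNEW) (nmem t aCNT' 0) (S \<union> ({M} \<inter> mis E {..j})))"
proof -
  obtain s1 where s1: "reaches find_conflict s s1" "nmem s1 aCONFLICT 0 = 0 \<longleftrightarrow> M \<in> mis E {..j}"
    using runs_find_conflict[OF s] by (rule runsE)
  note [simp] = reaches_frame[OF s1(1), simplified program]
  have "candidate m E j D M s1"
    by (rule candidate_frame[OF s reaches_agree_outside[OF s1(1)]]) (simp add: program)
  from runs_find_duplicate[OF this D] obtain s2 where s2: "reaches find_duplicate s1 s2"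
    "nmem s2 aDUP 0 = 0 \<longleftrightarrow> M \<notin> row n (nmem s1 aNEW) ` {..<D}"
    by (rule runsE)
  note [simp] = reaches_frame[OF s2(1), simplified program]
  have rows: "row n (nmem s aNEW) D = M" "nmem s aCNT' 0 = D" "row n (nmem s aNEW) ` {..<D} = S"
    using s fam by (simp_all add: candidate_def family_def)
  have "S \<union> ({M} \<inter> mis E {..j}) = (if M \<in> mis E {..j} \<and> M \<notin> S then insert M S else S)"
    by auto
  thus ?thesis
    unfolding keep_candidate_def using s1(2) s2(2) rows fam family_Suc[OF fam]
    by (intro runs_reaches_Seq[OF s1(1)] runs_reaches_Seq[OF s2(1)] runs_intros) auto
qed

definition extending :: "nat \<Rightarrow> nat set set \<Rightarrow> nat \<Rightarrow> nat set set \<Rightarrow> state \<Rightarrow> bool" where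
  "extending m E j S s \<longleftrightarrow> row_table n m s \<and> n \<le> m \<and> m \<le> z \<and> adjacency n E s \<and>
     nmem s aJ 0 = j \<and> j < n \<and> card (mis E {..j}) \<le> m \<and>
     family n (nmem s aNEW) (nmem s aCNT' 0) S \<and> S \<subseteq> mis E {..j}"

lemma extending_count_le: "extending m E j S s \<Longrightarrow> nmem s aCNT' 0 \<le> m"
  using card_mono[of "mis E {..j}" S] card_family[of n "nmem s aNEW" "nmem s aCNT' 0" S]
  by (auto simp: extending_def finite_mis)

lemma extending_nupdate: "extending m E j S s \<Longrightarrow> extending m E j S (nupdate aI 0 i s)"
  by (simp add: extending_def row_table_def adjacency_def)

lemma runs_keep_new_row:
  assumes s: "extending m E j S s" and M: "M \<subseteq> {..j}" and writes: "nwrites c \<subseteq> {aV, aNEW}"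
    and c: "runs c s (\<lambda>t. row n (nmem t aNEW) (nmem s aCNT' 0) = M \<and>
      (\<forall>k. k \<noteq> nmem s aCNT' 0 \<longrightarrow> row n (nmem t aNEW) k = row n (nmem s aNEW) k))"
  shows "runs (c ;; keep_candidate) s (extending m E j (S \<union> ({M} \<inter> mis E {..j})))"
proof -
  let ?D = "nmem s aCNT' 0"
  obtain s1 where s1: "reaches c s s1" "row n (nmem s1 aNEW) ?D = M"
    "\<And>k. k \<noteq> ?D \<Longrightarrow> row n (nmem s1 aNEW) k = row n (nmem s aNEW) k"
    using c by (auto elim: runsE)
  have frame: "nmem s1 a = nmem s a" if "a \<notin> {aV, aNEW}" for a
    using reaches_frame(1)[OF s1(1)] writes that by blast
  have cand: "candidate m E j ?D M s1"
    using s s1(2) M extending_count_le[OF s]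
    by (simp add: extending_def candidate_def row_table_def adjacency_def frame)
  have "family n (nmem s1 aNEW) ?D S"
    using s family_cong[of ?D n "nmem s1 aNEW" "nmem s aNEW" S] s1(3) by (simp add: extending_def)
  moreover have "?D \<le> z"
    using extending_count_le[OF s] s by (simp add: extending_def)
  ultimately obtain s2 where s2: "reaches keep_candidate s1 s2"
    "family n (nmem s2 aNEW) (nmem s2 aCNT' 0) (S \<union> ({M} \<inter> mis E {..j}))"
    using runs_keep_candidate[OF cand] by (auto elim: runsE)
  note [simp] = reaches_frame[OF s2(1), simplified program]
  have "extending m E j (S \<union> ({M} \<inter> mis E {..j})) s2"
    using s s2(2) by (simp add: extending_def row_table_def adjacency_def frame)
  thus ?thesis
    by (intro runs_reaches_Seq[OF s1(1)] runsI[OF s2(1)])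
qed

lemma runs_extend_member:
  assumes s: "extending m E j S s" and i: "nmem s aI 0 = i" "i \<le> m" and no_loop: "\<And>v. {v} \<notin> E"
    and M: "row n (nmem s aFAM) i = M" "M \<subseteq> {..j}"
  shows "runs extend_member s (extending m E j (S \<union> ({M, mis_exchange E j M} \<inter> mis E {..j})))"
proof -
  let ?T = "mis E {..j}" and ?M' = "mis_exchange E j M"
  have "runs copy_member s (\<lambda>t. row n (nmem t aNEW) (nmem s aCNT' 0) = M \<and>
      (\<forall>k. k \<noteq> nmem s aCNT' 0 \<longrightarrow> row n (nmem t aNEW) k = row n (nmem s aNEW) k))"
    using runs_copy_member[of m s i "nmem s aCNT' 0"] s i M(1) extending_count_le[OF s]
    by (simp add: extending_def)
  from runs_keep_new_row[OF s M(2) _ this] obtain s1 where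
    s1: "reaches (copy_member ;; keep_candidate) s s1" "extending m E j (S \<union> ({M} \<inter> ?T)) s1"
    by (auto simp: program elim: runsE)
  note [simp] = reaches_frame[OF s1(1), simplified program]
  have "runs exchange_member s1 (\<lambda>t. row n (nmem t aNEW) (nmem s1 aCNT' 0) = ?M' \<and>
      (\<forall>k. k \<noteq> nmem s1 aCNT' 0 \<longrightarrow> row n (nmem t aNEW) k = row n (nmem s1 aNEW) k))"
    using runs_exchange_member[of m s1 E j i "nmem s1 aCNT' 0"] s1(2) i M(1)
      extending_count_le[OF s1(2)] no_loop
    by (simp add: extending_def)
  moreover have "?M' \<subseteq> {..j}"
    using M(2) by (auto simp: mis_exchange_def nonneighbours_def)
  ultimately have "runs (exchange_member ;; keep_candidate) s1
      (extending m E j (S \<union> ({M} \<inter> ?T) \<union> ({?M'} \<inter> ?T)))"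
    by (intro runs_keep_new_row[OF s1(2)]) (simp_all add: program)
  moreover have "S \<union> ({M} \<inter> ?T) \<union> ({?M'} \<inter> ?T) = S \<union> ({M, ?M'} \<inter> ?T)"
    by auto
  ultimately show ?thesis
    unfolding extend_member_def by (intro runs_reaches_Seq[OF s1(1)]) simp
qed

lemma runs_extend_family:
  assumes s: "extending m E j {} s" and C: "nmem s aCNT 0 = C" "C \<le> m"
    and fam: "family n (nmem s aFAM) C (mis E {..<j})" and no_loop: "\<And>v. {v} \<notin> E"
  shows "runs extend_family s (extending m E j (mis E {..j}))"
proof -
  let ?R = "row n (nmem s aFAM)" and ?T = "mis E {..j}"
  let ?S = "\<lambda>i. (?R ` {..<i} \<union> mis_exchange E j ` ?R ` {..<i}) \<inter> ?T"
  have "runs (FOR aI < Var aCNT DO extend_member) s (extending m E j (?S C))"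
  proof (rule runs_For[where Inv = "\<lambda>i. extending m E j (?S i)"],
      goal_cases bound le disjoint counter init step)
    case init
    show ?case
      using s by (simp add: extending_nupdate)
  next
    case (step i t)
    note [simp] = agree_outsideD[OF step(4), simplified program]
    have "?R i \<subseteq> {..j}"
      using fam step(1) mis_subset[of "?R i" E "{..<j}"] by (force simp: family_def)
    hence "runs extend_member t (extending m E j (?S i \<union> ({?R i, mis_exchange E j (?R i)} \<inter> ?T)))"
      using step(1-3) C no_loop by (intro runs_extend_member) simp_all
    moreover have "?S i \<union> ({?R i, mis_exchange E j (?R i)} \<inter> ?T) = ?S (Suc i)"
      by (auto simp: lessThan_Suc)
    ultimately show ?case
      by (auto simp: extending_nupdate elim: runs_conseq)
  qed (use s C in \<open>auto simp: extending_def program\<close>)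
  moreover have "?S C = ?T"
  proof -
    have "insert j {..<j} = {..j}"
      by auto
    hence "?T \<subseteq> mis E {..<j} \<union> mis_exchange E j ` mis E {..<j}"
      using mis_insert_subset[of "{..<j}" E j] no_loop by simp
    thus ?thesis
      using fam by (simp add: family_def Int_absorb1)
  qed
  ultimately show ?thesis
    by (simp add: extend_family_def)
qed

lemma runs_copy_family:
  assumes tab: "row_table n m s" and D: "nmem s aCNT' 0 = D" "D \<le> m" "D * n \<le> z"
    and fam: "family n (nmem s aNEW) D S"
  shows "runs copy_family s (\<lambda>t. family n (nmem t aFAM) (nmem t aCNT 0) S)"
  unfolding copy_family_def
proof (rule runs_Seq, rule runs_conseq[OF runs_tabulate[where m = "D * n" and
      get = "\<lambda>t. nmem t aFAM" and k = 0 and F = "nmem s aNEW"]],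
      goal_cases bound le disjoint counter get step final)
  case (step i t)
  note [simp] = agree_outsideD[OF step(3), simplified]
  show ?case
    using step(2) by (intro runs_intros) simp
next
  case (final t)
  note [simp] = reaches_frame[OF final(1), simplified]
  have "row n (nmem t aFAM) i = row n (nmem s aNEW) i" if "i < D" for i
    using matrix_index_less[OF that] by (auto simp: final(2) row_def overwrite_def)
  thus ?case
    using fam D(1) family_cong[of D n "nmem t aFAM" "nmem s aNEW" S] by (intro runs_intros) simp
qed (use D in \<open>simp_all add: row_tableD[OF tab]\<close>)

lemma runs_mis_stage:
  assumes n: "nmem s aN 0 = n" and adj: "adjacency n E s" and no_loop: "\<And>v. {v} \<notin> E"
    and j: "nmem s aJ 0 = j" "j < n" and C: "nmem s aCNT 0 = C" "n + 2 * C \<le> z"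
    and fam: "family n (nmem s aFAM) C (mis E {..<j})" and D: "card (mis E {..j}) * n \<le> z"
  shows "runs mis_stage s (\<lambda>t. family n (nmem t aFAM) (nmem t aCNT 0) (mis E {..j}))"
proof -
  let ?m = "n + (C + C)"
  obtain s1 where s1: "reaches fill_rows s s1" "row_table n ?m s1"
    using runs_fill_rows[OF n C(1)] C(2) by (auto elim: runsE)
  note [simp] = reaches_frame[OF s1(1), simplified program]
  define s2 where "s2 = nupdate aCNT' 0 0 s1"
  have s2: "reaches (aCNT' ::= NConst 0) s1 s2"
    using reaches_NStore[of aCNT' "NConst 0" "NConst 0" s1] by (simp add: s2_def)
  have "insert j {..<j} = {..j}"
    by auto
  hence "card (mis E {..j}) \<le> 2 * C"
    using card_mis_insert_le_double[of "{..<j}" E j] no_loop card_family[OF fam] by simp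
  hence "extending ?m E j {} s2"
    using s1(2) adj j C(2)
    by (simp add: s2_def extending_def row_table_def adjacency_def family_def)
  from runs_extend_family[OF this, of C] obtain s3 where
    s3: "reaches extend_family s2 s3" "extending ?m E j (mis E {..j}) s3"
    using C(1) fam no_loop by (auto simp: s2_def elim: runsE)
  have "runs copy_family s3 (\<lambda>t. family n (nmem t aFAM) (nmem t aCNT 0) (mis E {..j}))"
    using s3(2) extending_count_le[OF s3(2)] D card_family[of n "nmem s3 aNEW" "nmem s3 aCNT' 0"]
    by (intro runs_copy_family) (auto simp: extending_def)
  thus ?thesis
    unfolding mis_stage_def
    by (intro runs_reaches_Seq[OF s1(1)] runs_reaches_Seq[OF s2] runs_reaches_Seq[OF s3(1)])
qed

theorem runs_enum_mis:
  assumes n: "nmem s aN 0 = n" and init: "nmem s aFAM = (\<lambda>_. 0)" and adj: "adjacency n E s"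
    and no_loop: "\<And>v. {v} \<notin> E"
    and count: "\<And>j. j \<le> n \<Longrightarrow> card (mis E {..<j}) \<le> B" and bound: "(n + 2) * (2 * B + 2) \<le> z"
  shows "runs enum_mis s (\<lambda>t. family n (nmem t aFAM) (nmem t aCNT 0) (mis E {..<n}))"
  unfolding enum_mis_def
proof (rule runs_Seq, rule runs_NStore, rule runs_For[where
      Inv = "\<lambda>j t. family n (nmem t aFAM) (nmem t aCNT 0) (mis E {..<j})"],
    goal_cases bound le disjoint counter init step)
  case (step j t)
  note [simp] = agree_outsideD[OF step(4), simplified program]
  have count_t: "nmem t aCNT 0 \<le> B" "card (mis E {..j}) \<le> B"
    using count[of j] count[of "Suc j"] step(1) card_family[OF step(2)]
    by (simp_all add: lessThan_Suc_atMost)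
  have "card (mis E {..j}) * n \<le> B * n"
    using count_t(2) by (rule mult_le_mono1)
  also have "\<dots> \<le> (n + 2) * (2 * B + 2)"
    by (simp add: algebra_simps)
  also note bound
  finally have "runs mis_stage t (\<lambda>t. family n (nmem t aFAM) (nmem t aCNT 0) (mis E {..j}))"
    using step n adj no_loop bound count_t(1)
    by (intro runs_mis_stage) (auto simp: adjacency_def algebra_simps)
  thus ?case
    by (rule runs_conseq) (simp add: lessThan_Suc_atMost)
qed (use n init dim_le in \<open>auto simp: program family_def row_def mis_empty lessThan_Suc\<close>)

end

section \<open>Computing the best move\<close>

text \<open>
  Arrays \<open>aF\<close>, \<open>aL\<close> and \<open>aBEST\<close> hold the current labelling, a candidate and the best candidate so
  far; \<open>aA\<close> is the new label of the move, \<open>aD\<close>, \<open>rRES\<close> and \<open>rEX\<close> represent a preflow.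
\<close>

abbreviation (input) "aF \<equiv> (20 :: nat)"
abbreviation (input) "aBEST \<equiv> (21 :: nat)"
abbreviation (input) "aL \<equiv> (22 :: nat)"
abbreviation (input) "aD \<equiv> (23 :: nat)"
abbreviation (input) "aA \<equiv> (24 :: nat)"
abbreviation (input) "aACT \<equiv> (25 :: nat)"
abbreviation (input) "aADM \<equiv> (26 :: nat)"
abbreviation (input) "aP \<equiv> (27 :: nat)"
abbreviation (input) "aQ \<equiv> (28 :: nat)"
abbreviation (input) "aLEV \<equiv> (29 :: nat)"
abbreviation (input) "aOCC \<equiv> (30 :: nat)"
abbreviation (input) "aGAP \<equiv> (31 :: nat)"
abbreviation (input) "push_counters \<equiv> [32, 33, 34, 35 :: nat]"
abbreviation (input) "rW \<equiv> (0 :: nat)"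
abbreviation (input) "rRES \<equiv> (1 :: nat)"
abbreviation (input) "rEX \<equiv> (2 :: nat)"
abbreviation (input) "rDEL \<equiv> (3 :: nat)"
abbreviation (input) "rSUM \<equiv> (4 :: nat)"

abbreviation RMCell :: "nat \<Rightarrow> nexp \<Rightarrow> nexp \<Rightarrow> rexp" ("_\<langle>_, _\<rangle>\<^sub>r" [1000, 0, 0] 900) where
  "a\<langle>i, j\<rangle>\<^sub>r \<equiv> a\<langle>aROW\<langle>i\<rangle> \<oplus> j\<rangle>\<^sub>r"

abbreviation RMStore :: "nat \<Rightarrow> nexp \<Rightarrow> nexp \<Rightarrow> rexp \<Rightarrow> com"
  ("_\<langle>_, _\<rangle>\<^sub>r ::= _" [1000, 0, 0, 65] 62) where
  "a\<langle>i, j\<rangle>\<^sub>r ::= x \<equiv> a\<langle>aROW\<langle>i\<rangle> \<oplus> j\<rangle>\<^sub>r ::= x"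

definition sum_separation :: "nat \<Rightarrow> com" where [program]:
  "sum_separation a = (rSUM ::=\<^sub>r ROfNat (NConst 0) ;;
     FOR aV < Var aN DO
       IF a\<langle>Var aU\<rangle> \<^bold>= a\<langle>Var aV\<rangle> THEN Skip ELSE rSUM ::=\<^sub>r RVar rSUM \<oplus>\<^sub>r rW\<langle>Var aU, Var aV\<rangle>\<^sub>r)"

definition init_heights :: com where [program]:
  "init_heights = (FOR aU < Var aN DO aD\<langle>Var aU\<rangle> ::= NConst 0)"

definition init_excess :: com where [program]:
  "init_excess = (FOR aU < Var aN DO (sum_separation aF ;; rEX\<langle>Var aU\<rangle>\<^sub>r ::= RVar rSUM))"

definition init_residual :: com where [program]:
  "init_residual = (FOR aU < Var aN DO FOR aV < Var aN DO
     IF aF\<langle>Var aU\<rangle> \<^bold>= aF\<langle>Var aV\<rangle>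
     THEN rRES\<langle>Var aU, Var aV\<rangle>\<^sub>r ::= rW\<langle>Var aU, Var aV\<rangle>\<^sub>r \<oplus>\<^sub>r rW\<langle>Var aU, Var aV\<rangle>\<^sub>r
     ELSE rRES\<langle>Var aU, Var aV\<rangle>\<^sub>r ::= rW\<langle>Var aU, Var aV\<rangle>\<^sub>r)"

definition init_preflow :: com where [program]:
  "init_preflow = (init_heights ;; init_excess ;; init_residual)"

definition find_active :: com where [program]:
  "find_active = Search aACT aU (Var aN) Skip
     (ROfNat (NConst 0) \<^bold><\<^sub>r rEX\<langle>Var aU\<rangle>\<^sub>r \<^bold>\<and> aD\<langle>Var aU\<rangle> \<^bold>< Var aN \<^bold>\<and> Nonzero (aFAM\<langle>Var aA, Var aU\<rangle>))"

definition find_admissible :: com where [program]: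
  "find_admissible = Search aADM aV (Var aN) Skip
     (ROfNat (NConst 0) \<^bold><\<^sub>r rRES\<langle>Var aP, Var aV\<rangle>\<^sub>r \<^bold>\<and> aD\<langle>Var aP\<rangle> \<^bold>= aD\<langle>Var aV\<rangle> \<oplus> NConst 1)"

definition push :: com where [program]:
  "push = (
     (IF rEX\<langle>Var aP\<rangle>\<^sub>r \<^bold><\<^sub>r rRES\<langle>Var aP, Var aQ\<rangle>\<^sub>r
      THEN rDEL ::=\<^sub>r rEX\<langle>Var aP\<rangle>\<^sub>r ELSE rDEL ::=\<^sub>r rRES\<langle>Var aP, Var aQ\<rangle>\<^sub>r) ;;
     rRES\<langle>Var aP, Var aQ\<rangle>\<^sub>r ::= rRES\<langle>Var aP, Var aQ\<rangle>\<^sub>r \<ominus>\<^sub>r RVar rDEL ;;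
     rRES\<langle>Var aQ, Var aP\<rangle>\<^sub>r ::= rRES\<langle>Var aQ, Var aP\<rangle>\<^sub>r \<oplus>\<^sub>r RVar rDEL ;;
     rEX\<langle>Var aP\<rangle>\<^sub>r ::= rEX\<langle>Var aP\<rangle>\<^sub>r \<ominus>\<^sub>r RVar rDEL ;;
     rEX\<langle>Var aQ\<rangle>\<^sub>r ::= rEX\<langle>Var aQ\<rangle>\<^sub>r \<oplus>\<^sub>r RVar rDEL)"

definition relabel :: com where [program]:
  "relabel = aD\<langle>Var aP\<rangle> ::= aD\<langle>Var aP\<rangle> \<oplus> NConst 1"

definition push_or_relabel :: com where [program]:
  "push_or_relabel = (aP ::= Var aACT \<ominus> NConst 1 ;; find_admissible ;;
     IF Nonzero (Var aADM) THEN (aQ ::= Var aADM \<ominus> NConst 1 ;; push) ELSE relabel)"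

definition preflow_step :: com where [program]:
  "preflow_step = (find_active ;; IF Nonzero (Var aACT) THEN push_or_relabel ELSE Skip)"

definition find_level :: com where [program]:
  "find_level = Search aOCC aV (Var aN) Skip (aD\<langle>Var aV\<rangle> \<^bold>= Var aLEV)"

definition find_gap :: com where [program]:
  "find_gap = Search aGAP aLEV (Var aN \<oplus> NConst 1) find_level (\<^bold>\<not> Nonzero (Var aOCC))"

definition apply_move :: com where [program]:
  "apply_move = (FOR aV < Var aN DO
     IF Var aGAP \<^bold>< aD\<langle>Var aV\<rangle> \<oplus> NConst 1 THEN aL\<langle>Var aV\<rangle> ::= Var aA ELSE aL\<langle>Var aV\<rangle> ::= aF\<langle>Var aV\<rangle>)"

definition best_move :: com where [program]:
  "best_move = (init_preflow ;; Repeat push_counters (Var aN \<oplus> NConst 2) preflow_step ;;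
     find_gap ;; apply_move)"

definition weights :: "nat \<Rightarrow> (nat \<Rightarrow> nat \<Rightarrow> real) \<Rightarrow> state \<Rightarrow> bool" where
  "weights n W s \<longleftrightarrow> (\<forall>u<n. \<forall>v<n. rmem s rW (u * n + v) = W u v)"

definition residual :: "nat \<Rightarrow> state \<Rightarrow> nat \<Rightarrow> nat \<Rightarrow> real" where
  "residual n s u v = (if u < n \<and> v < n then rmem s rRES (u * n + v) else 0)"

lemma weightsD: "weights n W s \<Longrightarrow> u < n \<Longrightarrow> v < n \<Longrightarrow> rmem s rW (u * n + v) = W u v"
  by (simp add: weights_def)

lemma residual_cong: "rmem t rRES = rmem s rRES \<Longrightarrow> residual n t = residual n s"
  by (simp add: residual_def fun_eq_iff)

lemma residual_nupdate [simp]: "residual n (nupdate a i x s) = residual n s"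
  by (rule residual_cong) simp

context matrix_ram
begin

abbreviation "active_at S s \<equiv> active {..<n} S (rmem s rEX) (nmem s aD)"
abbreviation "admissible_at s \<equiv> admissible {..<n} (residual n s) (nmem s aD)"
abbreviation "potential_at s \<equiv> potential {..<n} (residual n s) (rmem s rEX) (nmem s aD)"
abbreviation "preflow_at S b c s \<equiv> preflow {..<n} S b c (residual n s) (rmem s rEX) (nmem s aD)"
abbreviation "push_relabel_at S s t \<equiv> push_relabel {..<n} S (residual n s) (rmem s rEX) (nmem s aD)
  (residual n t) (rmem t rEX) (nmem t aD)"

lemma runs_sum_separation:
  assumes tab: "row_table n m s" and W: "weights n W s" and u: "nmem s aU 0 = u" "u < n" "u \<le> m"
    and a: "a \<noteq> aV"
  shows "runs (sum_separation a) s (\<lambda>t. rmem t rSUM 0 = separation {..<n} W (nmem s a) u)"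
  unfolding sum_separation_def
proof (rule runs_Seq, rule runs_RStore, rule runs_conseq[OF runs_For_sum[where m = n and
      r = rSUM and g = "\<lambda>v. if nmem s a u = nmem s a v then 0 else W u v"]],
    goal_cases bound le disjoint counter step final)
  case (step v t)
  note [simp] = agree_outsideD[OF step(3), simplified]
  show ?case
    using step(1,2) u a weightsD[OF W u(2) step(1)]
    by (intro runs_intros) (simp_all add: row_tableD[OF tab])
qed (use dim_le in \<open>simp_all add: row_tableD[OF tab] separation_def\<close>)

lemma runs_init_heights:
  assumes "nmem s aN 0 = n"
  shows "runs init_heights s (\<lambda>t. \<forall>v<n. nmem t aD v = 0)"
  unfolding init_heights_def
proof (rule runs_conseq[OF runs_tabulate[where m = n and get = "\<lambda>t. nmem t aD" and k = 0 and
      F = "\<lambda>_. 0"]],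
    goal_cases bound le disjoint counter get step final)
  case (step v t)
  thus ?case
    by (intro runs_intros) simp
qed (use assms dim_le in \<open>auto simp: overwrite_def\<close>)

lemma runs_init_excess:
  assumes tab: "row_table n m s" "n \<le> m" and W: "weights n W s"
  shows "runs init_excess s (\<lambda>t. \<forall>v<n. rmem t rEX v = separation {..<n} W (nmem s aF) v)"
  unfolding init_excess_def
proof (rule runs_conseq[OF runs_tabulate[where m = n and get = "\<lambda>t. rmem t rEX" and k = 0 and
      F = "separation {..<n} W (nmem s aF)"]], goal_cases bound le disjoint counter get step final)
  case (step u t)
  note [simp] = agree_outsideD[OF step(3), simplified program]
  have "runs (sum_separation aF) t (\<lambda>t'. rmem t' rSUM 0 = separation {..<n} W (nmem t aF) u)"
    using tab W step(1,2)
    by (intro runs_sum_separation[where m = m]) (auto simp: row_table_def weights_def)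
  then obtain t' where t': "reaches (sum_separation aF) t t'"
    "rmem t' rSUM 0 = separation {..<n} W (nmem s aF) u"
    by (auto elim: runsE)
  note [simp] = reaches_frame[OF t'(1), simplified program]
  show ?case
    using step(2) t'(2) by (intro runs_reaches_Seq[OF t'(1)] runs_intros) simp
qed (use dim_le in \<open>auto simp: row_tableD[OF tab(1)] overwrite_def program\<close>)

lemma runs_init_residual:
  assumes tab: "row_table n m s" "n \<le> m" and W: "weights n W s"
  shows "runs init_residual s (\<lambda>t. \<forall>u<n. \<forall>v<n. residual n t u v = move_capacity W (nmem s aF) u v)"
  unfolding init_residual_def
proof (rule runs_conseq[OF runs_tabulate_matrix[where n = n and get = "\<lambda>t. rmem t rRES" and
      F = "move_capacity W (nmem s aF)"]],
    goal_cases bound le disjoint outer inner distinct get get' step final)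
  case (step u v t)
  note [simp] = agree_outsideD[OF step(5), simplified]
  have "u \<le> m"
    using step(1) tab(2) by simp
  thus ?case
    using step(3,4) weightsD[OF W step(1,2)]
    by (intro runs_intros) (simp_all add: row_tableD[OF tab(1)] move_capacity_def)
qed (use dim_le in \<open>auto simp: row_tableD[OF tab(1)] residual_def\<close>)

lemma runs_find_active:
  assumes tab: "row_table n m s" and a: "nmem s aA 0 = a" "a \<le> m"
  shows "runs find_active s (\<lambda>t.
    search_result (active_at (row n (nmem s aFAM) a) s) n (nmem t aACT 0))"
  unfolding find_active_def
proof (rule runs_Search, goal_cases bound le disjoint counter result distinct step)
  case (step u t)
  note [simp] = agree_outsideD[OF step(3), simplified]
  show ?case
    using step(1,2) a mem_row_iff[OF step(1), of "nmem s aFAM" a]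
    by (intro runs_intros) (auto simp: row_tableD[OF tab] active_def)
qed (use dim_le in \<open>auto simp: row_tableD[OF tab]\<close>)

lemma runs_find_admissible:
  assumes tab: "row_table n m s" and u: "nmem s aP 0 = u" "u < n" "u \<le> m"
  shows "runs find_admissible s (\<lambda>t. search_result (admissible_at s u) n (nmem t aADM 0))"
  unfolding find_admissible_def
proof (rule runs_Search, goal_cases bound le disjoint counter result distinct step)
  case (step v t)
  note [simp] = agree_outsideD[OF step(3), simplified]
  show ?case
    using step(1,2) u
    by (intro runs_intros) (auto simp: row_tableD[OF tab] admissible_def residual_def)
qed (use dim_le in \<open>auto simp: row_tableD[OF tab]\<close>)

lemma runs_push:
  assumes tab: "row_table n m s" "n \<le> m" and u: "nmem s aP 0 = u" "u < n"
    and v: "nmem s aQ 0 = v" "v < n" and uv: "u \<noteq> v"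
    and x: "x = min (rmem s rEX u) (residual n s u v)"
  shows "runs push s (\<lambda>t. residual n t = push_residual u v x (residual n s) \<and>
    rmem t rEX = push_excess u v x (rmem s rEX))"
  unfolding push_def using u v uv x tab(2)
  by (intro runs_intros)
    (auto simp: row_tableD[OF tab(1)] push_excess_def push_residual_def residual_def
      matrix_index_eq_iff min_def fun_upd_twist fun_eq_iff)

lemma runs_push_step:
  assumes tab: "row_table n m s" "n \<le> m" and u: "nmem s aP 0 = u" "active_at S s u"
    and v: "nmem s aADM 0 = Suc v" "admissible_at s u v"
  shows "runs (aQ ::= Var aADM \<ominus> NConst 1 ;; push) s (push_relabel_at S s)"
proof -
  let ?s = "nupdate aQ 0 v s" and ?x = "min (rmem s rEX u) (residual n s u v)"
  have uv: "u < n" "v < n" "u \<noteq> v"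
    using v(2) by (auto simp: admissible_def)
  have "runs push ?s (\<lambda>t. residual n t = push_residual u v ?x (residual n s) \<and>
      rmem t rEX = push_excess u v ?x (rmem s rEX))"
    using runs_push[of m ?s u v ?x] tab u(1) uv by (simp add: row_table_def)
  hence "runs push ?s (push_relabel_at S s)"
  proof (rule runs_conseq)
    fix t assume t: "reaches push ?s t" "residual n t = push_residual u v ?x (residual n s) \<and>
      rmem t rEX = push_excess u v ?x (rmem s rEX)"
    have "nmem t aD = nmem s aD"
      using reaches_frame(1)[OF t(1), of aD] by (simp add: program)
    thus "push_relabel_at S s t"
      using push_relabel.push[OF u(2) v(2) refl] t(2) by simp
  qed
  thus ?thesis
    using v(1) by (intro runs_Seq runs_NStore) simp
qed

lemma runs_relabel:
  assumes "nmem s aP 0 = u" "active_at S s u" "\<And>v. \<not> admissible_at s u v"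
  shows "runs relabel s (push_relabel_at S s)"
  unfolding relabel_def using push_relabel.relabel[OF assms(2,3)] assms(1)
  by (intro runs_NStore) simp

lemma runs_push_or_relabel:
  assumes tab: "row_table n m s" "n \<le> m" and u: "nmem s aACT 0 = Suc u" "active_at S s u"
  shows "runs push_or_relabel s (push_relabel_at S s)"
proof -
  have "u < n" "u \<le> m"
    using u(2) tab(2) by (auto simp: active_def)
  define s1 where "s1 = nupdate aP 0 u s"
  have s1: "reaches (aP ::= Var aACT \<ominus> NConst 1) s s1"
    using reaches_NStore[of aP "NConst 0" "Var aACT \<ominus> NConst 1" s] u(1) by (simp add: s1_def)
  obtain s2 where s2: "reaches find_admissible s1 s2"
      "search_result (admissible_at s u) n (nmem s2 aADM 0)"
    using runs_find_admissible[of m s1 u] tab \<open>u < n\<close> \<open>u \<le> m\<close>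
    by (auto simp: s1_def row_table_def elim: runsE)
  note [simp] = reaches_frame[OF s2(1), simplified program]
  have same: "residual n s2 = residual n s" "rmem s2 = rmem s" "nmem s2 aD = nmem s aD"
    using residual_cong[of s2 s n] by (simp_all add: s1_def fun_eq_iff)
  have "runs (IF Nonzero (Var aADM) THEN (aQ ::= Var aADM \<ominus> NConst 1 ;; push) ELSE relabel) s2
      (push_relabel_at S s2)"
  proof (rule runs_Cond)
    assume "bval (Nonzero (Var aADM)) s2"
    then obtain v where "nmem s2 aADM 0 = Suc v" "admissible_at s u v"
      using search_result_witness[OF s2(2)] by (auto simp: gr0_conv_Suc)
    thus "runs (aQ ::= Var aADM \<ominus> NConst 1 ;; push) s2 (push_relabel_at S s2)"
      using tab u(2)
      by (intro runs_push_step[where m = m]) (simp_all add: s1_def same row_table_def)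
  next
    assume "\<not> bval (Nonzero (Var aADM)) s2"
    hence "\<not> admissible_at s u v" for v
      using search_result_eq_0_iff[OF s2(2)] by (auto simp: admissible_def)
    thus "runs relabel s2 (push_relabel_at S s2)"
      using u(2) by (intro runs_relabel) (simp_all add: s1_def same)
  qed
  thus ?thesis
    unfolding push_or_relabel_def same
    by (intro runs_reaches_Seq[OF s1] runs_reaches_Seq[OF s2(1)])
qed

text \<open>An inactive state is reached within \<open>(n + 2) ^ 4\<close> steps, of which \<open>k\<close> have been made.\<close>

definition discharging ::
  "nat set \<Rightarrow> (nat \<Rightarrow> real) \<Rightarrow> (nat \<Rightarrow> nat \<Rightarrow> real) \<Rightarrow> nat \<Rightarrow> state \<Rightarrow> bool" where
  "discharging S b c k s \<longleftrightarrow> preflow_at S b c s \<and>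
     (potential_at s + k < (n + 2) ^ 4 \<or> (\<forall>u. \<not> active_at S s u))"

lemma discharging_push_relabel:
  assumes s: "discharging S b c k s" and step: "push_relabel_at S s t"
  shows "discharging S b c (Suc k) t"
proof -
  have flow: "preflow_at S b c s" and "potential_at s + k < (n + 2) ^ 4"
    using s step by (auto simp: discharging_def elim: push_relabel.cases)
  thus ?thesis
    using preflow.push_relabel_preserves_preflow[OF flow step]
      preflow.push_relabel_potential_less[OF flow step] by (simp add: discharging_def)
qed

lemma runs_preflow_step:
  assumes tab: "row_table n m s" "n \<le> m" and a: "nmem s aA 0 = a" "a \<le> m"
    and S: "S = row n (nmem s aFAM) a" and s: "discharging S b c k s"
  shows "runs preflow_step s (discharging S b c (Suc k))"
proof -
  obtain s1 where s1: "reaches find_active s s1" "search_result (active_at S s) n (nmem s1 aACT 0)"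
    using runs_find_active[OF tab(1) a] S by (auto elim: runsE)
  note [simp] = reaches_frame[OF s1(1), simplified program]
  have same: "residual n s1 = residual n s"
    by (rule residual_cong) simp
  have discharging1: "discharging S b c k s1"
    using s by (simp add: discharging_def same)
  show ?thesis
    unfolding preflow_step_def
  proof (intro runs_reaches_Seq[OF s1(1)] runs_Cond)
    assume "bval (Nonzero (Var aACT)) s1"
    then obtain u where "nmem s1 aACT 0 = Suc u" "active_at S s u"
      using search_result_witness[OF s1(2)] by (auto simp: gr0_conv_Suc)
    hence "runs push_or_relabel s1 (push_relabel_at S s1)"
      using tab by (intro runs_push_or_relabel[where m = m]) (simp_all add: row_table_def)
    thus "runs push_or_relabel s1 (discharging S b c (Suc k))"
      by (rule runs_conseq) (rule discharging_push_relabel[OF discharging1])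
  next
    assume "\<not> bval (Nonzero (Var aACT)) s1"
    hence "\<forall>u. \<not> active_at S s u"
      using search_result_eq_0_iff[OF s1(2)] by (auto simp: active_def)
    thus "runs Skip s1 (discharging S b c (Suc k))"
      using s by (intro runs_Skip) (simp add: discharging_def same)
  qed
qed

lemma runs_preflow_steps:
  assumes tab: "row_table n m s" "n \<le> m" and a: "nmem s aA 0 = a" "a \<le> m"
    and S: "S = row n (nmem s aFAM) a"
    and init: "preflow_at S b c s" "\<And>v. v < n \<Longrightarrow> nmem s aD v = 0"
  shows "runs (Repeat push_counters (Var aN \<oplus> NConst 2) preflow_step) s
    (\<lambda>t. preflow_at S b c t \<and> (\<forall>u. \<not> active_at S t u))"
proof (rule runs_conseq[OF runs_Repeat[where m = "n + 2" and Inv = "discharging S b c"]],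
    goal_cases bound le disjoint distinct counters stable init step final)
  case (stable i x k t)
  thus ?case
    by (auto simp: discharging_def)
next
  case init
  show ?case
    using assms(6,7) potential_initial_less[of "{..<n}" "nmem s aD" "residual n s" "rmem s rEX"]
    by (simp add: discharging_def)
next
  case (step i t)
  note [simp] = agree_outsideD[OF step(2), simplified program]
  show ?case
    using tab a S step(1) by (intro runs_preflow_step) (simp_all add: row_table_def)
next
  case (final t)
  have "length push_counters = 4"
    by simp
  with final(2) show ?case
    unfolding discharging_def by (simp only: add_less_same_cancel2 not_less0) simp
qed (use dim_bound in \<open>auto simp: row_tableD[OF tab(1)] program\<close>)

lemma runs_find_level:
  assumes "nmem s aN 0 = n" "nmem s aLEV 0 = h"
  shows "runs find_level s (\<lambda>t. nmem t aOCC 0 \<noteq> 0 \<longleftrightarrow> (\<exists>v<n. nmem s aD v = h))"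
  unfolding find_level_def
proof (rule runs_conseq[OF runs_Search[where m = n and P = "\<lambda>v. nmem s aD v = h"]],
    goal_cases bound le disjoint counter result distinct step final)
  case (step v t)
  note [simp] = agree_outsideD[OF step(3), simplified]
  show ?case
    using step(2) assms by (intro runs_intros) simp
next
  case (final t)
  thus ?case
    using search_result_eq_0_iff[OF final(2)] by auto
qed (use assms dim_le in auto)

lemma runs_find_gap:
  assumes "nmem s aN 0 = n"
  shows "runs find_gap s (\<lambda>t. \<exists>h\<le>n. nmem t aGAP 0 = Suc h \<and> (\<forall>v<n. nmem s aD v \<noteq> h))"
  unfolding find_gap_def
proof (rule runs_conseq[OF runs_Search[where m = "n + 1" and P = "\<lambda>h. \<forall>v<n. nmem s aD v \<noteq> h"]],
    goal_cases bound le disjoint counter result distinct step final)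
  case (step h t)
  note [simp] = agree_outsideD[OF step(3), simplified program]
  have "runs find_level t (\<lambda>t'. nmem t' aOCC 0 \<noteq> 0 \<longleftrightarrow> (\<exists>v<n. nmem t aD v = h))"
    using assms step(2) by (intro runs_find_level) simp_all
  thus ?case
    by (rule runs_conseq) auto
next
  case (final t)
  obtain h where "h \<le> card {..<n}" "\<And>v. v \<in> {..<n} \<Longrightarrow> nmem s aD v \<noteq> h"
    using gap_exists[of "{..<n}" "nmem s aD"] by blast
  hence "nmem t aGAP 0 \<noteq> 0"
    using search_result_eq_0_iff[OF final(2)] by (auto simp: less_Suc_eq_le)
  thus ?case
    using search_result_witness[OF final(2)] by (auto simp: gr0_conv_Suc less_Suc_eq_le)
qed (use assms dim_le in \<open>auto simp: program\<close>)

lemma runs_apply_move: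
  assumes "nmem s aN 0 = n" "nmem s aGAP 0 = Suc h"
  shows "runs apply_move s (\<lambda>t. \<forall>v<n.
    nmem t aL v = (if h < nmem s aD v then nmem s aA 0 else nmem s aF v))"
  unfolding apply_move_def
proof (rule runs_conseq[OF runs_tabulate[where m = n and get = "\<lambda>t. nmem t aL" and k = 0 and
      F = "\<lambda>v. if h < nmem s aD v then nmem s aA 0 else nmem s aF v"]],
    goal_cases bound le disjoint counter get step final)
  case (step v t)
  note [simp] = agree_outsideD[OF step(3), simplified]
  show ?case
    using step(2) assms by (intro runs_intros) simp_all
qed (use assms dim_le in \<open>auto simp: overwrite_def\<close>)

end

locale labeling_ram = matrix_ram + uniform_labeling "{..<n}" W for W :: "nat \<Rightarrow> nat \<Rightarrow> real"
begin

lemma runs_init_preflow: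
  assumes tab: "row_table n m s" "n \<le> m" and W: "weights n W s"
  shows "runs init_preflow s (\<lambda>t. (\<forall>v<n. nmem t aD v = 0) \<and>
    preflow_at S (separation {..<n} W (nmem s aF)) (move_capacity W (nmem s aF)) t)"
proof -
  obtain s1 where s1: "reaches init_heights s s1" "\<forall>v<n. nmem s1 aD v = 0"
    using runs_init_heights[OF row_tableD(1)[OF tab(1)]] by (rule runsE)
  note [simp] = reaches_frame[OF s1(1), simplified program]
  have "row_table n m s1" "weights n W s1"
    using tab W by (simp_all add: row_table_def weights_def)
  from runs_init_excess[OF this(1) tab(2) this(2)]
  obtain s2 where s2: "reaches init_excess s1 s2"
    "\<forall>v<n. rmem s2 rEX v = separation {..<n} W (nmem s1 aF) v"
    by (rule runsE)
  note [simp] = reaches_frame[OF s2(1), simplified program]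
  have "row_table n m s2" "weights n W s2"
    using tab W by (simp_all add: row_table_def weights_def)
  from runs_init_residual[OF this(1) tab(2) this(2)]
  obtain s3 where s3: "reaches init_residual s2 s3"
    "\<forall>u<n. \<forall>v<n. residual n s3 u v = move_capacity W (nmem s2 aF) u v"
    by (rule runsE)
  note [simp] = reaches_frame[OF s3(1), simplified program]
  have "preflow_at S (separation {..<n} W (nmem s aF)) (move_capacity W (nmem s aF)) s3"
    using s1(2) s2(2) s3(2) separation_nonneg move_capacity_nonneg
    by (intro preflow_initial) simp_all
  thus ?thesis
    unfolding init_preflow_def using s1(2)
    by (intro runs_reaches_Seq[OF s1(1)] runs_reaches_Seq[OF s2(1)] runsI[OF s3(1)]) simp
qed

lemma runs_best_move:
  assumes tab: "row_table n m s" "n \<le> m" and W: "weights n W s"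
    and a: "nmem s aA 0 = a" "a \<le> m" "a \<in> \<Lambda>"
    and lab: "lab a = row n (nmem s aFAM) a" and f: "labeling {..<n} \<Lambda> lab (nmem s aF)"
  shows "runs best_move s (\<lambda>t. labeling {..<n} \<Lambda> lab (nmem t aL) \<and>
    (\<forall>Y. Y \<subseteq> {..<n} \<and> Y \<subseteq> lab a \<longrightarrow>
      label_cost {..<n} W (nmem t aL) \<le> move_cost {..<n} W (nmem s aF) Y))"
proof -
  let ?V = "{..<n}" and ?f = "nmem s aF"
  let ?b = "separation ?V W ?f" and ?c = "move_capacity W ?f"
  obtain s1 where s1: "reaches init_preflow s s1" "\<forall>v<n. nmem s1 aD v = 0"
    "preflow_at (lab a) ?b ?c s1"
    using runs_init_preflow[OF tab W, where S = "lab a"] by (auto elim: runsE)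
  note [simp] = reaches_frame[OF s1(1), simplified program]
  obtain s2 where s2: "reaches (Repeat push_counters (Var aN \<oplus> NConst 2) preflow_step) s1 s2"
      "preflow_at (lab a) ?b ?c s2" "\<And>u. \<not> active_at (lab a) s2 u"
    using runs_preflow_steps[of m s1 a "lab a" ?b ?c] tab a lab s1(2,3)
    by (auto simp: row_table_def elim: runsE)
  note [simp] = reaches_frame[OF s2(1), simplified program]
  obtain s3 h where s3: "reaches find_gap s2 s3" "h \<le> n" "nmem s3 aGAP 0 = Suc h"
    "\<forall>v<n. nmem s2 aD v \<noteq> h"
    using runs_find_gap[of s2] tab by (auto simp: row_table_def elim: runsE)
  note [simp] = reaches_frame[OF s3(1), simplified program]
  let ?X = "{v \<in> ?V. h < nmem s2 aD v}"
  obtain t where t: "reaches apply_move s3 t" "\<forall>v<n. nmem t aL v = (if v \<in> ?X then a else ?f v)"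
    using runs_apply_move[of s3 h] s3(3) tab a by (auto simp: row_table_def elim: runsE)
  have X: "?X \<subseteq> lab a"
    by (rule preflow.gap_subset_nonsinks[OF s2(2)])
  have "label_cost ?V W (nmem t aL) \<le> move_cost ?V W ?f Y" if "Y \<subseteq> ?V" "Y \<subseteq> lab a" for Y
  proof -
    have "label_cost ?V W (nmem t aL) = label_cost ?V W (\<lambda>v. if v \<in> ?X then a else ?f v)"
      using t(2) by (intro label_cost_cong) simp
    also have "\<dots> \<le> move_cost ?V W ?f ?X"
      by (rule label_cost_move_le) auto
    also have "\<dots> \<le> move_cost ?V W ?f Y"
      unfolding move_cost_def using s3(2,4) that by (intro preflow.gap_cut_minimal[OF s2(2,3)]) auto
    finally show ?thesis .
  qed
  moreover have "labeling ?V \<Lambda> lab (nmem t aL)"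
    using f t(2) X a(3) by (auto simp: labeling_def)
  ultimately show ?thesis
    unfolding best_move_def by (intro runs_reaches_Seq[OF s1(1)] runs_reaches_Seq[OF s2(1)]
      runs_reaches_Seq[OF s3(1)] runsI[OF t(1)]) auto
qed

end

section \<open>The algorithm\<close>

abbreviation (input) "aG \<equiv> (1 :: nat)"
abbreviation (input) "aOUT \<equiv> (4 :: nat)"
abbreviation (input) "search_counters \<equiv> [36, 37, 38, 39, 40, 41, 42, 43, 44 :: nat]"
abbreviation (input) "rCOST \<equiv> (5 :: nat)"
abbreviation (input) "rBEST \<equiv> (6 :: nat)"

definition copy_labels :: "nat \<Rightarrow> nat \<Rightarrow> com" where [program]:
  "copy_labels a b = (FOR aV < Var aN DO b\<langle>Var aV\<rangle> ::= a\<langle>Var aV\<rangle>)"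

definition sum_label_cost :: "nat \<Rightarrow> nat \<Rightarrow> com" where [program]:
  "sum_label_cost a r = (r ::=\<^sub>r ROfNat (NConst 0) ;;
     FOR aU < Var aN DO (sum_separation a ;; r ::=\<^sub>r RVar r \<oplus>\<^sub>r RVar rSUM))"

definition keep_better :: com where [program]:
  "keep_better = (sum_label_cost aL rCOST ;; sum_label_cost aBEST rBEST ;;
     IF RVar rCOST \<^bold><\<^sub>r RVar rBEST THEN copy_labels aL aBEST ELSE Skip)"

definition try_label :: com where [program]:
  "try_label = (best_move ;; keep_better)"

definition improve :: com where [program]:
  "improve = (copy_labels aF aBEST ;; (FOR aA < Var aCNT DO try_label) ;; copy_labels aBEST aF)"

definition init_labels :: com where [program]:
  "init_labels = (FOR aV < Var aN DO (
     Search aHIT aI (Var aCNT) Skip (Nonzero (aFAM\<langle>Var aI, Var aV\<rangle>)) ;;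
     aF\<langle>Var aV\<rangle> ::= Var aHIT \<ominus> NConst 1))"

definition write_output :: com where [program]:
  "write_output = (FOR aU < Var aN DO FOR aV < Var aN DO
     IF Nonzero (aG\<langle>Var aU, Var aV\<rangle>) \<^bold>\<and> \<^bold>\<not> aF\<langle>Var aU\<rangle> \<^bold>= aF\<langle>Var aV\<rangle>
     THEN aOUT\<langle>Var aU, Var aV\<rangle> ::= NConst 1 ELSE aOUT\<langle>Var aU, Var aV\<rangle> ::= NConst 0)"

definition prepare :: com where [program]:
  "prepare = (enum_mis ;; fill_rows ;; init_labels)"

definition local_search :: com where [program]:
  "local_search = Repeat search_counters (Var aN \<oplus> (Var aCNT \<oplus> NConst 2)) improve"

definition algorithm :: com where [program]:
  "algorithm = (prepare ;; local_search ;; write_output)"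

context matrix_ram
begin

lemma runs_copy_labels:
  assumes "nmem s aN 0 = n" "a \<noteq> b" "aV \<notin> {a, b}" "b \<noteq> aN"
  shows "runs (copy_labels a b) s (\<lambda>t. \<forall>v<n. nmem t b v = nmem s a v)"
  unfolding copy_labels_def
proof (rule runs_conseq[OF runs_tabulate[where m = n and get = "\<lambda>t. nmem t b" and k = 0 and
      F = "nmem s a"]],
    goal_cases bound le disjoint counter get step final)
  case (step v t)
  note [simp] = agree_outsideD[OF step(3), simplified]
  show ?case
    using step(2) assms by (intro runs_intros) simp
qed (use assms dim_le in \<open>auto simp: overwrite_def\<close>)

lemma runs_sum_label_cost:
  assumes tab: "row_table n m s" "n \<le> m" and W: "weights n W s" and a: "a \<notin> {aU, aV}"
    and r: "r \<notin> {rW, rSUM}"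
  shows "runs (sum_label_cost a r) s (\<lambda>t. rmem t r 0 = label_cost {..<n} W (nmem s a))"
  unfolding sum_label_cost_def
proof (rule runs_Seq, rule runs_RStore, rule runs_conseq[OF runs_For_sum[where m = n and r = r and
      g = "separation {..<n} W (nmem s a)"]], goal_cases bound le disjoint counter step final)
  case (step u t)
  note [simp] = agree_outsideD[OF step(3), simplified program]
  have "runs (sum_separation a) t (\<lambda>t'. rmem t' rSUM 0 = separation {..<n} W (nmem t a) u)"
    using tab W step(1,2) a r
    by (intro runs_sum_separation[where m = m]) (auto simp: row_table_def weights_def)
  then obtain t' where t': "reaches (sum_separation a) t t'"
    "rmem t' rSUM 0 = separation {..<n} W (nmem s a) u"
    using a by (auto elim: runsE)
  note [simp] = reaches_frame[OF t'(1), simplified program]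
  show ?case
    using t'(2) r by (intro runs_reaches_Seq[OF t'(1)] runs_intros) simp
qed (use dim_le in \<open>auto simp: row_tableD[OF tab(1)] label_cost_def program\<close>)

lemma runs_init_labels:
  assumes tab: "row_table n m s" and L: "nmem s aCNT 0 = L" "L \<le> m" "L \<le> z"
    and cover: "\<And>v. v < n \<Longrightarrow> \<exists>i<L. v \<in> row n (nmem s aFAM) i"
  shows "runs init_labels s (\<lambda>t. labeling {..<n} {..<L} (row n (nmem s aFAM)) (nmem t aF))"
  unfolding init_labels_def
proof (rule runs_conseq[OF runs_For[where m = n and
      Inv = "\<lambda>k t. \<forall>v<k. nmem t aF v < L \<and> v \<in> row n (nmem s aFAM) (nmem t aF v)"]],
    goal_cases bound le disjoint counter init step final)
  case (step v t)
  let ?P = "\<lambda>i. v \<in> row n (nmem s aFAM) i"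
  let ?search = "Search aHIT aI (Var aCNT) Skip (Nonzero (aFAM\<langle>Var aI, Var aV\<rangle>))"
  note [simp] = agree_outsideD[OF step(4), simplified]
  have "runs ?search t (\<lambda>t'. search_result ?P L (nmem t' aHIT 0))"
  proof (rule runs_Search, goal_cases bound le disjoint counter result distinct step)
    case (step i t')
    note [simp] = agree_outsideD[OF step(3), simplified]
    show ?case
      using step(1,2) \<open>v < n\<close> \<open>nmem t aV 0 = v\<close> L
      by (intro runs_intros) (simp add: row_tableD[OF tab] mem_row_iff)
  qed (use L in auto)
  then obtain t' where t': "reaches ?search t t'" "search_result ?P L (nmem t' aHIT 0)"
    by (rule runsE)
  note [simp] = reaches_frame[OF t'(1), simplified]
  have "nmem t' aHIT 0 \<noteq> 0"
    using search_result_eq_0_iff[OF t'(2)] cover[OF step(1)] by auto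
  with search_result_witness[OF t'(2)] step(2,3) show ?case
    by (intro runs_reaches_Seq[OF t'(1)] runs_NStore) (auto simp: less_Suc_eq)
qed (use dim_le in \<open>auto simp: row_tableD[OF tab] labeling_def\<close>)

lemma runs_write_output:
  assumes tab: "row_table n m s" "n \<le> m"
  shows "runs write_output s (\<lambda>t. \<forall>u<n. \<forall>v<n.
    nmem t aOUT (u * n + v) \<noteq> 0 \<longleftrightarrow> nmem s aG (u * n + v) \<noteq> 0 \<and> nmem s aF u \<noteq> nmem s aF v)"
  unfolding write_output_def
proof (rule runs_conseq[OF runs_tabulate_matrix[where n = n and get = "\<lambda>t. nmem t aOUT" and
      F = "\<lambda>u v. of_bool (nmem s aG (u * n + v) \<noteq> 0 \<and> nmem s aF u \<noteq> nmem s aF v)"]],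
    goal_cases bound le disjoint outer inner distinct get get' step final)
  case (step u v t)
  note [simp] = agree_outsideD[OF step(5), simplified]
  have "u \<le> m"
    using step(1) tab(2) by simp
  thus ?case
    using step(3,4) by (intro runs_intros) (auto simp: row_tableD[OF tab(1)])
qed (use dim_le in \<open>auto simp: row_tableD[OF tab(1)]\<close>)

end

context labeling_ram
begin

definition search_state :: "nat \<Rightarrow> nat \<Rightarrow> (nat \<Rightarrow> nat set) \<Rightarrow> state \<Rightarrow> bool" where
  "search_state m L lab s \<longleftrightarrow> row_table n m s \<and> n \<le> m \<and> nmem s aCNT 0 = L \<and> L \<le> m \<and> n + L + 2 \<le> z \<and>
     row n (nmem s aFAM) = lab \<and> weights n W s"

lemma search_state_frame:
  assumes "search_state m L lab s" "agree_outside N R s t" "N \<inter> {aN, aROW, aCNT, aFAM} = {}"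
    "rW \<notin> R"
  shows "search_state m L lab t"
proof -
  have "nmem t a = nmem s a" if "a \<in> {aN, aROW, aCNT, aFAM}" for a
    using agree_outsideD(1)[OF assms(2), of a] assms(3) that by blast
  moreover have "rmem t rW = rmem s rW"
    using agree_outsideD(2)[OF assms(2,4)] .
  ultimately show ?thesis
    using assms(1) by (simp add: search_state_def row_table_def weights_def)
qed

lemma runs_keep_better:
  assumes s: "search_state m L lab s"
  shows "runs keep_better s (\<lambda>t. \<forall>v<n. nmem t aBEST v =
    (if label_cost {..<n} W (nmem s aL) < label_cost {..<n} W (nmem s aBEST)
     then nmem s aL v else nmem s aBEST v))"
proof -
  have base: "row_table n m s" "n \<le> m" "weights n W s"
    using s by (simp_all add: search_state_def)
  obtain s1 where s1: "reaches (sum_label_cost aL rCOST) s s1"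
      "rmem s1 rCOST 0 = label_cost {..<n} W (nmem s aL)"
    using runs_sum_label_cost[OF base, of aL rCOST] by (auto elim: runsE)
  note [simp] = reaches_frame[OF s1(1), simplified program]
  obtain s2 where s2: "reaches (sum_label_cost aBEST rBEST) s1 s2"
      "rmem s2 rBEST 0 = label_cost {..<n} W (nmem s aBEST)"
    using runs_sum_label_cost[of m s1 W aBEST rBEST] base
    by (auto simp: row_table_def weights_def elim: runsE)
  note [simp] = reaches_frame[OF s2(1), simplified program]
  have "runs (copy_labels aL aBEST) s2 (\<lambda>t. \<forall>v<n. nmem t aBEST v = nmem s aL v)"
    using runs_copy_labels[of s2 aL aBEST] base(1) by (simp add: row_table_def)
  thus ?thesis
    unfolding keep_better_def using s1(2) s2(2)
    by (intro runs_reaches_Seq[OF s1(1)] runs_reaches_Seq[OF s2(1)] runs_Cond runs_Skip) simp_all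
qed

lemma runs_try_label:
  assumes s: "search_state m L lab s" and a: "nmem s aA 0 = a" "a < L"
    and f: "labeling {..<n} {..<L} lab (nmem s aF)"
    and best: "labeling {..<n} {..<L} lab (nmem s aBEST)"
  shows "runs try_label s (\<lambda>t. labeling {..<n} {..<L} lab (nmem t aBEST) \<and>
    label_cost {..<n} W (nmem t aBEST) \<le> label_cost {..<n} W (nmem s aBEST) \<and>
    (\<forall>Y. Y \<subseteq> {..<n} \<and> Y \<subseteq> lab a \<longrightarrow>
      label_cost {..<n} W (nmem t aBEST) \<le> move_cost {..<n} W (nmem s aF) Y))"
    (is "runs try_label s ?Q")
proof -
  let ?V = "{..<n}" and ?cost = "label_cost {..<n} W"
  obtain s1 where s1: "reaches best_move s s1" "labeling ?V {..<L} lab (nmem s1 aL)"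
      "\<And>Y. Y \<subseteq> ?V \<Longrightarrow> Y \<subseteq> lab a \<Longrightarrow> ?cost (nmem s1 aL) \<le> move_cost ?V W (nmem s aF) Y"
    using runs_best_move[of m s a "{..<L}" lab] s a f by (auto simp: search_state_def elim: runsE)
  note [simp] = reaches_frame[OF s1(1), simplified program]
  have "search_state m L lab s1"
    by (rule search_state_frame[OF s reaches_agree_outside[OF s1(1)]]) (simp_all add: program)
  from runs_keep_better[OF this] have "runs keep_better s1 ?Q"
  proof (rule runs_conseq)
    fix t :: state
    let ?kept = "if ?cost (nmem s1 aL) < ?cost (nmem s1 aBEST) then nmem s1 aL else nmem s1 aBEST"
    assume "\<forall>v<n. nmem t aBEST v =
      (if ?cost (nmem s1 aL) < ?cost (nmem s1 aBEST) then nmem s1 aL v else nmem s1 aBEST v)"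
    hence "?cost (nmem t aBEST) = ?cost ?kept"
      "labeling ?V {..<L} lab (nmem t aBEST) = labeling ?V {..<L} lab ?kept"
      by (intro label_cost_cong labeling_cong; simp)+
    moreover have kept_le: "?cost ?kept \<le> ?cost (nmem s1 aL)" "?cost ?kept \<le> ?cost (nmem s aBEST)"
      by simp_all
    moreover have "labeling ?V {..<L} lab ?kept"
      using s1(2) best by simp
    ultimately show "?Q t"
      using order.trans[OF kept_le(1) s1(3)] by (simp del: not_less)
  qed
  thus ?thesis
    unfolding try_label_def by (intro runs_reaches_Seq[OF s1(1)])
qed

lemma runs_improve:
  assumes s: "search_state m L lab s" and f: "labeling {..<n} {..<L} lab (nmem s aF)"
  shows "runs improve s (\<lambda>t. labeling {..<n} {..<L} lab (nmem t aF) \<and>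
    improves {..<n} W {..<L} lab (nmem s aF) (nmem t aF))"
proof -
  let ?V = "{..<n}"
  let ?best = "\<lambda>a t. labeling ?V {..<L} lab (nmem t aBEST) \<and> (\<forall>b<a. \<forall>Y. Y \<subseteq> ?V \<and> Y \<subseteq> lab b \<longrightarrow>
    label_cost ?V W (nmem t aBEST) \<le> move_cost ?V W (nmem s aF) Y)"
  have n: "nmem s aN 0 = n"
    using s by (simp add: search_state_def row_table_def)
  obtain s1 where s1: "reaches (copy_labels aF aBEST) s s1" "\<forall>v<n. nmem s1 aBEST v = nmem s aF v"
    using runs_copy_labels[OF n, of aF aBEST] by (auto elim: runsE)
  note [simp] = reaches_frame[OF s1(1), simplified program]
  have search1: "search_state m L lab s1"
    by (rule search_state_frame[OF s reaches_agree_outside[OF s1(1)]]) (simp_all add: program)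
  have "runs (FOR aA < Var aCNT DO try_label) s1 (?best L)"
  proof (rule runs_For[where Inv = ?best], goal_cases bound le disjoint counter init step)
    case init
    show ?case
      using s1(2) f labeling_cong[of ?V "nmem s1 aBEST" "nmem s aF"] by simp
  next
    case (step a t)
    note [simp] = agree_outsideD[OF step(4), simplified program]
    have "search_state m L lab t"
      by (rule search_state_frame[OF search1 step(4)]) (simp_all add: program)
    from runs_try_label[OF this step(3,1)] show ?case
      using step(2) f by (auto simp: less_Suc_eq elim!: runs_conseq intro: order.trans)
  qed (use search1 in \<open>auto simp: search_state_def program\<close>)
  then obtain s2 where s2: "reaches (FOR aA < Var aCNT DO try_label) s1 s2" "?best L s2"
    by (rule runsE)
  note [simp] = reaches_frame[OF s2(1), simplified program]
  obtain t where t: "reaches (copy_labels aBEST aF) s2 t" "\<forall>v<n. nmem t aF v = nmem s2 aBEST v"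
    using runs_copy_labels[of s2 aBEST aF] n by (auto elim: runsE)
  have "label_cost ?V W (nmem t aF) = label_cost ?V W (nmem s2 aBEST)"
    "labeling ?V {..<L} lab (nmem t aF) = labeling ?V {..<L} lab (nmem s2 aBEST)"
    using t(2) by (intro label_cost_cong labeling_cong; simp)+
  thus ?thesis
    unfolding improve_def using s2(2)
    by (intro runs_reaches_Seq[OF s1(1)] runs_reaches_Seq[OF s2(1)] runsI[OF t(1)])
      (auto simp: improves_def)
qed

lemma runs_local_search:
  assumes s: "search_state m L lab s" and L: "0 < L" and f: "labeling {..<n} {..<L} lab (nmem s aF)"
  shows "runs local_search s
    (\<lambda>t. labeling {..<n} {..<L} lab (nmem t aF) \<and> (\<forall>h. labeling {..<n} {..<L} lab h \<longrightarrow>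
      label_cost {..<n} W (nmem t aF) \<le> 2 * label_cost {..<n} W h))"
  unfolding local_search_def
proof (rule runs_conseq[OF runs_Repeat[where m = "n + (L + 2)" and
      Inv = "\<lambda>i t. labeling {..<n} {..<L} lab (nmem t aF) \<and>
        (improves {..<n} W {..<L} lab ^^ i) (nmem s aF) (nmem t aF)"]],
    goal_cases bound le disjoint distinct counters stable init step final)
  case (step i t)
  have "search_state m L lab t"
    by (rule search_state_frame[OF s step(2)]) (simp_all add: program)
  from runs_improve[OF this conjunct1[OF step(1)]] show ?case
    using step(1) by (auto elim!: runs_conseq)
next
  case (final t)
  have "16 * ((card {..<n})\<^sup>2 + 1)\<^sup>2 * card {..<L} \<le> 2 ^ 4 * ((n + 2)\<^sup>2)\<^sup>2 * L"
    by (intro mult_mono power_mono) (auto simp: power2_eq_square)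
  also have "\<dots> \<le> (n + (L + 2)) ^ 4 * ((n + (L + 2))\<^sup>2)\<^sup>2 * (n + (L + 2))"
    by (intro mult_mono power_mono) auto
  also have "x ^ 4 * (x\<^sup>2)\<^sup>2 * x = x ^ length search_counters" for x :: nat
    by (simp add: eval_nat_numeral ac_simps)
  finally have "label_cost {..<n} W (nmem t aF) \<le> 2 * label_cost {..<n} W h"
    if "labeling {..<n} {..<L} lab h" for h
    using local_search_two_approx[OF that] L final(2) by blast
  with final(2) show ?case
    by blast
qed (use s f in \<open>auto simp: search_state_def row_table_def program\<close>)

end

lemma row_major_index: "u < n \<Longrightarrow> v < n \<Longrightarrow> row_major n A (u * n + v) = A u v"
  using matrix_index_less[of u n v n] by (simp add: row_major_def)

lemma input_state_simps:
  assumes "valid_instance I"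
  shows "nmem (input_state I) aN 0 = nverts I" "nmem (input_state I) aFAM = (\<lambda>_. 0)"
    "adjacency (nverts I) (dedges I) (input_state I)"
    "weights (nverts I) (weight_matrix I) (input_state I)"
    "u < nverts I \<Longrightarrow> v < nverts I \<Longrightarrow>
      nmem (input_state I) aG (u * nverts I + v) \<noteq> 0 \<longleftrightarrow> {u, v} \<in> edges I"
  by (auto simp: input_state_def adjacency_def weights_def Let_def row_major_index
      weight_matrix_def)

lemma output_edges_eq_label_cut:
  assumes "valid_instance I" and "\<And>u v. u < nverts I \<Longrightarrow> v < nverts I \<Longrightarrow>
    nmem s aOUT (u * nverts I + v) \<noteq> 0 \<longleftrightarrow> {u, v} \<in> edges I \<and> f u \<noteq> f v"
  shows "output_edges I s = label_cut I f"
  unfolding output_edges_def label_cut_def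
  using assms(2) edges_subset_vertices[OF assms(1)] by (intro Collect_cong ex_cong1) blast

context labeling_ram
begin

definition near_optimal_output :: "nat set set \<Rightarrow> state \<Rightarrow> state \<Rightarrow> bool" where
  "near_optimal_output E s t \<longleftrightarrow> (\<exists>lab (L :: nat) f. mis E {..<n} = lab ` {..<L} \<and>
     labeling {..<n} {..<L} lab f \<and>
     (\<forall>h. labeling {..<n} {..<L} lab h \<longrightarrow> label_cost {..<n} W f \<le> 2 * label_cost {..<n} W h) \<and>
     (\<forall>u<n. \<forall>v<n. nmem t aOUT (u * n + v) \<noteq> 0 \<longleftrightarrow> nmem s aG (u * n + v) \<noteq> 0 \<and> f u \<noteq> f v))"

lemma runs_prepare:
  assumes s: "nmem s aN 0 = n" "nmem s aFAM = (\<lambda>_. 0)" "adjacency n E s" "weights n W s"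
    and no_loop: "\<And>v. {v} \<notin> E"
    and count: "\<And>j. j \<le> n \<Longrightarrow> card (mis E {..<j}) \<le> B" and bound: "(n + 2) * (2 * B + 2) \<le> z"
  shows "runs prepare s (\<lambda>t. \<exists>m L lab. mis E {..<n} = lab ` {..<L} \<and> search_state m L lab t \<and>
    labeling {..<n} {..<L} lab (nmem t aF))"
proof -
  obtain s1 where s1: "reaches enum_mis s s1"
      "family n (nmem s1 aFAM) (nmem s1 aCNT 0) (mis E {..<n})"
    using runs_enum_mis[OF s(1-3) no_loop count bound] by (rule runsE)
  note [simp] = reaches_frame[OF s1(1), simplified program]
  define L where "L = nmem s1 aCNT 0"
  define lab where "lab = row n (nmem s1 aFAM)"
  have lab: "mis E {..<n} = lab ` {..<L}"
    using s1(2) by (simp add: family_def lab_def L_def)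
  have "L \<le> B"
    using card_family[OF s1(2)] count[of n] by (simp add: L_def)
  with bound have L_bound: "n + L + 2 \<le> z" "n + (L + L) \<le> z"
    by (simp_all add: algebra_simps)
  obtain s2 where s2: "reaches fill_rows s1 s2" "row_table n (n + (L + L)) s2"
    using runs_fill_rows[of s1 L] s(1) L_bound by (auto simp: L_def elim: runsE)
  note [simp] = reaches_frame[OF s2(1), simplified program]
  have "\<exists>i<L. v \<in> row n (nmem s2 aFAM) i" if "v < n" for v
    using mis_covers[of "{..<n}" v E] no_loop that lab by (auto simp: lab_def)
  from runs_init_labels[OF s2(2) _ _ _ this]
  obtain t where t: "reaches init_labels s2 t" "labeling {..<n} {..<L} lab (nmem t aF)"
    using L_bound by (auto simp: lab_def L_def elim: runsE)
  note [simp] = reaches_frame[OF t(1), simplified program]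
  have "search_state (n + (L + L)) L lab t"
    using s2(2) s(4) L_bound by (simp add: search_state_def row_table_def weights_def lab_def L_def)
  with lab t(2) show ?thesis
    unfolding prepare_def
    by (intro runs_reaches_Seq[OF s1(1)] runs_reaches_Seq[OF s2(1)] runsI[OF t(1)]) blast
qed

theorem runs_algorithm:
  assumes s: "nmem s aN 0 = n" "nmem s aFAM = (\<lambda>_. 0)" "adjacency n E s" "weights n W s"
    and no_loop: "\<And>v. {v} \<notin> E"
    and count: "\<And>j. j \<le> n \<Longrightarrow> card (mis E {..<j}) \<le> B" and bound: "(n + 2) * (2 * B + 2) \<le> z"
  shows "runs algorithm s (near_optimal_output E s)"
proof -
  obtain s1 m lab and L :: nat where s1: "reaches prepare s s1" "mis E {..<n} = lab ` {..<L}"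
      "search_state m L lab s1" "labeling {..<n} {..<L} lab (nmem s1 aF)"
    using runs_prepare[OF s no_loop count bound] by (auto elim!: runsE)
  note [simp] = reaches_frame[OF s1(1), simplified program]
  have "mis E {..<n} \<noteq> {}"
    by (rule independent_subset_mis[of "{..<n}" "{}" E])
      (use no_loop in \<open>auto simp: independent_def\<close>)
  hence "0 < L"
    using s1(2) by auto
  from runs_local_search[OF s1(3) this s1(4)] obtain s2 where s2: "reaches local_search s1 s2"
      "labeling {..<n} {..<L} lab (nmem s2 aF)"
      "\<forall>h. labeling {..<n} {..<L} lab h \<longrightarrow>
        label_cost {..<n} W (nmem s2 aF) \<le> 2 * label_cost {..<n} W h"
    by (auto elim: runsE)
  note [simp] = reaches_frame[OF s2(1), simplified program]
  have "row_table n m s2" "n \<le> m"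
    using s1(3) by (simp_all add: search_state_def row_table_def)
  from runs_write_output[OF this] obtain t where t: "reaches write_output s2 t"
      "\<forall>u<n. \<forall>v<n. nmem t aOUT (u * n + v) \<noteq> 0 \<longleftrightarrow>
        nmem s2 aG (u * n + v) \<noteq> 0 \<and> nmem s2 aF u \<noteq> nmem s2 aF v"
    by (rule runsE)
  have "near_optimal_output E s t"
    unfolding near_optimal_output_def using s1(2) s2(2,3) t(2)
    by (intro exI[of _ lab] exI[of _ L] exI[of _ "nmem s2 aF"]) simp
  thus ?thesis
    unfolding algorithm_def
    by (intro runs_reaches_Seq[OF s1(1)] runs_reaches_Seq[OF s2(1)] runsI[OF t(1)])
qed

end

theorem algorithm_correct:
  assumes I: "valid_instance I" and count: "\<And>j. j \<le> nverts I \<Longrightarrow> card (mis (dedges I) {..<j}) \<le> B"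
  shows "\<exists>T s. exec algorithm (input_state I) T s \<and>
    T \<le> ((nverts I + 2) * (2 * B + 2)) ^ time_exponent algorithm \<and>
    feasible I (output_edges I s) \<and> cost I (output_edges I s) \<le> 2 * opt I"
proof -
  let ?n = "nverts I" and ?W = "weight_matrix I"
  let ?z = "(?n + 2) * (2 * B + 2)"
  interpret uniform_labeling "{..<?n}" ?W
    by (rule uniform_labeling_weight_matrix[OF I])
  interpret labeling_ram ?z ?n ?W
    by unfold_locales auto
  obtain t where t: "reaches algorithm (input_state I) t"
      "near_optimal_output (dedges I) (input_state I) t"
    using runs_algorithm[OF input_state_simps(1-4)[OF I] demand_loop_free[OF I] count order.refl]
    by (rule runsE)
  from t(2) obtain lab f and L :: nat where
    lab: "mis (dedges I) {..<?n} = lab ` {..<L}" and f: "labeling {..<?n} {..<L} lab f"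
    and two: "\<forall>h. labeling {..<?n} {..<L} lab h \<longrightarrow>
      label_cost {..<?n} ?W f \<le> 2 * label_cost {..<?n} ?W h"
    and out: "\<forall>u<?n. \<forall>v<?n.
      nmem t aOUT (u * ?n + v) \<noteq> 0 \<longleftrightarrow> nmem (input_state I) aG (u * ?n + v) \<noteq> 0 \<and> f u \<noteq> f v"
    unfolding near_optimal_output_def by blast
  have "output_edges I t = label_cut I f"
    using out input_state_simps(5)[OF I] by (intro output_edges_eq_label_cut[OF I]) blast
  moreover have "feasible I (label_cut I f)"
    using lab by (intro feasible_label_cut[OF I f]) simp
  moreover have "cost I (label_cut I f) \<le> 2 * opt I"
    using two by (intro label_cut_two_approx[OF I lab]) simp
  ultimately show ?thesis
    using t(1) unfolding reaches_def by metis
qed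

section \<open>Running time for \<open>tK\<^sub>2\<close>-free demand graphs\<close>

lemma square_add_one_power_le:
  fixes k t :: nat
  assumes "2 \<le> k"
  shows "(k\<^sup>2 + 1) ^ t \<le> k ^ (3 * t)"
proof -
  have "k\<^sup>2 + 1 \<le> 2 * k\<^sup>2"
    using assms by simp
  also have "\<dots> \<le> k * k\<^sup>2"
    using assms by (rule mult_le_mono1)
  finally have "k\<^sup>2 + 1 \<le> k ^ 3"
    by (simp add: power3_eq_cube power2_eq_square)
  thus ?thesis
    by (simp add: power_mult power_mono)
qed

lemma finite_terminals: "valid_instance I \<Longrightarrow> finite (dverts I)"
  by (auto simp: valid_instance_def intro: finite_subset)

lemma no_demands_of_card_terminals:
  assumes I: "valid_instance I" and "card (dverts I) < 2"
  shows "dedges I = {}"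
proof (rule ccontr)
  assume "dedges I \<noteq> {}"
  then obtain e where "e \<in> all_pairs (dverts I)"
    using I by (metis ex_in_conv subsetD valid_instance_def)
  then obtain u v where "u \<in> dverts I" "v \<in> dverts I" "u \<noteq> v"
    by (auto simp: all_pairs_def)
  hence "card {u, v} \<le> card (dverts I)" "card {u, v} = 2"
    using finite_terminals[OF I] card_mono[of "dverts I" "{u, v}"] by auto
  with assms(2) show False
    by simp
qed

lemma card_mis_demands_le:
  assumes I: "valid_instance I" and t: "0 < t" and free: "tK2_free t (dedges I)" and V: "finite V"
  shows "card (mis (dedges I) V) \<le> card (dverts I) ^ (3 * t) + 1"
proof (cases "2 \<le> card (dverts I)")
  case True
  let ?k = "card (dverts I)" and ?E = "dedges I"
  have demand: "e \<subseteq> dverts I" "card e = 2" if "e \<in> ?E" for e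
    using that I by (auto simp: valid_instance_def all_pairs_def)
  have "card (mis ?E V) \<le> card (mis ?E (V \<inter> dverts I))"
    by (intro card_mis_isolated_le V demand(1))
  also have "\<dots> \<le> ((card (V \<inter> dverts I))\<^sup>2 + 1) ^ (t - 1)"
    using V demand(2) t free
    by (intro card_mis_le_of_induced_matching) (auto simp: tK2_free_iff_induced_matching)
  also have "\<dots> \<le> (?k\<^sup>2 + 1) ^ (t - 1)"
    using finite_terminals[OF I] by (intro power_mono add_mono card_mono) auto
  also have "\<dots> \<le> ?k ^ (3 * (t - 1))"
    by (rule square_add_one_power_le[OF True])
  also have "\<dots> \<le> ?k ^ (3 * t)"
    using True by (intro power_increasing) auto
  finally show ?thesis
    by simp
next
  case False
  hence "independent (dedges I) V"
    using no_demands_of_card_terminals[OF I] by (simp add: independent_def)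
  thus ?thesis
    by (simp add: mis_of_independent)
qed

lemma power_two_mult_add_four_le:
  fixes y c :: nat
  shows "(2 * y + 4) ^ c \<le> 6 ^ c * y ^ c + 6 ^ c"
proof (cases "y = 0")
  case True
  thus ?thesis
    by (simp add: power_mono trans_le_add2)
next
  case False
  hence "(2 * y + 4) ^ c \<le> (6 * y) ^ c"
    by (intro power_mono) auto
  thus ?thesis
    by (simp add: power_mult_distrib trans_le_add1)
qed

lemma running_time_algorithm_le:
  fixes d :: nat
  defines "d \<equiv> time_exponent algorithm"
  assumes I: "valid_instance I" and t: "0 < t" and free: "tK2_free t (dedges I)"
  shows "running_time algorithm I \<le>
    6 ^ (2 * d) * (nverts I + card (dverts I) ^ (3 * t)) ^ (2 * d) + 6 ^ (2 * d)"
proof -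
  let ?n = "nverts I" and ?k = "card (dverts I)"
  let ?y = "?n + ?k ^ (3 * t)"
  have "card (mis (dedges I) {..<j}) \<le> ?k ^ (3 * t) + 1" for j
    by (intro card_mis_demands_le[OF I t free]) simp
  then obtain T s where T: "exec algorithm (input_state I) T s"
      "T \<le> ((?n + 2) * (2 * (?k ^ (3 * t) + 1) + 2)) ^ d"
    using algorithm_correct[OF I] unfolding d_def by blast
  note T(2)
  also have "((?n + 2) * (2 * (?k ^ (3 * t) + 1) + 2)) ^ d \<le> ((2 * ?y + 4) * (2 * ?y + 4)) ^ d"
    by (intro power_mono mult_mono) auto
  also have "\<dots> = (2 * ?y + 4) ^ (2 * d)"
    by (simp only: power_mult power2_eq_square)
  also have "\<dots> \<le> 6 ^ (2 * d) * ?y ^ (2 * d) + 6 ^ (2 * d)"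
    by (rule power_two_mult_add_four_le)
  finally show ?thesis
    using running_time_eq[OF T(1)] by simp
qed

theorem theorem1:
  shows "\<exists>P. approx_algorithm 2 P \<and>
    (\<exists>a b c :: nat. \<forall>I t.
       valid_instance I \<and> t > 1 \<and> tK2_free t (dedges I) \<longrightarrow>
       running_time P I \<le> a * (nverts I + card (dverts I) ^ (b * t)) ^ c + a)"
proof (intro exI conjI allI impI)
  show "approx_algorithm 2 algorithm"
    unfolding approx_algorithm_def
  proof (intro allI impI)
    fix I assume "valid_instance I"
    moreover have "card (mis (dedges I) {..<j}) \<le> (\<Sum>j\<le>nverts I. card (mis (dedges I) {..<j}))"
      if "j \<le> nverts I" for j
      using that by (intro member_le_sum) auto
    ultimately show "\<exists>T s. exec algorithm (input_state I) T s \<and> feasible I (output_edges I s) \<and>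
        cost I (output_edges I s) \<le> 2 * opt I"
      using algorithm_correct by blast
  qed
next
  let ?c = "2 * time_exponent algorithm"
  fix I and t :: nat
  assume "valid_instance I \<and> 1 < t \<and> tK2_free t (dedges I)"
  thus "running_time algorithm I \<le> 6 ^ ?c * (nverts I + card (dverts I) ^ (3 * t)) ^ ?c + 6 ^ ?c"
    using running_time_algorithm_le[of I t] by simp
qed

end
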